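(* Let $P$ be the point group of one of the $2$-dimensional space groups $S$, with lattice $\Pi$, acting on $T^2=\mathbb{R}^2/\Pi$ via $P\subset O(2)$. Then the $P$-equivariant cohomology $H^1=H^1_P(T^2;\mathbb{Z}_2)$, its subgroup $F^1=F^1H^1_P(T^2;\mathbb{Z}_2)$ and the quotient $H^1/F^1$ are, up to isomorphism, as follows (column "ori" is $+$ if $P$ preserves the orientation of $T^2$ and $-$ otherwise): $$ \begin{array}{|c|c|c||c|c|c|} \hline S & P & \text{ori} & H^1_P(T^2;\mathbb{Z}_2) & F^1 & H^1/F^1\\ \hline \text{p1} & 1 & + & \mathbb{Z}_2^{\oplus2} & 0 & \mathbb{Z}_2^{\oplus2}\\ \text{p2} & \mathbb{Z}_2 & + & \mathbb{Z}_2^{\oplus3} & \mathbb{Z}_2 & \mathbb{Z}_2^{\oplus2}\\ \text{p3} & \mathbb{Z}_3 & + & 0 & 0 & 0\\ \text{p4} & \mathbb{Z}_4 & + & \mathbb{Z}_2^{\oplus2} & \mathbb{Z}_2 & \mathbb{Z}_2\\ \text{p6} & \mathbb{Z}_6 & + & \mathbb{Z}_2 & \mathbb{Z}_2 & 0\\ \text{pm/pg} & D_1 & - & \mathbb{Z}_2^{\oplus3} & \mathbb{Z}_2 & \mathbb{Z}_2^{\oplus2}\\ \text{cm} & D_1 & - & \mathbb{Z}_2^{\oplus2} & \mathbb{Z}_2 & \mathbb{Z}_2\\ \text{pmm/pmg/pgg} & D_2 & - & \mathbb{Z}_2^{\oplus4} & \mathbb{Z}_2^{\oplus2} & \mathbb{Z}_2^{\oplus2}\\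 \text{cmm} & D_2 & - & \mathbb{Z}_2^{\oplus3} & \mathbb{Z}_2^{\oplus2} & \mathbb{Z}_2\\ \text{p3m1} & D_3 & - & \mathbb{Z}_2 & \mathbb{Z}_2 & 0\\ \text{p31m} & D_3 & - & \mathbb{Z}_2 & \mathbb{Z}_2 & 0\\ \text{p4m/p4g} & D_4 & - & \mathbb{Z}_2^{\oplus3} & \mathbb{Z}_2^{\oplus2} & \mathbb{Z}_2\\ \text{p6m} & D_6 & - & \mathbb{Z}_2^{\oplus2} & \mathbb{Z}_2^{\oplus2} & 0\\ \hline \end{array} $$
   Context: **Space groups.** A $2$-dimensional space group is a subgroup $S\subset\mathbb{R}^2\rtimes O(2)$ of the group of isometries of $\mathbb{R}^2$ which is an extension $1\to\Pi\to S\to P\to 1$ of a finite group $P\subset O(2)$ (the point group) by a rank $2$ lattice $\Pi\subset\mathbb{R}^2$ of translations, compatibly with $1\to\mathbb{R}^2\to\mathbb{R}^2\rtimes O(2)\to O(2)\to 1$. The standard action of $P\subset O(2)$ on $\mathbb{R}^2$ preserves $\Pi$, so $P$ acts from the left on $T^2=\mathbb{R}^2/\Pi$ (this is the action considered). $\mathbb{Z}_n$ is cyclic of order $n$, $D_n=\langle C,\sigma\mid C^n,\sigma^2,\sigma C\sigma C\rangle$ is dihedral of order $2n$. There are $17$ types of $2$-dimensional space groups, and up to linear isomorphism $(\Pi,P)$ depends only on the type and can be taken as follows. Write $\sigma_x=\begin{pmatrix}-1&0\\0&1\end{pmatrix}$, $\sigma_y=\begin{pmatrix}1&0\\0&-1\end{pmatrix}$,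 and $R_\theta$ for the rotation of $\mathbb{R}^2$ by angle $\theta$. - $\Pi=\mathbb{Z}^2$: p1 ($P$ trivial); p2 ($P=\mathbb{Z}_2$ generated by $R_\pi=-1$); p4 ($P=\mathbb{Z}_4$ generated by $R_{\pi/2}$); pm and pg ($P=D_1$ generated by $\sigma_x$); pmm, pmg and pgg ($P=D_2$ generated by $\sigma_x,\sigma_y$); p4m and p4g ($P=D_4$ generated by $R_{\pi/2},\sigma_x$). - $\Pi=\mathbb{Z}\binom{1}{1}\oplus\mathbb{Z}\binom{-1}{1}$: cm ($P=D_1$ generated by $\sigma_x$); cmm ($P=D_2$ generated by $\sigma_x,\sigma_y$). - $\Pi=\mathbb{Z}\binom{1}{0}\oplus\mathbb{Z}\binom{1/2}{\sqrt3/2}$: p3 ($P=\mathbb{Z}_3$ generated by $R_{2\pi/3}$); p6 ($P=\mathbb{Z}_6$ generated by $R_{\pi/3}$); p3m1 ($P=D_3$ generated by $R_{2\pi/3},\sigma_x$); p31m ($P=D_3$ generated by $R_{2\pi/3},\sigma_y$); p6m ($P=D_6$ generated by $R_{\pi/3},\sigma_y$). Types sharing the same action of $P$ on $T^2$ are grouped together (e.g. pm/pg). **Equivariant cohomology.** $H^n_P(X;\mathbb{Z}_2)=H^n(EP\times_PX;\mathbb{Z}_2)$ is Borel equivariant cohomology. $F^1H^1_P(T^2;\mathbb{Z}_2)$ is the first step of the filtration $H^1_P=F^0\supset F^1\supset F^2=0$ from the Leray--Serre spectral sequence of $T^2\to EP\times_PT^2\to BP$; concretely it is the image of $H^1(BP;\mathbb{Z}_2)=\mathrm{Hom}(P,\mathbb{Z}_2)$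 in $H^1_P(T^2;\mathbb{Z}_2)$, i.e. the kernel of the restriction to the fibre $H^1_P(T^2;\mathbb{Z}_2)\to H^1(T^2;\mathbb{Z}_2)$. *)

theory Defs
  imports "HOL-Analysis.Analysis" "HOL-Algebra.Group_Action" "HOL-Homology.Homology"
begin

section \<open>Singular cohomology with coefficients\<close>

text \<open>
  The group Hom(G,A), for A abelian. Homomorphisms are taken extensional on the
  carrier of G, so that equal homomorphisms are equal as HOL functions.
\<close>

definition hom_group ::
  "('a, 'm) monoid_scheme \<Rightarrow> ('b, 'n) monoid_scheme \<Rightarrow> ('a \<Rightarrow> 'b) monoid" where
  "hom_group G A =
     \<lparr>carrier = hom G A \<inter> extensional (carrier G),
      mult = (\<lambda>f g. \<lambda>x\<in>carrier G. f x \<otimes>\<^bsub>A\<^esub> g x),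
      one = (\<lambda>x\<in>carrier G. \<one>\<^bsub>A\<^esub>)\<rparr>"

definition cochain_group ::
  "nat \<Rightarrow> 'a topology \<Rightarrow> ('b, 'n) monoid_scheme \<Rightarrow> ('a chain \<Rightarrow> 'b) monoid" where
  "cochain_group n X A = hom_group (chain_group n X) A"

definition coboundary ::
  "nat \<Rightarrow> 'a topology \<Rightarrow> ('a chain \<Rightarrow> 'b) \<Rightarrow> ('a chain \<Rightarrow> 'b)" where
  "coboundary n X c = (\<lambda>x\<in>carrier (chain_group (Suc n) X). c (chain_boundary (Suc n) x))"

definition cocycle_group ::
  "nat \<Rightarrow> 'a topology \<Rightarrow> ('b, 'n) monoid_scheme \<Rightarrow> ('a chain \<Rightarrow> 'b) monoid" where
  "cocycle_group n X A =
     (cochain_group n X A)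
       \<lparr>carrier := kernel (cochain_group n X A) (cochain_group (Suc n) X A) (coboundary n X)\<rparr>"

definition coboundary_set ::
  "nat \<Rightarrow> 'a topology \<Rightarrow> ('b, 'n) monoid_scheme \<Rightarrow> ('a chain \<Rightarrow> 'b) set" where
  "coboundary_set n X A =
     (case n of
        0 \<Rightarrow> {\<one>\<^bsub>cochain_group 0 X A\<^esub>}
      | Suc m \<Rightarrow> coboundary m X ` carrier (cochain_group m X A))"

definition cohomology_group ::
  "nat \<Rightarrow> 'a topology \<Rightarrow> ('b, 'n) monoid_scheme \<Rightarrow> ('a chain \<Rightarrow> 'b) set monoid" where
  "cohomology_group n X A = cocycle_group n X A Mod coboundary_set n X A"

definition cochain_map ::
  "nat \<Rightarrow> 'a topology \<Rightarrow> ('a \<Rightarrow> 'c) \<Rightarrow> ('c chain \<Rightarrow> 'b) \<Rightarrow> ('a chain \<Rightarrow> 'b)" where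
  "cochain_map n X f c = (\<lambda>x\<in>carrier (chain_group n X). c (chain_map n f x))"

text \<open>
  The homomorphism induced on cohomology by a continuous map f from X to Y. Classes are
  cosets; the class of a cocycle z of Y is sent to the coset of its pullback, obtained here
  without choosing z by translating the whole pulled-back coset by the coboundaries of X.
\<close>

definition cohomology_map ::
  "nat \<Rightarrow> 'a topology \<Rightarrow> ('b, 'n) monoid_scheme \<Rightarrow> ('a \<Rightarrow> 'c)
    \<Rightarrow> ('c chain \<Rightarrow> 'b) set \<Rightarrow> ('a chain \<Rightarrow> 'b) set" where
  "cohomology_map n X A f C =
     coboundary_set n X A <#>\<^bsub>cochain_group n X A\<^esub> (cochain_map n X f ` C)"


section \<open>Orbit spaces and the Borel construction\<close>

text \<open>The points of the orbit space are the orbits; it carries the quotient topology.\<close>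

definition orbit_space ::
  "('g, 'm) monoid_scheme \<Rightarrow> ('g \<Rightarrow> 'x \<Rightarrow> 'x) \<Rightarrow> 'x topology \<Rightarrow> 'x set topology" where
  "orbit_space G \<phi> X =
     topology (\<lambda>U. U \<subseteq> orbits G (topspace X) \<phi> \<and>
                   openin X {x \<in> topspace X. orbit G \<phi> x \<in> U})"

lemma openin_orbit_space:
  "openin (orbit_space G \<phi> X) U \<longleftrightarrow>
     U \<subseteq> orbits G (topspace X) \<phi> \<and> openin X {x \<in> topspace X. orbit G \<phi> x \<in> U}"
proof -
  let ?P = "\<lambda>U. U \<subseteq> orbits G (topspace X) \<phi> \<and> openin X {x \<in> topspace X. orbit G \<phi> x \<in> U}"
  have 1: "?P (U \<inter> V)" if "?P U" "?P V" for U V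
  proof -
    have "{x \<in> topspace X. orbit G \<phi> x \<in> U \<inter> V} =
          {x \<in> topspace X. orbit G \<phi> x \<in> U} \<inter> {x \<in> topspace X. orbit G \<phi> x \<in> V}" by auto
    then show ?thesis using that by auto
  qed
  have 2: "?P (\<Union>K)" if "\<forall>U\<in>K. ?P U" for K
  proof -
    have "{x \<in> topspace X. orbit G \<phi> x \<in> \<Union>K} =
          (\<Union>U\<in>K. {x \<in> topspace X. orbit G \<phi> x \<in> U})" by auto
    then show ?thesis using that by auto
  qed
  have "istopology ?P"
    unfolding istopology_def using 1 2 by blast
  then show ?thesis
    by (simp add: orbit_space_def topology_inverse')
qed

lemma topspace_orbit_space: "topspace (orbit_space G \<phi> X) = orbits G (topspace X) \<phi>"
proof
  show "topspace (orbit_space G \<phi> X) \<subseteq> orbits G (topspace X) \<phi>"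
    using openin_orbit_space openin_topspace by blast
  have "{x \<in> topspace X. orbit G \<phi> x \<in> orbits G (topspace X) \<phi>} = topspace X"
    by (auto simp: orbits_def)
  then have "openin (orbit_space G \<phi> X) (orbits G (topspace X) \<phi>)"
    by (simp add: openin_orbit_space)
  then show "orbits G (topspace X) \<phi> \<subseteq> topspace (orbit_space G \<phi> X)"
    by (rule openin_subset)
qed

lemma quotient_map_orbit_space: "quotient_map X (orbit_space G \<phi> X) (orbit G \<phi>)"
  unfolding quotient_map_def
proof (intro conjI allI impI)
  show "orbit G \<phi> ` topspace X = topspace (orbit_space G \<phi> X)"
    by (auto simp: topspace_orbit_space orbits_def)
  show "openin X {x \<in> topspace X. orbit G \<phi> x \<in> U} = openin (orbit_space G \<phi> X) U"
    if "U \<subseteq> topspace (orbit_space G \<phi> X)" for U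
    using that by (simp add: openin_orbit_space topspace_orbit_space)
qed

text \<open>
  A model E of EG for a finite discrete group G: a nonempty contractible Hausdorff space with
  a free continuous G-action (for finite G and Hausdorff E such an action makes E a
  principal G-bundle over E/G). Nonemptiness is explicit because the library regards the
  empty space as contractible.
\<close>

definition universal_space ::
  "('g, 'm) monoid_scheme \<Rightarrow> 'e topology \<Rightarrow> ('g \<Rightarrow> 'e \<Rightarrow> 'e) \<Rightarrow> bool" where
  "universal_space G E \<psi> \<longleftrightarrow>
     group G \<and> finite (carrier G) \<and>
     group_action G (topspace E) \<psi> \<and>
     (\<forall>g\<in>carrier G. continuous_map E E (\<psi> g)) \<and>
     (\<forall>g\<in>carrier G. \<forall>e\<in>topspace E. \<psi> g e = e \<longrightarrow> g = \<one>\<^bsub>G\<^esub>) \<and>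
     Hausdorff_space E \<and> contractible_space E \<and> topspace E \<noteq> {}"

text \<open>
  The Borel construction is the quotient of E times X by the diagonal left action. This is the
  usual balanced product when the left action on E is viewed as the right action of inverses.
\<close>

definition borel_construction ::
  "('g, 'm) monoid_scheme \<Rightarrow> 'e topology \<Rightarrow> ('g \<Rightarrow> 'e \<Rightarrow> 'e)
    \<Rightarrow> 'x topology \<Rightarrow> ('g \<Rightarrow> 'x \<Rightarrow> 'x) \<Rightarrow> ('e \<times> 'x) set topology" where
  "borel_construction G E \<psi> X \<phi> =
     orbit_space G (\<lambda>g. map_prod (\<psi> g) (\<phi> g)) (prod_topology E X)"

definition equivariant_cohomology ::
  "nat \<Rightarrow> ('g, 'm) monoid_scheme \<Rightarrow> 'e topology \<Rightarrow> ('g \<Rightarrow> 'e \<Rightarrow> 'e)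
    \<Rightarrow> 'x topology \<Rightarrow> ('g \<Rightarrow> 'x \<Rightarrow> 'x) \<Rightarrow> ('b, 'n) monoid_scheme
    \<Rightarrow> (('e \<times> 'x) set chain \<Rightarrow> 'b) set monoid" where
  "equivariant_cohomology n G E \<psi> X \<phi> A = cohomology_group n (borel_construction G E \<psi> X \<phi>) A"

text \<open>
  The first filtration step in degree one: the image of the cohomology of BG = E/G under the
  bundle projection of the Borel construction, which sends the orbit of (e,x) to the orbit of e.
\<close>

definition equivariant_F1H1 ::
  "('g, 'm) monoid_scheme \<Rightarrow> 'e topology \<Rightarrow> ('g \<Rightarrow> 'e \<Rightarrow> 'e)
    \<Rightarrow> 'x topology \<Rightarrow> ('g \<Rightarrow> 'x \<Rightarrow> 'x) \<Rightarrow> ('b, 'n) monoid_scheme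
    \<Rightarrow> (('e \<times> 'x) set chain \<Rightarrow> 'b) set set" where
  "equivariant_F1H1 G E \<psi> X \<phi> A =
     cohomology_map 1 (borel_construction G E \<psi> X \<phi>) A ((`) fst)
       ` carrier (cohomology_group 1 (orbit_space G \<psi> E) A)"


subsection \<open>Universal spaces exist\<close>

text \<open>
  The space of injective maps from G to the real sequences, with G acting by translation of the
  argument, is a universal space.
\<close>

lemma shift_homotopy_injective:
  fixes d :: "nat \<Rightarrow> real"
  assumes d: "\<And>n. (1 - t) * d n + t * (if even n then d (n div 2) else 0) = 0"
  shows "d n = 0"
proof (cases "t = 1")
  case True
  then show ?thesis using d[of "2 * n"] by simp
next
  case False
  show ?thesis
  proof (induction n rule: less_induct)
    case (less n)
    show ?case
    proof (cases "n = 0")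
      case True
      then show ?thesis using d[of 0] by (simp add: algebra_simps)
    next
      case n: False
      have "(if even n then d (n div 2) else 0) = 0"
        using less.IH[of "n div 2"] n by auto
      then have "(1 - t) * d n = 0" using d[of n] by simp
      then show ?thesis using False by simp
    qed
  qed
qed

lemma universal_space_exists:
  fixes G :: "('g, 'm) monoid_scheme" (structure)
  assumes "group G" "finite (carrier G)"
  shows "\<exists>(E :: ('g \<Rightarrow> nat \<Rightarrow> real) topology) \<psi>. universal_space G E \<psi>"
proof -
  interpret group G by fact
  define C where "C = carrier G"
  define S where "S = {f \<in> extensional C. inj_on f C} \<inter> (UNIV :: ('g \<Rightarrow> nat \<Rightarrow> real) set)"
  define \<psi> where "\<psi> g = (\<lambda>f\<in>S. \<lambda>x\<in>C. f (x \<otimes> g))" for g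
  obtain idx :: "'g \<Rightarrow> nat" where idx: "inj_on idx C"
    using assms(2) finite_imp_inj_to_nat_seg unfolding C_def by metis
  define f0 where "f0 = (\<lambda>x\<in>C. \<lambda>n. if n = Suc (2 * idx x) then 1 else (0::real))"
  define sh where "sh v n = (if even n then v (n div 2) else 0)" for v :: "nat \<Rightarrow> real" and n :: nat
  have f0C: "f0 x (Suc (2 * idx y)) = (if x = y then 1 else 0)" "even n \<Longrightarrow> f0 x n = 0"
    if "x \<in> C" "y \<in> C" for x y n
    using that idx by (auto simp: f0_def inj_on_def)
  have f0S: "f0 \<in> S"
  proof -
    have "inj_on f0 C"
    proof (rule inj_onI)
      fix x y assume xy: "x \<in> C" "y \<in> C" "f0 x = f0 y"
      then have "f0 x (Suc (2 * idx y)) = f0 y (Suc (2 * idx y))" by simp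
      then show "x = y" using f0C(1)[OF xy(1,2)] f0C(1)[OF xy(2,2)] by (auto split: if_splits)
    qed
    then show ?thesis by (simp add: S_def f0_def)
  qed
  define h1 where "h1 = (\<lambda>(t::real, f::'g \<Rightarrow> nat \<Rightarrow> real). \<lambda>x\<in>C. \<lambda>n. (1 - t) * f x n + t * sh (f x) n)"
  define h2 where "h2 = (\<lambda>(t::real, f::'g \<Rightarrow> nat \<Rightarrow> real). \<lambda>x\<in>C. \<lambda>n. (1 - t) * sh (f x) n + t * f0 x n)"
  have coord: "continuous_on T (\<lambda>p::real \<times> ('g \<Rightarrow> nat \<Rightarrow> real). snd p x n)" for T x n
  proof -
    have 1: "continuous_on UNIV (\<lambda>f::'g \<Rightarrow> nat \<Rightarrow> real. f x)"
      by (rule continuous_on_product_coordinates)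
    have 2: "continuous_on UNIV (\<lambda>v::nat \<Rightarrow> real. v n)"
      by (rule continuous_on_product_coordinates)
    have "continuous_on UNIV (\<lambda>f::'g \<Rightarrow> nat \<Rightarrow> real. f x n)"
      using continuous_on_compose2[OF 2 1] by simp
    from continuous_on_compose2[OF this continuous_on_snd[OF continuous_on_id]]
    show ?thesis by simp
  qed
  have shc: "continuous_on T (\<lambda>p::real \<times> ('g \<Rightarrow> nat \<Rightarrow> real). sh (snd p x) n)" for T x n
    unfolding sh_def by (cases "even n") (auto intro: coord)
  have c1: "continuous_on T h1" for T
  proof (rule continuous_on_coordinatewise_then_product)+
    fix x n
    show "continuous_on T (\<lambda>p. h1 p x n)"
      by (cases "x \<in> C") (auto simp: h1_def case_prod_unfold intro!: continuous_intros coord shc)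
  qed
  have c2: "continuous_on T h2" for T
  proof (rule continuous_on_coordinatewise_then_product)+
    fix x n
    show "continuous_on T (\<lambda>p. h2 p x n)"
      by (cases "x \<in> C") (auto simp: h2_def case_prod_unfold intro!: continuous_intros coord shc)
  qed
  have m1: "h1 (t, f) \<in> S" if f: "f \<in> S" for t f
  proof -
    have "inj_on (h1 (t, f)) C"
    proof (rule inj_onI)
      fix x y assume xy: "x \<in> C" "y \<in> C" "h1 (t, f) x = h1 (t, f) y"
      define d where "d n = f x n - f y n" for n
      have "(1 - t) * d n + t * (if even n then d (n div 2) else 0) = 0" for n
        using fun_cong[OF xy(3), of n] xy(1,2)
        by (auto simp: h1_def sh_def d_def algebra_simps split: if_splits)
      then have "d n = 0" for n by (rule shift_homotopy_injective)
      then have "f x = f y" by (auto simp: d_def)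
      then show "x = y" using f xy by (auto simp: S_def inj_on_def)
    qed
    then show ?thesis by (simp add: S_def h1_def)
  qed
  have m2: "h2 (t, f) \<in> S" if f: "f \<in> S" for t f
  proof -
    have "inj_on (h2 (t, f)) C"
    proof (rule inj_onI)
      fix x y assume xy: "x \<in> C" "y \<in> C" "h2 (t, f) x = h2 (t, f) y"
      show "x = y"
      proof (cases "t = 1")
        case True
        then have "f0 x = f0 y" using xy by (auto simp: h2_def)
        then show ?thesis using f0S xy by (auto simp: S_def inj_on_def)
      next
        case False
        have "f x n = f y n" for n
          using fun_cong[OF xy(3), of "2 * n"] xy(1,2) False
          by (simp add: h2_def sh_def f0C(2)[OF xy(1,1)] f0C(2)[OF xy(2,2)])
        then have "f x = f y" by auto
        then show "x = y" using f xy by (auto simp: S_def inj_on_def)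
      qed
    qed
    then show ?thesis by (simp add: S_def h2_def)
  qed
  have ext: "f x = undefined" if "f \<in> S" "x \<notin> C" for f x
    using that by (auto simp: S_def extensional_def)
  have "homotopic_with (\<lambda>_. True) (top_of_set S) (top_of_set S) id (\<lambda>f. h1 (1, f))"
  proof (subst homotopic_with, simp, intro exI[of _ h1] conjI ballI)
    show "continuous_map (prod_topology (top_of_set {0..1}) (top_of_set S)) (top_of_set S) h1"
      using m1 by (auto simp: prod_topology_subtopology_eu intro: c1)
    show "h1 (0, f) = id f" if "f \<in> topspace (top_of_set S)" for f
      using that ext by (auto simp: h1_def fun_eq_iff)
  qed auto
  moreover have "homotopic_with (\<lambda>_. True) (top_of_set S) (top_of_set S) (\<lambda>f. h1 (1, f)) (\<lambda>_. f0)"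
  proof (subst homotopic_with, simp, intro exI[of _ h2] conjI ballI)
    show "continuous_map (prod_topology (top_of_set {0..1}) (top_of_set S)) (top_of_set S) h2"
      using m2 by (auto simp: prod_topology_subtopology_eu intro: c2)
    show "h2 (0, f) = h1 (1, f)" if "f \<in> topspace (top_of_set S)" for f
      by (auto simp: h1_def h2_def fun_eq_iff)
    show "h2 (1, f) = f0" if "f \<in> topspace (top_of_set S)" for f
      by (auto simp: h2_def f0_def fun_eq_iff)
  qed auto
  ultimately have contr: "contractible_space (top_of_set S)"
    unfolding contractible_space_def using homotopic_with_trans by blast
  have S_I: "(\<lambda>x\<in>C. f (x \<otimes> g)) \<in> S" if "f \<in> S" "g \<in> C" for f g
  proof -
    have "inj_on (\<lambda>x\<in>C. f (x \<otimes> g)) C"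
    proof (rule inj_onI)
      fix x y assume xy: "x \<in> C" "y \<in> C" "(\<lambda>x\<in>C. f (x \<otimes> g)) x = (\<lambda>x\<in>C. f (x \<otimes> g)) y"
      then have "f (x \<otimes> g) = f (y \<otimes> g)" by simp
      then have "x \<otimes> g = y \<otimes> g"
        using that xy by (auto simp: S_def C_def dest: inj_onD)
      then show "x = y" using that xy by (simp add: C_def)
    qed
    then show ?thesis by (simp add: S_def)
  qed
  have \<psi>S: "\<psi> g f \<in> S" if "f \<in> S" "g \<in> C" for f g
    using S_I that by (simp add: \<psi>_def)
  have \<psi>mult: "\<psi> (g \<otimes> h) f = \<psi> g (\<psi> h f)" if "f \<in> S" "g \<in> C" "h \<in> C" for f g h
    using that S_I[OF that(1,3)] by (auto simp: \<psi>_def C_def fun_eq_iff m_assoc)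
  have \<psi>one: "\<psi> \<one> f = f" if "f \<in> S" for f
    using that ext by (auto simp: \<psi>_def C_def fun_eq_iff)
  have inv: "inv g \<in> C" "inv g \<otimes> g = \<one>" "g \<otimes> inv g = \<one>" if "g \<in> C" for g
    using that by (auto simp: C_def)
  have \<psi>Bij: "\<psi> g \<in> Bij S" if "g \<in> C" for g
  proof -
    have "bij_betw (\<psi> g) S S"
    proof (rule bij_betw_byWitness[where f' = "\<psi> (inv g)"])
      show "\<forall>f\<in>S. \<psi> (inv g) (\<psi> g f) = f" "\<forall>f\<in>S. \<psi> g (\<psi> (inv g) f) = f"
        using that inv \<psi>mult \<psi>one by metis+
      show "\<psi> g ` S \<subseteq> S" "\<psi> (inv g) ` S \<subseteq> S"
        using that inv \<psi>S by auto
    qed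
    then show ?thesis by (auto simp: Bij_def \<psi>_def)
  qed
  have hom: "\<psi> \<in> hom G (BijGroup S)"
  proof (rule homI)
    show "\<psi> g \<in> carrier (BijGroup S)" if "g \<in> carrier G" for g
      using \<psi>Bij that by (simp add: BijGroup_def C_def)
    show "\<psi> (g \<otimes> h) = \<psi> g \<otimes>\<^bsub>BijGroup S\<^esub> \<psi> h" if gh: "g \<in> carrier G" "h \<in> carrier G" for g h
    proof
      fix f
      show "\<psi> (g \<otimes> h) f = (\<psi> g \<otimes>\<^bsub>BijGroup S\<^esub> \<psi> h) f"
        using gh \<psi>Bij \<psi>mult
        by (cases "f \<in> S") (auto simp: BijGroup_def C_def compose_def, simp add: \<psi>_def)
    qed
  qed
  have act: "group_action G S \<psi>"
    using hom group_BijGroup is_group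
    by (auto simp: group_action_def group_hom_def group_hom_axioms_def)
  have cont: "continuous_map (top_of_set S) (top_of_set S) (\<psi> g)" if "g \<in> C" for g
  proof -
    have "continuous_on S (\<lambda>f. \<lambda>x\<in>C. f (x \<otimes> g))"
    proof (rule continuous_on_coordinatewise_then_product)
      fix x
      show "continuous_on S (\<lambda>f. (\<lambda>x\<in>C. f (x \<otimes> g)) x)"
        by (cases "x \<in> C") (auto intro: continuous_on_subset[OF continuous_on_product_coordinates])
    qed
    then have "continuous_on S (\<psi> g)"
      by (rule continuous_on_eq) (simp add: \<psi>_def)
    then show ?thesis using \<psi>S that by auto
  qed
  have free: "g = \<one>" if "g \<in> C" "f \<in> S" "\<psi> g f = f" for f g
  proof -
    have "f g = f \<one>"
      using fun_cong[OF that(3), of \<one>] that(1,2) by (simp add: \<psi>_def C_def)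
    then show ?thesis using that by (auto simp: S_def inj_on_def C_def)
  qed
  have "Hausdorff_space (product_topology (\<lambda>_. euclidean :: (nat \<Rightarrow> real) topology) (UNIV :: 'g set))"
    by (simp only: Hausdorff_space_product_topology Hausdorff_space_euclidean) simp
  then have haus: "Hausdorff_space (top_of_set S)"
    by (intro Hausdorff_space_subtopology) (simp only: euclidean_product_topology)
  have "universal_space G (top_of_set S) \<psi>"
    unfolding universal_space_def
    using assms act cont free contr f0S haus
    by (auto simp: C_def)
  then show ?thesis by blast
qed


section \<open>Plane space groups\<close>

text \<open>The group of isometries: (a,A) is the map sending x to A x + a.\<close>

definition euclidean_group :: "((real^2) \<times> (real^2^2)) monoid" where
  "euclidean_group =
     \<lparr>carrier = UNIV \<times> {A. orthogonal_matrix A},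
      mult = (\<lambda>(a, A) (b, B). (a + A *v b, A ** B)),
      one = (0, mat 1)\<rparr>"

definition orthogonal_group :: "(real^2^2) monoid" where
  "orthogonal_group = \<lparr>carrier = {A. orthogonal_matrix A}, mult = (**), one = mat 1\<rparr>"

definition lattice_span :: "real^2 \<Rightarrow> real^2 \<Rightarrow> (real^2) set" where
  "lattice_span u v = {real_of_int m *\<^sub>R u + real_of_int n *\<^sub>R v |m n. True}"

definition rank2_lattice :: "(real^2) set \<Rightarrow> bool" where
  "rank2_lattice L \<longleftrightarrow> (\<exists>u v. u \<noteq> v \<and> independent {u, v} \<and> L = lattice_span u v)"

definition translation_lattice :: "((real^2) \<times> (real^2^2)) set \<Rightarrow> (real^2) set" where
  "translation_lattice S = {a. (a, mat 1) \<in> S}"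

definition point_group :: "((real^2) \<times> (real^2^2)) set \<Rightarrow> (real^2^2) monoid" where
  "point_group S = orthogonal_group\<lparr>carrier := snd ` S\<rparr>"

definition space_group :: "((real^2) \<times> (real^2^2)) set \<Rightarrow> bool" where
  "space_group S \<longleftrightarrow>
     subgroup S euclidean_group \<and>
     rank2_lattice (translation_lattice S) \<and> finite (carrier (point_group S))"

definition torus :: "(real^2) set \<Rightarrow> (real^2) set topology" where
  "torus L = orbit_space \<lparr>carrier = L, mult = (+), one = 0\<rparr> (+) euclidean"

text \<open>The points of the torus are cosets, on which a matrix preserving the lattice acts by images.\<close>

definition torus_action :: "real^2^2 \<Rightarrow> (real^2) set \<Rightarrow> (real^2) set" where
  "torus_action A = (`) ((*v) A)"

definition preserves_orientation :: "(real^2^2) monoid \<Rightarrow> bool" where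
  "preserves_orientation P \<longleftrightarrow> (\<forall>A\<in>carrier P. det A > 0)"

definition sigma_x :: "real^2^2" where
  "sigma_x = vector [vector [-1, 0], vector [0, 1]]"

definition sigma_y :: "real^2^2" where
  "sigma_y = vector [vector [1, 0], vector [0, -1]]"

definition rotation :: "real \<Rightarrow> real^2^2" where
  "rotation \<theta> = vector [vector [cos \<theta>, - sin \<theta>], vector [sin \<theta>, cos \<theta>]]"

text \<open>
  The 17 types, with those grouped together that have the same lattice and point group
  (PM stands for pm and pg, PMM for pmm, pmg and pgg, P4M for p4m and p4g).
\<close>

datatype plane_type =
  P1 | P2 | P3 | P4 | P6 | PM | CM | PMM | CMM | P3M1 | P31M | P4M | P6M

definition square_lattice :: "(real^2) set" where
  "square_lattice = lattice_span (vector [1, 0]) (vector [0, 1])"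

definition rhombic_lattice :: "(real^2) set" where
  "rhombic_lattice = lattice_span (vector [1, 1]) (vector [-1, 1])"

definition hexagonal_lattice :: "(real^2) set" where
  "hexagonal_lattice = lattice_span (vector [1, 0]) (vector [1/2, sqrt 3 / 2])"

fun standard_lattice :: "plane_type \<Rightarrow> (real^2) set" where
  "standard_lattice P1 = square_lattice"
| "standard_lattice P2 = square_lattice"
| "standard_lattice P4 = square_lattice"
| "standard_lattice PM = square_lattice"
| "standard_lattice PMM = square_lattice"
| "standard_lattice P4M = square_lattice"
| "standard_lattice CM = rhombic_lattice"
| "standard_lattice CMM = rhombic_lattice"
| "standard_lattice P3 = hexagonal_lattice"
| "standard_lattice P6 = hexagonal_lattice"
| "standard_lattice P3M1 = hexagonal_lattice"
| "standard_lattice P31M = hexagonal_lattice"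
| "standard_lattice P6M = hexagonal_lattice"

fun standard_generators :: "plane_type \<Rightarrow> (real^2^2) set" where
  "standard_generators P1 = {}"
| "standard_generators P2 = {rotation pi}"
| "standard_generators P4 = {rotation (pi / 2)}"
| "standard_generators PM = {sigma_x}"
| "standard_generators PMM = {sigma_x, sigma_y}"
| "standard_generators P4M = {rotation (pi / 2), sigma_x}"
| "standard_generators CM = {sigma_x}"
| "standard_generators CMM = {sigma_x, sigma_y}"
| "standard_generators P3 = {rotation (2 * pi / 3)}"
| "standard_generators P6 = {rotation (pi / 3)}"
| "standard_generators P3M1 = {rotation (2 * pi / 3), sigma_x}"
| "standard_generators P31M = {rotation (2 * pi / 3), sigma_y}"
| "standard_generators P6M = {rotation (pi / 3), sigma_y}"

text \<open>
  A space group belongs to the row t iff its lattice and point group are carried to the standard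
  pair by a common linear isomorphism.
\<close>

definition has_plane_type :: "((real^2) \<times> (real^2^2)) set \<Rightarrow> plane_type \<Rightarrow> bool" where
  "has_plane_type S t \<longleftrightarrow>
     (\<exists>M :: real^2^2. invertible M \<and>
        translation_lattice S = (*v) M ` standard_lattice t \<and>
        carrier (point_group S) =
          (\<lambda>A. M ** A ** matrix_inv M) ` generate orthogonal_group (standard_generators t))"


section \<open>The groups in the table\<close>

definition is_cyclic_of_order :: "nat \<Rightarrow> ('a, 'm) monoid_scheme \<Rightarrow> bool" where
  "is_cyclic_of_order n G \<longleftrightarrow> group G \<and> cyclic_group G \<and> order G = n"

text \<open>
  Generators C and s satisfying the relations of the presentation of the dihedral group exhibit G
  as a quotient of that group, which has order 2n; the condition on the order makes the
  quotient map an isomorphism.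
\<close>

definition is_dihedral :: "nat \<Rightarrow> ('a, 'm) monoid_scheme \<Rightarrow> bool" where
  "is_dihedral n G \<longleftrightarrow>
     group G \<and> order G = 2 * n \<and>
     (\<exists>C\<in>carrier G. \<exists>s\<in>carrier G.
        generate G {C, s} = carrier G \<and>
        C [^]\<^bsub>G\<^esub> n = \<one>\<^bsub>G\<^esub> \<and> s [^]\<^bsub>G\<^esub> (2::nat) = \<one>\<^bsub>G\<^esub> \<and>
        s \<otimes>\<^bsub>G\<^esub> C \<otimes>\<^bsub>G\<^esub> s \<otimes>\<^bsub>G\<^esub> C = \<one>\<^bsub>G\<^esub>)"

abbreviation Z2 :: "int monoid" where
  "Z2 \<equiv> integer_mod_group 2"

abbreviation Z2_sum :: "nat \<Rightarrow> (nat \<Rightarrow> int) monoid" where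
  "Z2_sum k \<equiv> sum_group {..<k} (\<lambda>_. Z2)"

end

theory Submission
  imports Defs
begin

text \<open>
  The product of a model E of EP with the plane is contractible, and the semidirect product of the
  lattice with P acts freely on it with quotient the Borel construction. For a covering with
  contractible total space and deck group G, integrating a 1-cocycle along chains that lead from a
  base point to its translates identifies the first cohomology of the base with Hom(G, A). So
  the first cohomology of the Borel construction is the group of characters of the semidirect
  product, and the filtration step consists of the characters that are trivial on the lattice.
  A character is a pair of a P-invariant character of the lattice and a character of P. All three
  groups in a row of the table have exponent 2, hence it suffices to count characters.
\<close>

section \<open>Lifting along regular coverings\<close>

text \<open>The group that counts is the semidirect product and not the space group
  \<open>S\<close>. The linear action of \<open>P\<close> on the torus fixes the coset of 0, so the
  extension attached to the Borel construction splits even when \<open>S\<close> does not; this is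
  why pm and pg give the same answer, and why the two restrictions of a character can be chosen
  independently. The model \<open>E\<close> is only known to be contractible and Hausdorff, so
  neither cell structures nor local connectedness are at hand. Two facts carry the argument:
  simplices lift, uniquely up to the group, and a contractible space has no first homology. In
  degree one, simplices of dimension at most 2 suffice; they are retracts of the plane, which
  reduces lifting to bisection of a square. Fundamental groups are bypassed by integrating along
  1-chains in place of paths, so contractibility enters through homology alone. Modulo 2 the lattice
  matters only through its quotient by twice itself. The integer matrices by which \<open>P\<close>
  acts survive a change of basis by a linear isomorphism, so they can be read off the standard
  pairs.\<close>

locale continuous_action = group G for G :: "('g, 'm) monoid_scheme" (structure) +
  fixes Y :: "'y topology" and act :: "'g \<Rightarrow> 'y \<Rightarrow> 'y"
  assumes act_one: "y \<in> topspace Y \<Longrightarrow> act \<one> y = y"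
    and act_mult: "\<lbrakk>g \<in> carrier G; h \<in> carrier G; y \<in> topspace Y\<rbrakk> \<Longrightarrow> act (g \<otimes> h) y = act g (act h y)"
    and act_cont: "g \<in> carrier G \<Longrightarrow> continuous_map Y Y (act g)"
begin

lemma act_closed: "\<lbrakk>g \<in> carrier G; y \<in> topspace Y\<rbrakk> \<Longrightarrow> act g y \<in> topspace Y"
  using act_cont continuous_map_funspace by blast

lemma act_inv: "\<lbrakk>g \<in> carrier G; y \<in> topspace Y\<rbrakk> \<Longrightarrow> act (inv g) (act g y) = y"
  by (metis act_mult act_one inv_closed l_inv)

lemma orbit_eq_iff:
  assumes "x \<in> topspace Y" "y \<in> topspace Y"
  shows "orbit G act x = orbit G act y \<longleftrightarrow> (\<exists>g\<in>carrier G. y = act g x)"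
proof
  assume "orbit G act x = orbit G act y"
  moreover have "y \<in> orbit G act y"
    unfolding orbit_def using act_one[OF assms(2)] by force
  ultimately show "\<exists>g\<in>carrier G. y = act g x" by (auto simp: orbit_def)
next
  assume "\<exists>g\<in>carrier G. y = act g x"
  then obtain g where g: "g \<in> carrier G" "y = act g x" by auto
  show "orbit G act x = orbit G act y"
  proof
    show "orbit G act y \<subseteq> orbit G act x"
      using g assms by (auto simp: orbit_def simp flip: act_mult)
    show "orbit G act x \<subseteq> orbit G act y"
    proof
      fix z assume "z \<in> orbit G act x"
      then obtain h where h: "h \<in> carrier G" "z = act h x" by (auto simp: orbit_def)
      then have "z = act (h \<otimes> inv g) y"
        using g assms act_inv act_mult act_closed by simp
      then show "z \<in> orbit G act y" using g h by (auto simp: orbit_def)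
    qed
  qed
qed

text \<open>The saturation of an open set is the union over all \<open>g\<close> of its preimages
  under \<open>act g\<close>, hence open however large \<open>G\<close> is.\<close>

lemma open_map_orbit: "open_map Y (orbit_space G act Y) (orbit G act)"
  unfolding open_map_def
proof (intro allI impI)
  fix U assume U: "openin Y U"
  have UY: "U \<subseteq> topspace Y" by (rule openin_subset[OF U])
  have "{x \<in> topspace Y. orbit G act x \<in> orbit G act ` U} = (\<Union>g\<in>carrier G. {x \<in> topspace Y. act g x \<in> U})"
    using UY by (auto simp: image_iff) (metis orbit_eq_iff subsetD, metis orbit_eq_iff act_closed)
  moreover have "openin Y (\<Union>g\<in>carrier G. {x \<in> topspace Y. act g x \<in> U})"
    using openin_continuous_map_preimage[OF act_cont U] by (intro openin_Union) auto
  moreover have "orbit G act ` U \<subseteq> orbits G (topspace Y) act"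
    using UY by (auto simp: orbits_def)
  ultimately show "openin (orbit_space G act Y) (orbit G act ` U)"
    by (simp add: openin_orbit_space)
qed

lemma orbit_surj: "orbit G act ` topspace Y = topspace (orbit_space G act Y)"
  by (auto simp: topspace_orbit_space orbits_def)

lemma orbit_cont: "continuous_map Y (orbit_space G act Y) (orbit G act)"
  by (rule quotient_imp_continuous_map[OF quotient_map_orbit_space])

text \<open>The Hausdorff property separates \<open>y\<close> from each of its finitely many other
  translates; intersecting the resulting neighbourhoods of \<open>y\<close> works for all
  \<open>g\<close> at once.\<close>

lemma finite_free_imp_wandering:
  assumes fin: "finite (carrier G)" and haus: "Hausdorff_space Y"
    and free: "\<And>g y. \<lbrakk>g \<in> carrier G; y \<in> topspace Y; act g y = y\<rbrakk> \<Longrightarrow> g = \<one>"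
    and y: "y \<in> topspace Y"
  shows "\<exists>U. openin Y U \<and> y \<in> U \<and> (\<forall>g\<in>carrier G. g \<noteq> \<one> \<longrightarrow> act g ` U \<inter> U = {})"
proof -
  have "\<exists>W. openin Y W \<and> y \<in> W \<and> act g ` W \<inter> W = {}" if g: "g \<in> carrier G - {\<one>}" for g
  proof -
    have "act g y \<in> topspace Y" "act g y \<noteq> y"
      using g free[of g y] y act_closed by auto
    then obtain U V where UV: "openin Y U" "openin Y V" "act g y \<in> U" "y \<in> V" "disjnt U V"
      using haus y unfolding Hausdorff_space_def by metis
    let ?W = "V \<inter> {x \<in> topspace Y. act g x \<in> U}"
    have "openin Y ?W"
      using openin_Int[OF UV(2) openin_continuous_map_preimage[OF act_cont UV(1)]] g by auto
    then show ?thesis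
      using UV y by (intro exI[of _ ?W]) (auto simp: disjnt_def)
  qed
  then obtain W where W: "\<And>g. g \<in> carrier G - {\<one>} \<Longrightarrow> openin Y (W g) \<and> y \<in> W g \<and> act g ` W g \<inter> W g = {}"
    by metis
  \<comment> \<open>For the trivial group the intersection is over the empty family and equals
    \<open>UNIV\<close>; the factor \<open>topspace Y\<close> keeps \<open>U\<close> open in that
    case.\<close>
  define U where "U = topspace Y \<inter> (\<Inter>g\<in>carrier G - {\<one>}. W g)"
  have "openin Y U"
    unfolding U_def by (rule openin_Int_Inter) (use fin W in auto)
  moreover have "y \<in> U" using W y by (auto simp: U_def)
  moreover have "act g ` U \<inter> U = {}" if "g \<in> carrier G" "g \<noteq> \<one>" for g
  proof -
    have "U \<subseteq> W g" using that by (auto simp: U_def)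
    then show ?thesis using W[of g] that by blast
  qed
  ultimately show ?thesis by blast
qed

end

text \<open>A covering is described from above, by slices in \<open>Y\<close>, in place of evenly
  covered neighbourhoods in \<open>B\<close>. The base is kept abstract instead of being
  \<open>orbit_space G act Y\<close>, because the Borel construction arises as a quotient of a
  quotient: by the lattice and then by \<open>P\<close>.\<close>

locale regular_cover = continuous_action G Y act
  for G :: "('g, 'm) monoid_scheme" (structure) and Y :: "'y topology" and act :: "'g \<Rightarrow> 'y \<Rightarrow> 'y" +
  fixes B :: "'b topology" and p :: "'y \<Rightarrow> 'b"
  assumes wandering: "y \<in> topspace Y \<Longrightarrow>
      \<exists>U. openin Y U \<and> y \<in> U \<and> (\<forall>g\<in>carrier G. g \<noteq> \<one> \<longrightarrow> act g ` U \<inter> U = {})"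
    and p_cont: "continuous_map Y B p"
    and p_open: "open_map Y B p"
    and p_surj: "p ` topspace Y = topspace B"
    and p_fibre: "\<lbrakk>x \<in> topspace Y; y \<in> topspace Y\<rbrakk> \<Longrightarrow> p x = p y \<longleftrightarrow> (\<exists>g\<in>carrier G. y = act g x)"
begin

lemma p_act: "\<lbrakk>g \<in> carrier G; y \<in> topspace Y\<rbrakk> \<Longrightarrow> p (act g y) = p y"
  using p_fibre[of y "act g y"] act_closed by auto

lemma slice:
  assumes "y \<in> topspace Y"
  obtains U where "openin Y U" "y \<in> U"
    "\<And>g u. \<lbrakk>g \<in> carrier G; u \<in> U; act g u \<in> U\<rbrakk> \<Longrightarrow> g = \<one>"
proof -
  obtain U where U: "openin Y U" "y \<in> U"
    and dis: "\<forall>g\<in>carrier G. g \<noteq> \<one> \<longrightarrow> act g ` U \<inter> U = {}"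
    using wandering[OF assms] by (elim exE conjE)
  have "g = \<one>" if "g \<in> carrier G" "u \<in> U" "act g u \<in> U" for g u
    using bspec[OF dis that(1)] that(2,3) by auto
  with U show ?thesis by (rule that)
qed

lemma act_free:
  assumes "g \<in> carrier G" "y \<in> topspace Y" "act g y = y"
  shows "g = \<one>"
  using slice[OF assms(2)] assms(1,3) by metis

text \<open>Points at which two lifts differ by a fixed group element form an open set, so on a
  connected domain a single element works throughout.\<close>

lemma lift_unique:
  assumes Z: "connected_space Z"
    and f: "continuous_map Z Y f" and f': "continuous_map Z Y f'"
    and eq: "\<And>z. z \<in> topspace Z \<Longrightarrow> p (f z) = p (f' z)"
    and z0: "z0 \<in> topspace Z" "g \<in> carrier G" "f' z0 = act g (f z0)"
    and z: "z \<in> topspace Z"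
  shows "f' z = act g (f z)"
proof -
  define D where "D h = {z \<in> topspace Z. f' z = act h (f z)}" for h
  have fY: "f z \<in> topspace Y" "f' z \<in> topspace Y" if "z \<in> topspace Z" for z
    using f f' that by (auto simp: continuous_map_def)
  have opn: "openin Z (D h)" if h: "h \<in> carrier G" for h
  proof (subst openin_subopen, intro ballI)
    fix x assume x: "x \<in> D h"
    then have xZ: "x \<in> topspace Z" and fx: "f' x = act h (f x)" by (auto simp: D_def)
    obtain U where U: "openin Y U" "f x \<in> U"
      "\<And>g u. \<lbrakk>g \<in> carrier G; u \<in> U; act g u \<in> U\<rbrakk> \<Longrightarrow> g = \<one>"
      using slice[OF fY(1)[OF xZ]] by metis
    \<comment> \<open>\<open>W\<close> is the translate of \<open>U\<close> by \<open>h\<close>.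
      Where \<open>f\<close> lands in \<open>U\<close> and \<open>f'\<close> in \<open>W\<close>,
      the element \<open>k\<close> relating them is such that \<open>inv h \<otimes> k\<close>
      carries a point of \<open>U\<close> into \<open>U\<close>, so \<open>k = h\<close>.\<close>
    define W where "W = {y \<in> topspace Y. act (inv h) y \<in> U}"
    have W: "openin Y W" unfolding W_def
      by (rule openin_continuous_map_preimage[OF act_cont]) (use h U in auto)
    define N where "N = {z \<in> topspace Z. f z \<in> U} \<inter> {z \<in> topspace Z. f' z \<in> W}"
    have "openin Z N" unfolding N_def
      using openin_continuous_map_preimage[OF f U(1)] openin_continuous_map_preimage[OF f' W] by auto
    moreover have "x \<in> N"
      using xZ U fx fY[OF xZ] act_inv[OF h] by (auto simp: N_def W_def)
    moreover have "N \<subseteq> D h"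
    proof
      fix z assume zN: "z \<in> N"
      then have zZ: "z \<in> topspace Z" by (auto simp: N_def)
      obtain k where k: "k \<in> carrier G" "f' z = act k (f z)"
        using p_fibre[OF fY(1)[OF zZ] fY(2)[OF zZ]] eq[OF zZ] by blast
      have "act (inv h \<otimes> k) (f z) \<in> U"
        using zN k h fY(1)[OF zZ] by (auto simp: N_def W_def act_mult)
      moreover have "f z \<in> U" using zN by (auto simp: N_def)
      ultimately have "inv h \<otimes> k = \<one>"
        using U(3) h k(1) by (meson inv_closed m_closed)
      then have "k = h" using h k(1)
        by (metis inv_closed inv_inv inv_solve_left inv_unique' l_one m_closed one_closed r_inv r_one)
      then show "z \<in> D h" using k zZ by (auto simp: D_def)
    qed
    ultimately show "\<exists>T. openin Z T \<and> x \<in> T \<and> T \<subseteq> D h" by blast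
  qed
  \<comment> \<open>\<open>R\<close> collects all other group elements. It is open, and freeness
    makes it disjoint from \<open>D g\<close>, so connectedness leaves only
    \<open>D g\<close>.\<close>
  define R where "R = (\<Union>h\<in>carrier G - {g}. D h)"
  have "openin Z (D g)" "openin Z R"
    unfolding R_def using opn z0 by auto
  moreover have "topspace Z \<subseteq> D g \<union> R"
  proof
    fix z assume zZ: "z \<in> topspace Z"
    obtain k where "k \<in> carrier G" "f' z = act k (f z)"
      using p_fibre[OF fY(1)[OF zZ] fY(2)[OF zZ]] eq[OF zZ] by blast
    then show "z \<in> D g \<union> R" using zZ by (auto simp: D_def R_def)
  qed
  moreover have "D g \<inter> R = {}"
  proof -
    have "h = g" if "h \<in> carrier G" "z \<in> topspace Z" "act g (f z) = act h (f z)" for h z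
    proof -
      have "act (inv h \<otimes> g) (f z) = f z"
        using that z0(2) fY act_inv act_mult inv_closed by metis
      then have "inv h \<otimes> g = \<one>"
        using act_free fY that z0(2) by (meson inv_closed m_closed)
      then show ?thesis using that z0(2) by (metis inv_closed inv_equality inv_inv)
    qed
    then show ?thesis by (force simp: D_def R_def)
  qed
  moreover have "D g \<noteq> {}" using z0 by (auto simp: D_def)
  ultimately have "R = {}"
    using Z unfolding connected_space_def by blast
  then show ?thesis
    using \<open>topspace Z \<subseteq> D g \<union> R\<close> z by (auto simp: D_def)
qed

definition has_lift :: "'z topology \<Rightarrow> ('z \<Rightarrow> 'b) \<Rightarrow> bool" where
  "has_lift Z f \<longleftrightarrow> (\<exists>F. continuous_map Z Y F \<and> (\<forall>z\<in>topspace Z. p (F z) = f z))"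

lemma has_lift_subset:
  assumes "has_lift (subtopology Z S) f" "T \<subseteq> S"
  shows "has_lift (subtopology Z T) f"
proof -
  obtain F where F: "continuous_map (subtopology Z S) Y F" "\<And>z. z \<in> topspace Z \<Longrightarrow> z \<in> S \<Longrightarrow> p (F z) = f z"
    using assms(1) unfolding has_lift_def by auto
  then show ?thesis
    unfolding has_lift_def using assms(2) continuous_map_from_subtopology_mono[OF F(1) assms(2)]
    by (intro exI[of _ F]) auto
qed

text \<open>On a slice \<open>p\<close> is injective, and it is open everywhere, so its inverse over
  the image of the slice is a continuous section; composing it with \<open>f\<close> gives the local
  lift.\<close>

lemma has_lift_local:
  assumes f: "continuous_map Z B f" and z: "z \<in> topspace Z"
  shows "\<exists>V. openin Z V \<and> z \<in> V \<and> has_lift (subtopology Z V) f"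
proof -
  obtain y where y: "y \<in> topspace Y" "p y = f z"
  proof -
    have "f z \<in> p ` topspace Y" using f z unfolding p_surj by (auto simp: continuous_map_def)
    then show thesis using that by auto
  qed
  obtain U where U: "openin Y U" "y \<in> U"
    "\<And>g u. \<lbrakk>g \<in> carrier G; u \<in> U; act g u \<in> U\<rbrakk> \<Longrightarrow> g = \<one>"
    using slice[OF y(1)] by metis
  have US: "U \<subseteq> topspace Y" using U(1) by (rule openin_subset)
  have inj: "inj_on p U"
  proof (rule inj_onI)
    fix a b assume ab: "a \<in> U" "b \<in> U" "p a = p b"
    then obtain g where g: "g \<in> carrier G" "b = act g a"
      using p_fibre US by (meson subsetD)
    then have "g = \<one>" using U(3)[of g a] ab by simp
    then show "a = b" using g act_one US ab by auto
  qed
  define V where "V = {z \<in> topspace Z. f z \<in> p ` U}"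
  have V: "openin Z V" unfolding V_def
    by (rule openin_continuous_map_preimage[OF f]) (use p_open U in \<open>auto simp: open_map_def\<close>)
  define F where "F = inv_into U p \<circ> f"
  have F: "F x \<in> U" "p (F x) = f x" if "x \<in> V" for x
    using that by (auto simp: V_def F_def f_inv_into_f inv_into_into)
  have cont: "continuous_map (subtopology Z V) Y F"
  proof (unfold continuous_map_def, intro conjI allI impI)
    show "F \<in> topspace (subtopology Z V) \<rightarrow> topspace Y" using F US by auto
    fix W assume W: "openin Y W"
    have "{x \<in> topspace (subtopology Z V). F x \<in> W} = V \<inter> {x \<in> topspace Z. f x \<in> p ` (U \<inter> W)}"
    proof -
      have "F x \<in> W \<longleftrightarrow> f x \<in> p ` (U \<inter> W)" if "x \<in> V" for x
      proof
        assume "f x \<in> p ` (U \<inter> W)"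
        then obtain u where "u \<in> U" "u \<in> W" "f x = p u" by auto
        then show "F x \<in> W" using F[OF that] inj by (auto dest: inj_onD)
      next
        assume "F x \<in> W"
        then show "f x \<in> p ` (U \<inter> W)" using F[OF that] by (metis IntI imageI)
      qed
      then show ?thesis using V openin_subset by fastforce
    qed
    moreover have "openin Z {x \<in> topspace Z. f x \<in> p ` (U \<inter> W)}"
      by (rule openin_continuous_map_preimage[OF f])
        (use p_open U W in \<open>auto simp: open_map_def openin_Int\<close>)
    ultimately show "openin (subtopology Z V) {x \<in> topspace (subtopology Z V). F x \<in> W}"
      by (auto simp: openin_subtopology_Int2)
  qed
  have "z \<in> V" using y U(2) z unfolding V_def by (metis (mono_tags, lifting) imageI mem_Collect_eq)
  with V cont F show ?thesis unfolding has_lift_def by force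
qed

text \<open>On the connected overlap the two lifts differ by a single group element
  \<open>g\<close>; translating the second by \<open>g\<close> makes them agree, and continuous maps
  on two closed sets paste.\<close>

lemma has_lift_union:
  assumes S: "closedin Z S" and T: "closedin Z T"
    and conn: "connectedin Z (S \<inter> T)" and ne: "S \<inter> T \<noteq> {}"
    and lS: "has_lift (subtopology Z S) f" and lT: "has_lift (subtopology Z T) f"
  shows "has_lift (subtopology Z (S \<union> T)) f"
proof -
  have SZ: "S \<subseteq> topspace Z" "T \<subseteq> topspace Z"
    using S T closedin_subset by auto
  obtain F1 where F1: "continuous_map (subtopology Z S) Y F1" "\<And>z. z \<in> S \<Longrightarrow> p (F1 z) = f z"
    using lS SZ unfolding has_lift_def by auto
  obtain F2 where F2: "continuous_map (subtopology Z T) Y F2" "\<And>z. z \<in> T \<Longrightarrow> p (F2 z) = f z"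
    using lT SZ unfolding has_lift_def by auto
  have F1Y: "F1 z \<in> topspace Y" if "z \<in> S" for z
    using F1(1) that SZ unfolding continuous_map_def by auto
  have F2Y: "F2 z \<in> topspace Y" if "z \<in> T" for z
    using F2(1) that SZ unfolding continuous_map_def by auto
  obtain z0 where z0: "z0 \<in> S" "z0 \<in> T" using ne by blast
  obtain g where g: "g \<in> carrier G" "F1 z0 = act g (F2 z0)"
    using p_fibre[OF F2Y[OF z0(2)] F1Y[OF z0(1)]] F1(2)[OF z0(1)] F2(2)[OF z0(2)] by auto
  have eq: "F1 z = act g (F2 z)" if "z \<in> S" "z \<in> T" for z
  proof (rule lift_unique[where Z = "subtopology Z (S \<inter> T)" and f = F2 and f' = F1 and z = z])
    show "connected_space (subtopology Z (S \<inter> T))"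
      using conn by (simp add: connectedin_def)
    show "continuous_map (subtopology Z (S \<inter> T)) Y F2" "continuous_map (subtopology Z (S \<inter> T)) Y F1"
      using F1(1) F2(1) by (auto elim: continuous_map_from_subtopology_mono)
  qed (use that z0 g SZ F1(2) F2(2) in auto)
  define F where "F = (\<lambda>z. if z \<in> S then F1 z else act g (F2 z))"
  have "continuous_map (subtopology Z (S \<union> T)) Y F"
  proof (rule pasting_lemma_closed[where I = UNIV and T = "\<lambda>b. if b then S else T"
        and f = "\<lambda>b. if b then F1 else act g \<circ> F2"])
    show "closedin (subtopology Z (S \<union> T)) (if b then S else T)" for b
      using S T by (auto intro: closedin_subset_topspace)
    have "continuous_map (subtopology Z T) Y (act g \<circ> F2)"
      by (rule continuous_map_compose[OF F2(1) act_cont[OF g(1)]])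
    then show "continuous_map (subtopology (subtopology Z (S \<union> T)) (if b then S else T)) Y
       (if b then F1 else act g \<circ> F2)" for b
      using F1(1) by (auto simp: subtopology_subtopology Int_absorb1)
  qed (use eq in \<open>auto simp: F_def split: if_splits\<close>)
  moreover have "p (F z) = f z" if "z \<in> S \<union> T" for z
    using that F1(2) F2(2) F2Y p_act[OF g(1)] by (auto simp: F_def)
  ultimately show ?thesis unfolding has_lift_def by auto
qed

text \<open>Bisection in the form of \<open>Bolzano\<close> takes the place of a Lebesgue number.
  Vertical intervals are glued first, giving a thin strip of full height around each
  \<open>s\<close>; then the strips are glued. All overlaps are segments, hence connected.\<close>

lemma has_lift_square:
  fixes f :: "real \<times> real \<Rightarrow> 'b"
  assumes f: "continuous_map euclidean B f"
  shows "has_lift (top_of_set ({0..1} \<times> {0..1})) f"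
proof -
  define L where "L a b c d \<longleftrightarrow> has_lift (top_of_set ({a..b} \<times> {c..d})) f" for a b c d
  \<comment> \<open>The width \<delta> may depend on the vertical interval; stacking two rectangles
    takes the smaller of their widths.\<close>
  define strip where "strip s c d \<longleftrightarrow> (\<exists>\<delta>>0. \<forall>a b. a \<le> s \<and> s \<le> b \<and> b - a < \<delta> \<longrightarrow> L a b c d)" for s c d
  have strip: "strip s 0 1" for s
  proof (rule Bolzano[where P = "strip s" and a = 0 and b = 1])
    fix c d e :: real
    assume cde: "strip s c d" "strip s d e" "c \<le> d" "d \<le> e"
    obtain \<delta>1 where 1: "\<delta>1 > 0" "\<And>a b. \<lbrakk>a \<le> s; s \<le> b; b - a < \<delta>1\<rbrakk> \<Longrightarrow> L a b c d"
      using cde(1) unfolding strip_def by auto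
    obtain \<delta>2 where 2: "\<delta>2 > 0" "\<And>a b. \<lbrakk>a \<le> s; s \<le> b; b - a < \<delta>2\<rbrakk> \<Longrightarrow> L a b d e"
      using cde(2) unfolding strip_def by auto
    have "L a b c e" if ab: "a \<le> s" "s \<le> b" "b - a < min \<delta>1 \<delta>2" for a b
    proof -
      have eq: "{a..b} \<times> {c..e} = {a..b} \<times> {c..d} \<union> {a..b} \<times> {d..e}"
        using cde by auto
      have int: "({a..b} \<times> {c..d}) \<inter> ({a..b} \<times> {d..e}) = {a..b} \<times> {d}"
        using cde by auto
      show ?thesis unfolding L_def eq
      proof (rule has_lift_union)
        show "connectedin euclidean (({a..b} \<times> {c..d}) \<inter> ({a..b} \<times> {d..e}))"
          unfolding int by (simp add: connected_Times)
        show "{a..b} \<times> {c..d} \<inter> {a..b} \<times> {d..e} \<noteq> {}" unfolding int using ab by auto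
        show "has_lift (top_of_set ({a..b} \<times> {c..d})) f" "has_lift (top_of_set ({a..b} \<times> {d..e})) f"
          using 1(2)[of a b] 2(2)[of a b] ab by (auto simp: L_def)
      qed (auto simp: closed_Times)
    qed
    then show "strip s c e"
      unfolding strip_def using 1(1) 2(1) by (intro exI[of _ "min \<delta>1 \<delta>2"]) auto
  next
    fix x :: real
    obtain V where V: "open V" "(s, x) \<in> V" "has_lift (top_of_set V) f"
      using has_lift_local[OF f, of "(s, x)"] by auto
    obtain e where e: "e > 0" "ball (s, x) e \<subseteq> V"
      using V open_contains_ball by metis
    have "L a b c d"
      if "a \<le> s" "s \<le> b" "b - a < e / 2" "c \<le> x" "x \<le> d" "d - c < e / 2" for a b c d
      unfolding L_def
    proof (rule has_lift_subset[OF V(3)])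
      have "dist (s, x) (u, v) < e" if "u \<in> {a..b}" "v \<in> {c..d}" for u v
      proof -
        have "dist s u < e / 2" "dist x v < e / 2"
          using that \<open>a \<le> s\<close> \<open>s \<le> b\<close> \<open>b - a < e / 2\<close> \<open>c \<le> x\<close> \<open>x \<le> d\<close> \<open>d - c < e / 2\<close>
          by (auto simp: dist_real_def abs_if)
        then show ?thesis
          using sqrt_sum_squares_le_sum_abs[of "dist s u" "dist x v"] by (simp add: dist_Pair_Pair)
      qed
      then show "{a..b} \<times> {c..d} \<subseteq> V" using e(2) by fastforce
    qed
    then have "strip s c d" if "c \<le> x" "x \<le> d" "d - c < e / 2" for c d
      unfolding strip_def using e(1) that by (intro exI[of _ "e / 2"]) auto
    then show "\<exists>d>0. \<forall>a b. a \<le> x \<and> x \<le> b \<and> b - a < d \<longrightarrow> strip s a b"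
      using e(1) by (intro exI[of _ "e / 2"]) auto
  qed auto
  have "L 0 1 0 1"
  proof (rule Bolzano[where P = "\<lambda>a b. L a b 0 1" and a = 0 and b = 1])
    fix a b c :: real
    assume abc: "L a b 0 1" "L b c 0 1" "a \<le> b" "b \<le> c"
    have eq: "{a..c} \<times> {0..1} = {a..b} \<times> {0..1::real} \<union> {b..c} \<times> {0..1}"
      using abc by auto
    have int: "({a..b} \<times> {0..1}) \<inter> ({b..c} \<times> {0..1::real}) = {b} \<times> {0..1}"
      using abc by auto
    show "L a c 0 1" unfolding L_def eq
    proof (rule has_lift_union)
      show "connectedin euclidean (({a..b} \<times> {0..1}) \<inter> ({b..c} \<times> {0..1::real}))"
        unfolding int by (simp add: connected_Times)
      show "{a..b} \<times> {0..1} \<inter> {b..c} \<times> {0..1::real} \<noteq> {}" unfolding int by auto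
    qed (use abc in \<open>auto simp: closed_Times L_def\<close>)
  qed (use strip in \<open>auto simp: strip_def\<close>)
  then show ?thesis by (simp add: L_def)
qed

end

section \<open>Chains in contractible spaces\<close>

lemma singular_simplex_value:
  "\<lbrakk>singular_simplex n X f; x \<in> standard_simplex n\<rbrakk> \<Longrightarrow> f x \<in> topspace X"
  by (auto simp: singular_simplex_def continuous_map_def)

text \<open>A contraction shrinks the space to some point \<open>b\<close>; path connectedness of a
  contractible space moves \<open>b\<close> to the prescribed \<open>a\<close>, and homotopic maps
  send a cycle to homologous cycles.\<close>

lemma contractible_imp_homologous:
  assumes X: "contractible_space X" and c: "singular_relcycle n X {} c"
    and a: "a \<in> topspace X"
  shows "homologous_rel n X {} c (chain_map n (\<lambda>_. a) c)"
proof -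
  obtain b where b: "homotopic_with (\<lambda>_. True) X X id (\<lambda>_. b)"
    using X unfolding contractible_space_def by blast
  have bX: "b \<in> topspace X"
    using homotopic_with_imp_continuous_maps[OF b] a by (auto simp: continuous_map_def)
  have "path_component_of X b a"
    using contractible_imp_path_connected_space[OF X] a bX
    by (simp add: path_connected_space_iff_path_component)
  then have "homotopic_with (\<lambda>_. True) X X (\<lambda>_. b) (\<lambda>_. a)"
    by (simp add: homotopic_constant_maps)
  then have "homotopic_with (\<lambda>h. h \<in> {} \<rightarrow> {}) X X id (\<lambda>_. a)"
    using b homotopic_with_trans[of "\<lambda>_. True"] by simp
  from homotopic_imp_homologous_rel_chain_maps[OF this c]
  show ?thesis
    using c chain_map_ident[of n X c] by (simp add: singular_cycle)
qed

text \<open>The cycle is homologous to its image in a one-point subspace, where cycles of positive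
  degree bound. In degree 0 a single point is a counterexample, hence
  \<open>n \<ge> 1\<close>.\<close>

lemma contractible_cycle_is_boundary:
  assumes X: "contractible_space X" and n: "n \<ge> 1"
    and c: "singular_chain n X c" "chain_boundary n c = 0"
  obtains d where "singular_chain (Suc n) X d" "chain_boundary (Suc n) d = c"
proof (cases "topspace X = {}")
  \<comment> \<open>The empty space has no point to contract to, but also no nonzero chains.\<close>
  case True
  then have "c = 0" using c singular_chain_empty by blast
  then show ?thesis using that[of 0] by simp
next
  case False
  then obtain a where a: "a \<in> topspace X" by blast
  have cyc: "singular_relcycle n X {} c" using c by (simp add: singular_cycle)
  let ?P = "subtopology X {a}"
  have P: "topspace ?P = {a}" using a by auto
  have "continuous_map X ?P (\<lambda>_. a)" using a by (simp add: continuous_map_in_subtopology)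
  then have "singular_relcycle n ?P {} (chain_map n (\<lambda>_. a) c)"
    using c chain_boundary_chain_map[OF c(1), of "\<lambda>_. a"]
    by (simp add: singular_cycle singular_chain_chain_map)
  then have "singular_relboundary n ?P {} (chain_map n (\<lambda>_. a) c)"
    using singular_boundary_eq_cycle_singleton[OF P n] by blast
  then have "singular_relboundary n X {} (chain_map n (\<lambda>_. a) c)"
    using singular_boundary_mono[of "{a}" "topspace X" n X] a by simp
  moreover have "singular_relboundary n X {} (c - chain_map n (\<lambda>_. a) c)"
    using contractible_imp_homologous[OF X cyc a] by (simp add: homologous_rel_def)
  ultimately have "singular_relboundary n X {} c"
    using singular_relboundary_add by fastforce
  then show ?thesis using that by (auto simp: singular_boundary)
qed

text \<open>Both 0-simplices are homologous to the constant simplex at the value of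
  \<sigma>.\<close>

lemma contractible_connecting_chain:
  assumes X: "contractible_space X" and \<sigma>: "singular_simplex 0 X \<sigma>" and \<tau>: "singular_simplex 0 X \<tau>"
  obtains d where "singular_chain 1 X d" "chain_boundary 1 d = frag_of \<tau> - frag_of \<sigma>"
proof -
  obtain e where "e \<in> standard_simplex 0" using nonempty_standard_simplex by blast
  then have a: "\<sigma> e \<in> topspace X" using \<sigma> singular_simplex_value by blast
  have 1: "homologous_rel 0 X {} (frag_of \<rho>) (frag_of (\<lambda>_\<in>standard_simplex 0. \<sigma> e))"
    if "singular_simplex 0 X \<rho>" for \<rho>
    using contractible_imp_homologous[OF X _ a, of 0 "frag_of \<rho>"] that
    by (simp add: singular_cycle singular_chain_of chain_boundary_of simplex_map_def comp_def)
  have "homologous_rel 0 X {} (frag_of \<tau>) (frag_of \<sigma>)"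
    using homologous_rel_trans[OF _ 1[OF \<tau>]] 1[OF \<sigma>] homologous_rel_sym by metis
  then show ?thesis
    using that by (auto simp: homologous_rel_def singular_boundary)
qed

text \<open>For n at most 2 the n-simplex is a retract of the plane, through its first two barycentric
  coordinates.\<close>

definition plane_to_simplex :: "nat \<Rightarrow> real \<times> real \<Rightarrow> nat \<Rightarrow> real" where
  "plane_to_simplex n = (\<lambda>(a, b) i.
     let a' = (if n = 0 then 1 else min 1 (max 0 a));
         b' = (if n = 2 then min (1 - a') (max 0 b) else 1 - a')
     in if i = 0 then a' else if i = 1 then b' else if i = 2 then 1 - a' - b' else 0)"

lemma plane_to_simplex_in:
  assumes "n \<le> 2"
  shows "plane_to_simplex n ab \<in> standard_simplex n"
proof -
  obtain a b where ab: "ab = (a, b)" by (cases ab)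
  define a' where "a' = (if n = 0 then 1 else min 1 (max 0 a))"
  define b' where "b' = (if n = 2 then min (1 - a') (max 0 b) else 1 - a')"
  have val: "plane_to_simplex n ab = (\<lambda>i. if i = 0 then a' else if i = 1 then b' else if i = 2 then 1 - a' - b' else 0)"
    by (simp add: plane_to_simplex_def ab a'_def b'_def Let_def fun_eq_iff)
  have a': "0 \<le> a'" "a' \<le> 1" by (auto simp: a'_def)
  then have b': "0 \<le> b'" "a' + b' \<le> 1" by (auto simp: b'_def)
  consider "n = 0" | "n = 1" | "n = 2" using assms by linarith
  then show ?thesis
  proof cases
    case 1
    then show ?thesis using a' b' unfolding val by (auto simp: standard_simplex_def a'_def b'_def)
  next
    case 2
    then show ?thesis using a' b' unfolding val by (auto simp: standard_simplex_def b'_def)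
  next
    case 3
    then show ?thesis using a' b' unfolding val by (auto simp: standard_simplex_def numeral_2_eq_2)
  qed
qed

lemma plane_to_simplex_retract:
  assumes "n \<le> 2" and x: "x \<in> standard_simplex n"
  shows "plane_to_simplex n (x 0, x 1) = x"
proof
  fix i
  from assms have x': "\<And>i. 0 \<le> x i" "\<And>i. x i \<le> 1" "\<And>i. i > n \<Longrightarrow> x i = 0" "(\<Sum>i\<le>n. x i) = 1"
    by (auto simp: standard_simplex_def)
  consider "n = 0" | "n = 1" | "n = 2" using assms(1) by linarith
  then show "plane_to_simplex n (x 0, x 1) i = x i"
  proof cases
    case 1
    then show ?thesis using x'(3)[of i] x'(4) by (auto simp: plane_to_simplex_def Let_def)
  next
    case 2
    then show ?thesis using x'(1)[of 0] x'(2)[of 0] x'(3)[of i] x'(4)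
      by (auto simp: plane_to_simplex_def Let_def)
  next
    case 3
    then have s: "x 0 + x (Suc 0) + x 2 = 1" using x'(4) by (simp add: numeral_2_eq_2)
    show ?thesis using 3 s x'(1)[of 0] x'(1)[of 1] x'(1)[of 2] x'(2)[of 0] x'(3)[of i]
      by (auto simp: plane_to_simplex_def Let_def min_def max_def)
  qed
qed

lemma continuous_plane_to_simplex:
  assumes "n \<le> 2"
  shows "continuous_map euclidean (subtopology (powertop_real UNIV) (standard_simplex n)) (plane_to_simplex n)"
proof -
  have "continuous_on UNIV (\<lambda>x. plane_to_simplex n x i)" for i
    unfolding plane_to_simplex_def Let_def case_prod_unfold
    by (cases "n = 0"; cases "n = 2"; cases "i = 0"; cases "i = 1"; cases "i = 2")
       (auto intro!: continuous_intros)
  then show ?thesis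
    using plane_to_simplex_in[OF assms]
    by (auto simp: continuous_map_in_subtopology continuous_map_componentwise_UNIV)
qed

section \<open>Lifts of singular simplices\<close>

context regular_cover
begin

text \<open>The retraction of the plane onto the simplex turns the lifting of a simplex into lifting
  over a square. Dimension at most 2 covers all of degree one: 1-simplices carry the cochains,
  2-simplices the cocycle condition.\<close>

lemma lift_simplex:
  assumes n: "n \<le> 2" and \<sigma>: "singular_simplex n B \<sigma>"
  obtains \<tau> where "singular_simplex n Y \<tau>" "simplex_map n p \<tau> = \<sigma>"
proof -
  let ?D = "subtopology (powertop_real UNIV) (standard_simplex n)"
  let ?Q = "{0..1} \<times> {0..1} :: (real \<times> real) set"
  have \<sigma>c: "continuous_map ?D B \<sigma>" and \<sigma>e: "\<sigma> \<in> extensional (standard_simplex n)"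
    using \<sigma> by (auto simp: singular_simplex_def)
  have "continuous_map euclidean B (\<sigma> \<circ> plane_to_simplex n)"
    by (rule continuous_map_compose[OF continuous_plane_to_simplex[OF n] \<sigma>c])
  from has_lift_square[OF this]
  obtain F where F: "continuous_map (top_of_set ?Q) Y F" "\<And>z. z \<in> ?Q \<Longrightarrow> p (F z) = \<sigma> (plane_to_simplex n z)"
    unfolding has_lift_def by auto
  \<comment> \<open>The first two barycentric coordinates lie in the unit interval and embed the
    simplex in the square; \<open>plane_to_simplex\<close> undoes this.\<close>
  define \<iota> where "\<iota> x = (x 0, x 1)" for x :: "nat \<Rightarrow> real"
  have \<iota>Q: "\<iota> x \<in> ?Q" if "x \<in> standard_simplex n" for x
    using that by (auto simp: \<iota>_def standard_simplex_def)
  have "continuous_on (standard_simplex n) \<iota>"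
    unfolding \<iota>_def
    by (intro continuous_on_Pair continuous_on_subset[OF continuous_on_product_coordinates]) auto
  then have "continuous_map ?D (top_of_set ?Q) \<iota>"
    using \<iota>Q by (auto simp: euclidean_product_topology)
  then have "continuous_map ?D Y (F \<circ> \<iota>)"
    using F(1) by (rule continuous_map_compose)
  then have "singular_simplex n Y (restrict (F \<circ> \<iota>) (standard_simplex n))"
    by (simp add: singular_simplex_def)
  moreover have "simplex_map n p (restrict (F \<circ> \<iota>) (standard_simplex n)) = \<sigma>"
  proof (rule extensionalityI[OF _ \<sigma>e])
    show "simplex_map n p (restrict (F \<circ> \<iota>) (standard_simplex n)) \<in> extensional (standard_simplex n)"
      by (simp add: simplex_map_def)
    fix x assume x: "x \<in> standard_simplex n"
    then show "simplex_map n p (restrict (F \<circ> \<iota>) (standard_simplex n)) x = \<sigma> x"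
      using F(2)[OF \<iota>Q[OF x]] plane_to_simplex_retract[OF n x] by (simp add: simplex_map_def \<iota>_def)
  qed
  ultimately show ?thesis by (rule that)
qed

text \<open>A group element that matches the two lifts at one point matches them everywhere, the
  simplex being connected.\<close>

lemma lift_simplex_unique:
  assumes \<tau>: "singular_simplex n Y \<tau>" and \<tau>': "singular_simplex n Y \<tau>'"
    and eq: "simplex_map n p \<tau> = simplex_map n p \<tau>'"
  obtains g where "g \<in> carrier G" "\<tau>' = simplex_map n (act g) \<tau>"
proof -
  let ?D = "subtopology (powertop_real UNIV) (standard_simplex n)"
  have peq: "p (\<tau> x) = p (\<tau>' x)" if "x \<in> standard_simplex n" for x
    using fun_cong[OF eq, of x] that by (simp add: simplex_map_def)
  obtain e where e: "e \<in> standard_simplex n" using nonempty_standard_simplex by blast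
  obtain g where g: "g \<in> carrier G" "\<tau>' e = act g (\<tau> e)"
    using p_fibre peq[OF e] singular_simplex_value \<tau> \<tau>' e by metis
  have "\<tau>' x = act g (\<tau> x)" if "x \<in> standard_simplex n" for x
  proof (rule lift_unique[where Z = ?D and f = \<tau> and f' = \<tau>' and z = x])
    show "connected_space ?D"
      using connectedin_standard_simplex by (simp add: connectedin_def)
  qed (use \<tau> \<tau>' peq that e g in \<open>auto simp: singular_simplex_def\<close>)
  then have "\<tau>' = simplex_map n (act g) \<tau>"
    using \<tau>' by (intro extensionalityI[of _ "standard_simplex n"])
      (auto simp: singular_simplex_def simplex_map_def)
  with g that show ?thesis by blast
qed

lemma simplex_act_free:
  assumes "singular_simplex n Y \<tau>" "g \<in> carrier G" "simplex_map n (act g) \<tau> = \<tau>"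
  shows "g = \<one>"
proof -
  obtain e where e: "e \<in> standard_simplex n" using nonempty_standard_simplex by blast
  show ?thesis
    using fun_cong[OF assms(3), of e] act_free[OF assms(2) singular_simplex_value[OF assms(1) e]] e
    by (simp add: simplex_map_def)
qed

lemma simplex_act_mult:
  assumes "singular_simplex n Y \<tau>" "g \<in> carrier G" "h \<in> carrier G"
  shows "simplex_map n (act (g \<otimes> h)) \<tau> = simplex_map n (act g) (simplex_map n (act h) \<tau>)"
  using act_mult[OF assms(2,3)] singular_simplex_value[OF assms(1)] 
  by (auto simp: simplex_map_def fun_eq_iff)

lemma simplex_act_one:
  "singular_simplex n Y \<tau> \<Longrightarrow> simplex_map n (act \<one>) \<tau> = \<tau>"
  by (simp add: simplex_map_id_gen act_one)

lemma simplex_p_act: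
  "\<lbrakk>singular_simplex n Y \<tau>; g \<in> carrier G\<rbrakk> \<Longrightarrow> simplex_map n p (simplex_map n (act g) \<tau>) = simplex_map n p \<tau>"
  using p_act singular_simplex_value[of n Y \<tau>] by (auto simp: simplex_map_def fun_eq_iff)

lemma chain_p_act:
  assumes "singular_chain n Y c" "g \<in> carrier G"
  shows "chain_map n p (chain_map n (act g) c) = chain_map n p c"
proof -
  have "chain_map n p (chain_map n (act g) c) = chain_map n (p \<circ> act g) c"
    by (simp add: chain_map_compose)
  also have "\<dots> = chain_map n p c"
    by (rule chain_map_eq[OF assms(1)]) (simp add: p_act assms(2))
  finally show ?thesis .
qed

end

section \<open>Characters and first cohomology\<close>

lemma hom_group_carrier: "f \<in> carrier (hom_group G A) \<longleftrightarrow> f \<in> hom G A \<and> f \<in> extensional (carrier G)"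
  by (simp add: hom_group_def)

lemma hom_group_simps:
  "one (hom_group G A) = (\<lambda>x\<in>carrier G. one A)"
  "mult (hom_group G A) f g = (\<lambda>x\<in>carrier G. f x \<otimes>\<^bsub>A\<^esub> g x)"
  by (simp_all add: hom_group_def)

lemma comm_group_hom_group:
  assumes "group G" "comm_group A"
  shows "comm_group (hom_group G A)"
proof -
  interpret G: group G by fact
  interpret A: comm_group A by fact
  show ?thesis
  proof (rule comm_groupI)
    fix f g assume fg: "f \<in> carrier (hom_group G A)" "g \<in> carrier (hom_group G A)"
    then have fg': "f \<in> hom G A" "g \<in> hom G A" by (auto simp: hom_group_carrier)
    note cl = hom_in_carrier[OF fg'(1)] hom_in_carrier[OF fg'(2)]
    show "f \<otimes>\<^bsub>hom_group G A\<^esub> g \<in> carrier (hom_group G A)"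
      unfolding hom_group_carrier hom_group_simps
      by (auto intro!: homI simp: cl hom_mult[OF fg'(1)] hom_mult[OF fg'(2)] A.m_ac)
    show "f \<otimes>\<^bsub>hom_group G A\<^esub> g = g \<otimes>\<^bsub>hom_group G A\<^esub> f"
      by (auto simp: hom_group_simps cl A.m_comm intro!: restrict_ext)
    show "\<one>\<^bsub>hom_group G A\<^esub> \<otimes>\<^bsub>hom_group G A\<^esub> f = f"
      using fg(1) cl(1) by (auto simp: hom_group_simps hom_group_carrier extensional_def fun_eq_iff)
    have "(\<lambda>x\<in>carrier G. inv\<^bsub>A\<^esub> f x) \<in> carrier (hom_group G A)"
      unfolding hom_group_carrier
      by (auto intro!: homI simp: cl hom_mult[OF fg'(1)] A.inv_mult)
    moreover have "(\<lambda>x\<in>carrier G. inv\<^bsub>A\<^esub> f x) \<otimes>\<^bsub>hom_group G A\<^esub> f = \<one>\<^bsub>hom_group G A\<^esub>"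
      by (auto simp: hom_group_simps cl intro!: restrict_ext)
    ultimately show "\<exists>g\<in>carrier (hom_group G A). g \<otimes>\<^bsub>hom_group G A\<^esub> f = \<one>\<^bsub>hom_group G A\<^esub>" by blast
    fix h assume "h \<in> carrier (hom_group G A)"
    then have "h \<in> hom G A" by (auto simp: hom_group_carrier)
    from hom_in_carrier[OF this]
    show "f \<otimes>\<^bsub>hom_group G A\<^esub> g \<otimes>\<^bsub>hom_group G A\<^esub> h = f \<otimes>\<^bsub>hom_group G A\<^esub> (g \<otimes>\<^bsub>hom_group G A\<^esub> h)"
      by (auto simp: hom_group_simps cl A.m_assoc intro!: restrict_ext)
  qed (auto simp: hom_group_carrier hom_group_simps hom_def)
qed

section \<open>Singular cochains and cocycles\<close>

lemma comm_group_cochain_group: "comm_group A \<Longrightarrow> comm_group (cochain_group n X A)"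
  by (simp add: cochain_group_def comm_group_hom_group)

lemma cochain_carrier:
  "c \<in> carrier (cochain_group n X A) \<longleftrightarrow>
     c \<in> hom (chain_group n X) A \<and> c \<in> extensional (singular_chain_set n X)"
  by (simp add: cochain_group_def hom_group_carrier)

lemma cochain_mult:
  "singular_chain n X x \<Longrightarrow> (c \<otimes>\<^bsub>cochain_group n X A\<^esub> d) x = c x \<otimes>\<^bsub>A\<^esub> d x"
  by (simp add: cochain_group_def hom_group_simps)

text \<open>Chains are free on simplices. Extensionality is left out of the hypotheses so that
  composites with a pushforward or a boundary can be compared directly.\<close>

lemma hom_chain_agree:
  assumes "group A" "f \<in> hom (chain_group n X) A" "g \<in> hom (chain_group n X) A"
    and "\<And>\<sigma>. singular_simplex n X \<sigma> \<Longrightarrow> f (frag_of \<sigma>) = g (frag_of \<sigma>)"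
    and x: "singular_chain n X x"
  shows "f x = g x"
proof -
  interpret f: group_hom "chain_group n X" A f
    using assms by (simp add: group_hom_def group_hom_axioms_def)
  interpret g: group_hom "chain_group n X" A g
    using assms by (simp add: group_hom_def group_hom_axioms_def)
  show ?thesis
  proof (rule free_Abelian_group_induct[where P = "\<lambda>x. f x = g x"])
    show "Poly_Mapping.keys x \<subseteq> singular_simplex_set n X" using x by (simp add: singular_chain_def)
    show "f 0 = g 0" using f.hom_one g.hom_one by simp
    show "f (a - b) = g (a - b)"
      if ab: "Poly_Mapping.keys a \<subseteq> singular_simplex_set n X" "Poly_Mapping.keys b \<subseteq> singular_simplex_set n X"
        "f a = g a" "f b = g b" for a b
    proof -
      have "f (a \<otimes>\<^bsub>chain_group n X\<^esub> inv\<^bsub>chain_group n X\<^esub> b) = g (a \<otimes>\<^bsub>chain_group n X\<^esub> inv\<^bsub>chain_group n X\<^esub> b)"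
      proof -
        have c: "a \<in> carrier (chain_group n X)" "b \<in> carrier (chain_group n X)"
          using ab by (simp_all add: singular_chain_def)
        show ?thesis
          unfolding f.hom_mult[OF c(1) f.G.inv_closed[OF c(2)]] g.hom_mult[OF c(1) f.G.inv_closed[OF c(2)]]
            f.hom_inv[OF c(2)] g.hom_inv[OF c(2)] ab by (rule refl)
      qed
      then show ?thesis using ab by simp
    qed
  qed (simp add: assms(4))
qed

context comm_group
begin

lemma mult_inv_mult_cancel:
  assumes "k \<in> carrier G" "a \<in> carrier G" "b \<in> carrier G"
  shows "(k \<otimes> a) \<otimes> inv (k \<otimes> b) = a \<otimes> inv b"
proof -
  have "(k \<otimes> a) \<otimes> inv (k \<otimes> b) = a \<otimes> (k \<otimes> inv k) \<otimes> inv b"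
    using assms by (simp add: inv_mult m_ac del: r_inv)
  then show ?thesis using assms by simp
qed

lemma cochain_group_hom:
  "c \<in> carrier (cochain_group n X G) \<Longrightarrow> group_hom (chain_group n X) G c"
  by (simp add: cochain_carrier group_hom_def group_hom_axioms_def)

lemma cochain_closed:
  "\<lbrakk>c \<in> carrier (cochain_group n X G); singular_chain n X x\<rbrakk> \<Longrightarrow> c x \<in> carrier G"
  using group_hom.hom_closed[OF cochain_group_hom] by fastforce

lemma cochain_0: "c \<in> carrier (cochain_group n X G) \<Longrightarrow> c 0 = \<one>"
  using group_hom.hom_one[OF cochain_group_hom] by fastforce

lemma cochain_add:
  "\<lbrakk>c \<in> carrier (cochain_group n X G); singular_chain n X x; singular_chain n X y\<rbrakk>
    \<Longrightarrow> c (x + y) = c x \<otimes> c y"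
  using group_hom.hom_mult[OF cochain_group_hom] by fastforce

lemma cochain_minus:
  assumes "c \<in> carrier (cochain_group n X G)" "singular_chain n X x"
  shows "c (- x) = inv (c x)"
  using group_hom.hom_inv[OF cochain_group_hom[OF assms(1)], of x] assms(2)
  by (simp add: singular_chain_def)

lemma cochain_diff:
  assumes "c \<in> carrier (cochain_group n X G)" "singular_chain n X x" "singular_chain n X y"
  shows "c (x - y) = c x \<otimes> inv (c y)"
  using cochain_add[OF assms(1,2), of "- y"] cochain_minus[OF assms(1,3)] assms(3)
  by (simp add: singular_chain_minus)

text \<open>The universal property of the free abelian group on simplices; \<open>restrict\<close>
  then supplies the extensionality built into \<open>hom_group\<close>.\<close>

lemma cochain_extend:
  assumes "\<And>\<sigma>. singular_simplex n X \<sigma> \<Longrightarrow> f \<sigma> \<in> carrier G"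
  obtains c where "c \<in> carrier (cochain_group n X G)"
    "\<And>\<sigma>. singular_simplex n X \<sigma> \<Longrightarrow> c (frag_of \<sigma>) = f \<sigma>"
proof -
  obtain h where h: "h \<in> hom (free_Abelian_group (singular_simplex_set n X)) G"
    "\<And>\<sigma>. \<sigma> \<in> singular_simplex_set n X \<Longrightarrow> h (frag_of \<sigma>) = f \<sigma>"
    using free_Abelian_group_universal[of f "singular_simplex_set n X"] assms by blast
  show ?thesis
  proof (rule that[of "restrict h (singular_chain_set n X)"])
    have "restrict h (singular_chain_set n X) \<in> hom (chain_group n X) G"
      using h(1) unfolding chain_group_def[symmetric]
      by (auto simp: hom_def singular_chain_add)
    then show "restrict h (singular_chain_set n X) \<in> carrier (cochain_group n X G)"
      by (simp add: cochain_carrier)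
  qed (use h(2) in \<open>auto simp: singular_chain_of\<close>)
qed

lemma cochain_eqI:
  assumes "c \<in> carrier (cochain_group n X G)" "d \<in> carrier (cochain_group n X G)"
    and "\<And>\<sigma>. singular_simplex n X \<sigma> \<Longrightarrow> c (frag_of \<sigma>) = d (frag_of \<sigma>)"
  shows "c = d"
proof (rule extensionalityI)
  show "c \<in> extensional (singular_chain_set n X)" "d \<in> extensional (singular_chain_set n X)"
    using assms by (auto simp: cochain_carrier)
  fix x assume "x \<in> singular_chain_set n X"
  then show "c x = d x"
    using hom_chain_agree[OF is_group, where f = c and g = d and n = n and X = X and x = x] assms
    by (simp add: cochain_carrier)
qed

lemma cochain_pullback:
  assumes c: "c \<in> carrier (cochain_group n X G)" and f: "continuous_map W X f"
  shows "cochain_map n W f c \<in> carrier (cochain_group n W G)"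
  using assms
  by (auto simp: cochain_carrier cochain_map_def hom_def singular_chain_add singular_chain_chain_map chain_map_add)

lemma coboundary_in:
  assumes c: "c \<in> carrier (cochain_group n X G)"
  shows "coboundary n X c \<in> carrier (cochain_group (Suc n) X G)"
  using assms
  by (auto simp: cochain_carrier coboundary_def hom_def singular_chain_add singular_chain_boundary_alt chain_boundary_add)

lemma coboundary_hom: "coboundary n X \<in> hom (cochain_group n X G) (cochain_group (Suc n) X G)"
proof (rule homI)
  fix c d assume cd: "c \<in> carrier (cochain_group n X G)" "d \<in> carrier (cochain_group n X G)"
  show "coboundary n X (c \<otimes>\<^bsub>cochain_group n X G\<^esub> d) =
      coboundary n X c \<otimes>\<^bsub>cochain_group (Suc n) X G\<^esub> coboundary n X d"
    by (auto simp: cochain_group_def hom_group_simps coboundary_def singular_chain_boundary_alt intro!: restrict_ext)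
qed (rule coboundary_in)

lemma cocycle_carrier:
  "z \<in> carrier (cocycle_group n X G) \<longleftrightarrow> z \<in> carrier (cochain_group n X G) \<and>
     (\<forall>x. singular_chain (Suc n) X x \<longrightarrow> z (chain_boundary (Suc n) x) = \<one>)"
proof -
  have "coboundary n X z = \<one>\<^bsub>cochain_group (Suc n) X G\<^esub> \<longleftrightarrow>
     (\<forall>x. singular_chain (Suc n) X x \<longrightarrow> z (chain_boundary (Suc n) x) = \<one>)"
    by (auto simp: coboundary_def cochain_group_def hom_group_simps fun_eq_iff restrict_def)
  then show ?thesis by (simp add: cocycle_group_def kernel_def)
qed

lemma cocycle_boundary:
  "\<lbrakk>z \<in> carrier (cocycle_group n X G); singular_chain (Suc n) X x\<rbrakk> \<Longrightarrow> z (chain_boundary (Suc n) x) = \<one>"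
  by (simp add: cocycle_carrier)

lemma comm_group_cocycle_group: "comm_group (cocycle_group n X G)"
proof -
  interpret C: comm_group "cochain_group n X G"
    by (rule comm_group_cochain_group[OF comm_group_axioms])
  interpret D: comm_group "cochain_group (Suc n) X G"
    by (rule comm_group_cochain_group[OF comm_group_axioms])
  interpret h: group_hom "cochain_group n X G" "cochain_group (Suc n) X G" "coboundary n X"
    by unfold_locales (rule coboundary_hom)
  have "group (cocycle_group n X G)"
    unfolding cocycle_group_def by (rule C.subgroup_imp_group[OF h.subgroup_kernel])
  then show ?thesis
    by (rule group.group_comm_groupI) (auto simp: cocycle_group_def kernel_def C.m_comm)
qed

lemma cocycle_mult:
  "monoid.mult (cocycle_group n X G) = monoid.mult (cochain_group n X G)"
  by (simp add: cocycle_group_def)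

end

section \<open>Integration of 1-cocycles over a covering with contractible total space\<close>

lemma chain_boundary_edge:
  "chain_boundary (Suc 0) (frag_of \<tau>) = frag_of (singular_face (Suc 0) 0 \<tau>) - frag_of (singular_face (Suc 0) (Suc 0) \<tau>)"
  by (simp add: chain_boundary_of)

text \<open>The base point is a singular 0-simplex, so that its translates are generators of the
  chain group and can occur in boundaries directly.\<close>

locale acyclic_cover = regular_cover G Y act B p + A: comm_group A
  for G :: "('g, 'm) monoid_scheme" (structure) and Y :: "'y topology" and act B
    and p :: "'y \<Rightarrow> 'b" and A :: "('a, 'k) monoid_scheme" +
  fixes \<sigma>0 :: "(nat \<Rightarrow> real) \<Rightarrow> 'y"
  assumes contractible: "contractible_space Y" and base: "singular_simplex 0 Y \<sigma>0"
begin

lemma translate_simplex: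
  "\<lbrakk>singular_simplex n Y \<sigma>; g \<in> carrier G\<rbrakk> \<Longrightarrow> singular_simplex n Y (simplex_map n (act g) \<sigma>)"
  by (rule singular_simplex_simplex_map[OF _ act_cont])

lemma simplex_act_inj:
  assumes \<sigma>: "singular_simplex n Y \<sigma>" and gh: "g \<in> carrier G" "h \<in> carrier G"
    and eq: "simplex_map n (act g) \<sigma> = simplex_map n (act h) \<sigma>"
  shows "g = h"
proof -
  have "simplex_map n (act (inv g \<otimes> h)) \<sigma> = simplex_map n (act (inv g \<otimes> g)) \<sigma>"
    unfolding simplex_act_mult[OF \<sigma> inv_closed[OF gh(1)] gh(1)] simplex_act_mult[OF \<sigma> inv_closed[OF gh(1)] gh(2)]
    by (simp only: eq)
  also have "\<dots> = \<sigma>" using simplex_act_one[OF \<sigma>] gh by simp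
  finally have "inv g \<otimes> h = \<one>"
    by (intro simplex_act_free[OF \<sigma>]) (use gh in auto)
  then show ?thesis using gh by (metis inv_closed inv_equality inv_inv)
qed

lemma push_simplex: "singular_simplex n Y \<sigma> \<Longrightarrow> singular_simplex n B (simplex_map n p \<sigma>)"
  by (rule singular_simplex_simplex_map[OF _ p_cont])

lemma push_chain: "singular_chain n Y c \<Longrightarrow> singular_chain n B (chain_map n p c)"
  by (rule singular_chain_chain_map[OF _ p_cont])

lemma translate_chain: "\<lbrakk>singular_chain n Y c; g \<in> carrier G\<rbrakk> \<Longrightarrow> singular_chain n Y (chain_map n (act g) c)"
  by (rule singular_chain_chain_map[OF _ act_cont])

definition lift_of :: "nat \<Rightarrow> ((nat \<Rightarrow> real) \<Rightarrow> 'b) \<Rightarrow> (nat \<Rightarrow> real) \<Rightarrow> 'y" where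
  "lift_of n \<rho> = (SOME \<sigma>. singular_simplex n Y \<sigma> \<and> simplex_map n p \<sigma> = \<rho>)"

lemma lift_of:
  assumes "n \<le> 2" "singular_simplex n B \<rho>"
  shows "singular_simplex n Y (lift_of n \<rho>)" "simplex_map n p (lift_of n \<rho>) = \<rho>"
  using someI_ex[of "\<lambda>\<sigma>. singular_simplex n Y \<sigma> \<and> simplex_map n p \<sigma> = \<rho>"] lift_simplex[OF assms]
  unfolding lift_of_def by blast+

abbreviation "moved g \<equiv> simplex_map 0 (act g) \<sigma>0"

text \<open>Chains play the role of paths: homology of the contractible space provides them, and
  concatenation becomes addition.\<close>

definition joins :: "((nat \<Rightarrow> real) \<Rightarrow> 'y) \<Rightarrow> ((nat \<Rightarrow> real) \<Rightarrow> 'y) \<Rightarrow> 'y chain \<Rightarrow> bool" where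
  "joins \<sigma> \<tau> d \<longleftrightarrow> singular_chain (Suc 0) Y d \<and> chain_boundary (Suc 0) d = frag_of \<tau> - frag_of \<sigma>"

lemma joins_chain: "joins \<sigma> \<tau> d \<Longrightarrow> singular_chain (Suc 0) Y d"
  by (simp add: joins_def)

lemma joins_exists:
  assumes "singular_simplex 0 Y \<sigma>" "singular_simplex 0 Y \<tau>"
  obtains d where "joins \<sigma> \<tau> d"
  using contractible_connecting_chain[OF contractible assms] unfolding joins_def by auto

lemma joins_add: "\<lbrakk>joins \<sigma> \<tau> d; joins \<tau> \<rho> e\<rbrakk> \<Longrightarrow> joins \<sigma> \<rho> (d + e)"
  by (simp add: joins_def singular_chain_add chain_boundary_add)

lemma joins_translate:
  assumes "joins \<sigma> \<tau> d" "g \<in> carrier G"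
  shows "joins (simplex_map 0 (act g) \<sigma>) (simplex_map 0 (act g) \<tau>) (chain_map (Suc 0) (act g) d)"
  using assms chain_boundary_chain_map[of "Suc 0" Y d "act g"]
  by (simp add: joins_def translate_chain chain_map_diff)

abbreviation "Z1 \<equiv> cocycle_group (Suc 0) B A"

abbreviation "push \<equiv> chain_map (Suc 0) p"

text \<open>Two chains with equal boundary differ by a cycle, which bounds a 2-chain in the
  contractible space; a cocycle vanishes on the boundary of the pushforward of that 2-chain.\<close>

lemma cocycle_push_eq:
  assumes z: "z \<in> carrier (Z1)"
    and d: "singular_chain (Suc 0) Y d" "singular_chain (Suc 0) Y e"
    and eq: "chain_boundary (Suc 0) d = chain_boundary (Suc 0) e"
  shows "z (push d) = z (push e)"
proof -
  have zc: "z \<in> carrier (cochain_group (Suc 0) B A)" using z by (simp add: A.cocycle_carrier)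
  obtain f where f: "singular_chain (Suc (Suc 0)) Y f" "chain_boundary (Suc (Suc 0)) f = d - e"
    using contractible_cycle_is_boundary[OF contractible, of "Suc 0" "d - e"] d eq
    by (auto simp: singular_chain_diff chain_boundary_diff)
  have "z (push (d - e)) = \<one>\<^bsub>A\<^esub>"
    using A.cocycle_boundary[OF z push_chain[OF f(1)]] chain_boundary_chain_map[OF f(1), of p] f(2)
    by simp
  then have "z (push d) \<otimes>\<^bsub>A\<^esub> inv\<^bsub>A\<^esub> z (push e) = \<one>\<^bsub>A\<^esub>"
    using A.cochain_diff[OF zc push_chain[OF d(1)] push_chain[OF d(2)]] by (simp add: chain_map_diff)
  then show ?thesis
    using A.cochain_closed[OF zc] push_chain d by (metis A.inv_closed A.inv_equality A.inv_inv)
qed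

text \<open>The choice of the chain is immaterial because the covering space has trivial first homology.\<close>

definition monodromy :: "('b chain \<Rightarrow> 'a) \<Rightarrow> 'g \<Rightarrow> 'a" where
  "monodromy z = (\<lambda>g\<in>carrier G. z (push (SOME d. joins \<sigma>0 (moved g) d)))"

lemma monodromy_eq:
  assumes z: "z \<in> carrier (Z1)" and g: "g \<in> carrier G"
    and d: "joins \<sigma>0 (moved g) d"
  shows "monodromy z g = z (push d)"
proof -
  have "joins \<sigma>0 (moved g) (SOME d. joins \<sigma>0 (moved g) d)"
    using d by (rule someI)
  then show ?thesis
    using cocycle_push_eq[OF z] d g by (simp add: monodromy_def joins_def)
qed

lemma base_translate_joins:
  assumes "g \<in> carrier G"
  obtains d where "joins \<sigma>0 (moved g) d"
  using joins_exists[OF base translate_simplex[OF base assms]] .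

text \<open>A chain to \<open>moved g\<close> followed by the \<open>g\<close>-translate of a chain
  to \<open>moved h\<close> leads to \<open>moved (g \<otimes> h)\<close>. Translation does not
  change the image in \<open>B\<close>, whence multiplicativity.\<close>

lemma monodromy_in:
  assumes z: "z \<in> carrier (Z1)"
  shows "monodromy z \<in> carrier (hom_group G A)"
  unfolding hom_group_carrier
proof (intro conjI homI)
  have zc: "z \<in> carrier (cochain_group (Suc 0) B A)" using z by (simp add: A.cocycle_carrier)
  fix g assume g: "g \<in> carrier G"
  obtain d where d: "joins \<sigma>0 (moved g) d" using base_translate_joins[OF g] .
  show "monodromy z g \<in> carrier A"
    using monodromy_eq[OF z g d] A.cochain_closed[OF zc push_chain[OF joins_chain[OF d]]] by simp
  fix h assume h: "h \<in> carrier G"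
  obtain e where e: "joins \<sigma>0 (moved h) e" using base_translate_joins[OF h] .
  have ge: "joins (moved g) (moved (g \<otimes> h)) (chain_map (Suc 0) (act g) e)"
    using joins_translate[OF e g] simplex_act_mult[OF base g h] by simp
  have "monodromy z (g \<otimes> h) = z (push (d + chain_map (Suc 0) (act g) e))"
    using monodromy_eq[OF z _ joins_add[OF d ge]] g h by simp
  also have "\<dots> = z (push d + push e)"
    using chain_p_act[OF joins_chain[OF e] g] by (simp add: chain_map_add)
  also have "\<dots> = monodromy z g \<otimes>\<^bsub>A\<^esub> monodromy z h"
    using A.cochain_add[OF zc push_chain[OF joins_chain[OF d]] push_chain[OF joins_chain[OF e]]]
      monodromy_eq[OF z g d] monodromy_eq[OF z h e] by simp
  finally show "monodromy z (g \<otimes> h) = monodromy z g \<otimes>\<^bsub>A\<^esub> monodromy z h" .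
qed (simp add: monodromy_def)

lemma monodromy_hom: "monodromy \<in> hom (Z1) (hom_group G A)"
proof (rule homI[OF monodromy_in])
  fix z w assume z: "z \<in> carrier (Z1)" and w: "w \<in> carrier (Z1)"
  let ?zw = "z \<otimes>\<^bsub>Z1\<^esub> w"
  interpret Z: comm_group "Z1" by (rule A.comm_group_cocycle_group)
  have zw: "?zw \<in> carrier (Z1)" using z w by simp
  show "monodromy ?zw = monodromy z \<otimes>\<^bsub>hom_group G A\<^esub> monodromy w"
  proof (rule extensionalityI[of _ "carrier G"])
    fix g assume g: "g \<in> carrier G"
    obtain d where d: "joins \<sigma>0 (moved g) d" using base_translate_joins[OF g] .
    show "monodromy ?zw g = (monodromy z \<otimes>\<^bsub>hom_group G A\<^esub> monodromy w) g"
      using monodromy_eq[OF z g d] monodromy_eq[OF w g d] monodromy_eq[OF zw g d] g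
        push_chain[OF joins_chain[OF d]]
      by (simp add: A.cocycle_mult cochain_mult hom_group_simps)
  qed (simp_all add: monodromy_def hom_group_simps)
qed

lemma coboundary_set_1: "coboundary_set (Suc 0) B A = coboundary 0 B ` carrier (cochain_group 0 B A)"
  by (simp add: coboundary_set_def)

text \<open>A chain from the base simplex to a translate becomes closed in \<open>B\<close>, so a
  coboundary integrates to the neutral element along it.\<close>

lemma monodromy_coboundary:
  assumes f: "f \<in> carrier (cochain_group 0 B A)"
  shows "coboundary 0 B f \<in> carrier (Z1)"
    and "monodromy (coboundary 0 B f) = \<one>\<^bsub>hom_group G A\<^esub>"
proof -
  show z: "coboundary 0 B f \<in> carrier (Z1)"
    using A.coboundary_in[OF f]
    by (auto simp: A.cocycle_carrier coboundary_def singular_chain_boundary_alt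
        chain_boundary_boundary_alt A.cochain_0[OF f])
  show "monodromy (coboundary 0 B f) = \<one>\<^bsub>hom_group G A\<^esub>"
  proof (rule extensionalityI[of _ "carrier G"])
    fix g assume g: "g \<in> carrier G"
    obtain d where d: "joins \<sigma>0 (moved g) d" using base_translate_joins[OF g] .
    have "chain_boundary (Suc 0) (push d) = 0"
      using d chain_boundary_chain_map[OF joins_chain[OF d], of p]
      by (simp add: joins_def chain_map_diff simplex_p_act base g)
    then show "monodromy (coboundary 0 B f) g = \<one>\<^bsub>hom_group G A\<^esub> g"
      using monodromy_eq[OF z g d] push_chain[OF joins_chain[OF d]] A.cochain_0[OF f] g
      by (simp add: coboundary_def hom_group_simps)
  qed (simp_all add: monodromy_def hom_group_simps)
qed

text \<open>A primitive is obtained by integrating \<open>z\<close> from the base simplex to a lift.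
  Trivial monodromy makes the integral independent of the lift, as two lifts of a 0-simplex differ
  by a group element.\<close>

lemma monodromy_trivial_imp_coboundary:
  assumes z: "z \<in> carrier (Z1)" and triv: "monodromy z = \<one>\<^bsub>hom_group G A\<^esub>"
  shows "z \<in> coboundary 0 B ` carrier (cochain_group 0 B A)"
proof -
  have zc: "z \<in> carrier (cochain_group (Suc 0) B A)" using z by (simp add: A.cocycle_carrier)
  let ?s = "lift_of 0"
  note s = lift_of[of 0, simplified]
  define c where "c \<sigma> = (SOME d. joins \<sigma>0 \<sigma> d)" for \<sigma>
  have c: "joins \<sigma>0 \<sigma> (c \<sigma>)" if "singular_simplex 0 Y \<sigma>" for \<sigma>
    using joins_exists[OF base that] unfolding c_def by (metis someI_ex)
  \<comment> \<open>Any lift is a translate of the chosen one by some \<open>g\<close>; reaching it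
    through \<open>moved g\<close> changes the integral by \<open>monodromy z g\<close>, which is
    neutral.\<close>
  have inv: "z (push d) = z (push (c (?s (simplex_map 0 p \<sigma>))))"
    if \<sigma>: "singular_simplex 0 Y \<sigma>" and d: "joins \<sigma>0 \<sigma> d" for \<sigma> d
  proof -
    let ?\<tau> = "?s (simplex_map 0 p \<sigma>)"
    have \<tau>: "singular_simplex 0 Y ?\<tau>" "simplex_map 0 p ?\<tau> = simplex_map 0 p \<sigma>"
      using s[OF push_simplex[OF \<sigma>]] by auto
    obtain g where g: "g \<in> carrier G" "\<sigma> = simplex_map 0 (act g) ?\<tau>"
      using lift_simplex_unique[OF \<tau>(1) \<sigma> \<tau>(2)] .
    obtain e where e: "joins \<sigma>0 (moved g) e" using base_translate_joins[OF g(1)] .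
    have j: "joins \<sigma>0 \<sigma> (e + chain_map (Suc 0) (act g) (c ?\<tau>))"
      using joins_add[OF e] joins_translate[OF c[OF \<tau>(1)] g(1)] g(2) by simp
    have "z (push d) = z (push e + push (c ?\<tau>))"
      using cocycle_push_eq[OF z joins_chain[OF d] joins_chain[OF j]] d j
        chain_p_act[OF joins_chain[OF c[OF \<tau>(1)]] g(1)]
      by (simp add: joins_def chain_map_add)
    also have "\<dots> = monodromy z g \<otimes>\<^bsub>A\<^esub> z (push (c ?\<tau>))"
      using A.cochain_add[OF zc] push_chain joins_chain e c[OF \<tau>(1)] monodromy_eq[OF z g(1) e] by metis
    also have "\<dots> = z (push (c ?\<tau>))"
      using A.cochain_closed[OF zc push_chain[OF joins_chain[OF c[OF \<tau>(1)]]]] triv g(1)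
      by (simp add: hom_group_simps)
    finally show ?thesis .
  qed
  obtain f where f: "f \<in> carrier (cochain_group 0 B A)"
    "\<And>\<rho>. singular_simplex 0 B \<rho> \<Longrightarrow> f (frag_of \<rho>) = z (push (c (?s \<rho>)))"
  proof (rule A.cochain_extend[of 0 B "\<lambda>\<rho>. z (push (c (?s \<rho>)))"])
    show "z (push (c (?s \<rho>))) \<in> carrier A" if "singular_simplex 0 B \<rho>" for \<rho>
      using A.cochain_closed[OF zc push_chain[OF joins_chain[OF c[OF s(1)[OF that]]]]] .
  qed blast
  have "z = coboundary 0 B f"
  proof (rule A.cochain_eqI[OF zc A.coboundary_in[OF f(1)]])
    fix \<rho> assume \<rho>: "singular_simplex (Suc 0) B \<rho>"
    obtain \<tau> where \<tau>: "singular_simplex (Suc 0) Y \<tau>" "simplex_map (Suc 0) p \<tau> = \<rho>"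
      using lift_simplex[OF _ \<rho>] by auto
    let ?a = "singular_face (Suc 0) 0 \<tau>" and ?b = "singular_face (Suc 0) (Suc 0) \<tau>"
    have a: "singular_simplex 0 Y ?a" and b: "singular_simplex 0 Y ?b"
      using singular_simplex_singular_face[OF \<tau>(1), of 0] singular_simplex_singular_face[OF \<tau>(1), of "Suc 0"]
      by simp_all
    have \<tau>c: "singular_chain (Suc 0) Y (frag_of \<tau>)" using \<tau>(1) by (simp add: singular_chain_of)
    \<comment> \<open>The edge \<tau> is appended to a chain that ends at its initial vertex: face
      \<open>Suc 0\<close> is the start of an edge, face 0 its end.\<close>
    have j: "joins \<sigma>0 ?a (c ?b + frag_of \<tau>)"
      by (rule joins_add[OF c[OF b]]) (simp add: joins_def \<tau>c chain_boundary_edge)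
    have bd: "chain_boundary (Suc 0) (frag_of \<rho>) = frag_of (simplex_map 0 p ?a) - frag_of (simplex_map 0 p ?b)"
      using chain_boundary_chain_map[OF \<tau>c, of p] \<tau>(2) by (simp add: chain_boundary_edge chain_map_diff)
    have cl: "z (push (c ?b)) \<in> carrier A" "z (frag_of \<rho>) \<in> carrier A"
      using A.cochain_closed[OF zc] push_chain[OF joins_chain[OF c[OF b]]] \<rho> by (simp_all add: singular_chain_of)
    have "coboundary 0 B f (frag_of \<rho>) = f (frag_of (simplex_map 0 p ?a) - frag_of (simplex_map 0 p ?b))"
      using \<rho> by (simp add: coboundary_def singular_chain_of bd)
    also have "\<dots> = f (frag_of (simplex_map 0 p ?a)) \<otimes>\<^bsub>A\<^esub> inv\<^bsub>A\<^esub> f (frag_of (simplex_map 0 p ?b))"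
      by (rule A.cochain_diff[OF f(1)]) (use push_simplex a b in \<open>auto simp: singular_chain_of\<close>)
    also have "\<dots> = z (push (c ?b + frag_of \<tau>)) \<otimes>\<^bsub>A\<^esub> inv\<^bsub>A\<^esub> z (push (c ?b))"
      using f(2)[OF push_simplex[OF a]] f(2)[OF push_simplex[OF b]] inv[OF a j] inv[OF b c[OF b]] by simp
    also have "z (push (c ?b + frag_of \<tau>)) = z (push (c ?b)) \<otimes>\<^bsub>A\<^esub> z (frag_of \<rho>)"
      using A.cochain_add[OF zc push_chain[OF joins_chain[OF c[OF b]]] push_chain[OF \<tau>c]] \<tau>(2)
      by (simp add: chain_map_add)
    also have "\<dots> \<otimes>\<^bsub>A\<^esub> inv\<^bsub>A\<^esub> z (push (c ?b)) = z (frag_of \<rho>)"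
      using cl by (simp add: A.m_comm A.m_assoc A.m_lcomm)
    finally show "z (frag_of \<rho>) = coboundary 0 B f (frag_of \<rho>)" by simp
  qed
  with f(1) show ?thesis by blast
qed

lemma monodromy_kernel:
  "kernel (Z1) (hom_group G A) monodromy = coboundary_set (Suc 0) B A"
  unfolding coboundary_set_1 kernel_def
  using monodromy_coboundary monodromy_trivial_imp_coboundary by blast

text \<open>The construction of a primitive is reversed: a 0-cochain \<open>c\<close> on
  \<open>Y\<close> is found on which \<open>G\<close> acts through \<kappa>. Its coboundary is then
  invariant, hence comes from a cocycle \<open>z\<close> on \<open>B\<close>, and integrating
  \<open>z\<close> from the base simplex to \<open>moved g\<close> returns
  \<open>\<kappa> g\<close>.\<close>

lemma monodromy_surj:
  assumes \<kappa>: "\<kappa> \<in> carrier (hom_group G A)"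
  obtains z where "z \<in> carrier (Z1)" "monodromy z = \<kappa>"
proof -
  have \<kappa>h: "\<kappa> \<in> hom G A" and \<kappa>e: "\<kappa> \<in> extensional (carrier G)"
    using \<kappa> by (auto simp: hom_group_carrier)
  note \<kappa>c = hom_in_carrier[OF \<kappa>h] and \<kappa>m = hom_mult[OF \<kappa>h]
  let ?s = "lift_of 0" and ?t = "lift_of (Suc 0)"
  have s: "singular_simplex 0 Y (?s (simplex_map 0 p \<sigma>))" "simplex_map 0 p (?s (simplex_map 0 p \<sigma>)) = simplex_map 0 p \<sigma>"
    if "singular_simplex 0 Y \<sigma>" for \<sigma>
    using lift_of[OF _ push_simplex[OF that]] by auto
  \<comment> \<open>The chosen lifts form a fundamental domain for 0-simplices;
    \<open>k \<sigma>\<close> brings the representative of the orbit to \<sigma>. Freeness makes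
    this element unique, so \<open>k\<close> is equivariant.\<close>
  define k where "k \<sigma> = (SOME g. g \<in> carrier G \<and> \<sigma> = simplex_map 0 (act g) (?s (simplex_map 0 p \<sigma>)))" for \<sigma>
  have k: "k \<sigma> \<in> carrier G" "\<sigma> = simplex_map 0 (act (k \<sigma>)) (?s (simplex_map 0 p \<sigma>))"
    if \<sigma>: "singular_simplex 0 Y \<sigma>" for \<sigma>
  proof -
    obtain g where "g \<in> carrier G" "\<sigma> = simplex_map 0 (act g) (?s (simplex_map 0 p \<sigma>))"
      using lift_simplex_unique[OF s(1)[OF \<sigma>] \<sigma> s(2)[OF \<sigma>]] .
    then have "k \<sigma> \<in> carrier G \<and> \<sigma> = simplex_map 0 (act (k \<sigma>)) (?s (simplex_map 0 p \<sigma>))"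
      unfolding k_def by (metis (mono_tags, lifting) someI_ex)
    then show "k \<sigma> \<in> carrier G" "\<sigma> = simplex_map 0 (act (k \<sigma>)) (?s (simplex_map 0 p \<sigma>))" by auto
  qed
  have k_act: "k (simplex_map 0 (act g) \<sigma>) = g \<otimes> k \<sigma>" if \<sigma>: "singular_simplex 0 Y \<sigma>" and g: "g \<in> carrier G" for g \<sigma>
  proof -
    let ?\<tau> = "?s (simplex_map 0 p \<sigma>)" and ?g\<sigma> = "simplex_map 0 (act g) \<sigma>"
    have g\<sigma>: "singular_simplex 0 Y ?g\<sigma>" by (rule translate_simplex[OF \<sigma> g])
    have 1: "?g\<sigma> = simplex_map 0 (act (k ?g\<sigma>)) ?\<tau>"
      using k(2)[OF g\<sigma>] simplex_p_act[OF \<sigma> g] by simp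
    have 2: "?g\<sigma> = simplex_map 0 (act (g \<otimes> k \<sigma>)) ?\<tau>"
      using k(2)[OF \<sigma>] simplex_act_mult[OF s(1)[OF \<sigma>] g k(1)[OF \<sigma>]] by simp
    have kc: "k ?g\<sigma> \<in> carrier G" "g \<otimes> k \<sigma> \<in> carrier G" using k(1) g\<sigma> \<sigma> g by auto
    have "simplex_map 0 (act (k ?g\<sigma>)) ?\<tau> = simplex_map 0 (act (g \<otimes> k \<sigma>)) ?\<tau>"
      using 1 2 by simp
    then show ?thesis by (rule simplex_act_inj[OF s(1)[OF \<sigma>] kc])
  qed
  obtain c where c: "c \<in> carrier (cochain_group 0 Y A)"
    "\<And>\<sigma>. singular_simplex 0 Y \<sigma> \<Longrightarrow> c (frag_of \<sigma>) = \<kappa> (k \<sigma>)"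
    by (rule A.cochain_extend[of 0 Y "\<lambda>\<sigma>. \<kappa> (k \<sigma>)"]) (use k(1) \<kappa>c in blast)+
  have c_act: "c (frag_of (simplex_map 0 (act g) \<sigma>)) = \<kappa> g \<otimes>\<^bsub>A\<^esub> c (frag_of \<sigma>)"
    if "singular_simplex 0 Y \<sigma>" "g \<in> carrier G" for g \<sigma>
    using c(2) translate_simplex that k_act k(1) \<kappa>m by simp
  note t = lift_of[of "Suc 0", simplified]
  have cb: "c (chain_boundary (Suc 0) x) \<in> carrier A" if "singular_chain (Suc 0) Y x" for x
    by (rule A.cochain_closed[OF c(1) singular_chain_boundary_alt[OF that]])
  \<comment> \<open>The value on an edge is the coboundary of \<open>c\<close> on one chosen lift;
    that other lifts give the same value is the content of \<open>pull\<close>.\<close>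
  obtain z where z: "z \<in> carrier (cochain_group (Suc 0) B A)"
    "\<And>\<rho>. singular_simplex (Suc 0) B \<rho> \<Longrightarrow> z (frag_of \<rho>) = c (chain_boundary (Suc 0) (frag_of (?t \<rho>)))"
  proof (rule A.cochain_extend[of "Suc 0" B "\<lambda>\<rho>. c (chain_boundary (Suc 0) (frag_of (?t \<rho>)))"])
    show "c (chain_boundary (Suc 0) (frag_of (?t \<rho>))) \<in> carrier A" if "singular_simplex (Suc 0) B \<rho>" for \<rho>
      using cb t(1)[OF that] by (simp add: singular_chain_of)
  qed blast
  have edge: "c (chain_boundary (Suc 0) (frag_of \<tau>)) =
      c (frag_of (singular_face (Suc 0) 0 \<tau>)) \<otimes>\<^bsub>A\<^esub> inv\<^bsub>A\<^esub> c (frag_of (singular_face (Suc 0) (Suc 0) \<tau>))"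
    and face: "singular_simplex 0 Y (singular_face (Suc 0) 0 \<tau>)" "singular_simplex 0 Y (singular_face (Suc 0) (Suc 0) \<tau>)"
    if \<tau>: "singular_simplex (Suc 0) Y \<tau>" for \<tau>
  proof -
    show a: "singular_simplex 0 Y (singular_face (Suc 0) 0 \<tau>)" "singular_simplex 0 Y (singular_face (Suc 0) (Suc 0) \<tau>)"
      using singular_simplex_singular_face[OF \<tau>, of 0] singular_simplex_singular_face[OF \<tau>, of "Suc 0"]
      by simp_all
    show "c (chain_boundary (Suc 0) (frag_of \<tau>)) =
      c (frag_of (singular_face (Suc 0) 0 \<tau>)) \<otimes>\<^bsub>A\<^esub> inv\<^bsub>A\<^esub> c (frag_of (singular_face (Suc 0) (Suc 0) \<tau>))"
      unfolding chain_boundary_edge by (rule A.cochain_diff[OF c(1)]) (simp_all add: singular_chain_of a)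
  qed
  have pull: "z (push x) = c (chain_boundary (Suc 0) x)" if x: "singular_chain (Suc 0) Y x" for x
  proof (rule hom_chain_agree[OF A.is_group _ _ _ x])
    show "(\<lambda>x. z (push x)) \<in> hom (chain_group (Suc 0) Y) A"
      by (auto intro!: homI simp: A.cochain_closed[OF z(1)] push_chain chain_map_add A.cochain_add[OF z(1)])
    show "(\<lambda>x. c (chain_boundary (Suc 0) x)) \<in> hom (chain_group (Suc 0) Y) A"
      by (auto intro!: homI simp: cb chain_boundary_add A.cochain_add[OF c(1)] singular_chain_boundary_alt)
    fix \<tau> assume \<tau>: "singular_simplex (Suc 0) Y \<tau>"
    let ?\<tau>' = "?t (simplex_map (Suc 0) p \<tau>)"
    have \<tau>': "singular_simplex (Suc 0) Y ?\<tau>'" "simplex_map (Suc 0) p ?\<tau>' = simplex_map (Suc 0) p \<tau>"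
      using t[OF push_simplex[OF \<tau>]] by auto
    obtain g where g: "g \<in> carrier G" "\<tau> = simplex_map (Suc 0) (act g) ?\<tau>'"
      using lift_simplex_unique[OF \<tau>'(1) \<tau> \<tau>'(2)] .
    let ?a = "singular_face (Suc 0) 0 ?\<tau>'" and ?b = "singular_face (Suc 0) (Suc 0) ?\<tau>'"
    have \<tau>c': "singular_chain (Suc 0) Y (frag_of ?\<tau>')" using \<tau>'(1) by (simp add: singular_chain_of)
    have ab: "singular_chain 0 Y (frag_of ?a)" "singular_chain 0 Y (frag_of ?b)"
      using face[OF \<tau>'(1)] by (simp_all add: singular_chain_of)
    note ca = A.cochain_closed[OF c(1) ab(1)] and cb' = A.cochain_closed[OF c(1) ab(2)]
    have "chain_boundary (Suc 0) (frag_of \<tau>) = chain_map 0 (act g) (chain_boundary (Suc 0) (frag_of ?\<tau>'))"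
      using chain_boundary_chain_map[OF \<tau>c', of "act g"] g(2) by simp
    also have "\<dots> = frag_of (simplex_map 0 (act g) ?a) - frag_of (simplex_map 0 (act g) ?b)"
      by (simp add: chain_boundary_edge chain_map_diff)
    finally have "c (chain_boundary (Suc 0) (frag_of \<tau>)) =
        c (frag_of (simplex_map 0 (act g) ?a)) \<otimes>\<^bsub>A\<^esub> inv\<^bsub>A\<^esub> c (frag_of (simplex_map 0 (act g) ?b))"
      using A.cochain_diff[OF c(1)] translate_simplex[OF face(1)[OF \<tau>'(1)] g(1)] translate_simplex[OF face(2)[OF \<tau>'(1)] g(1)]
      by (simp add: singular_chain_of)
    also have "\<dots> = (\<kappa> g \<otimes>\<^bsub>A\<^esub> c (frag_of ?a)) \<otimes>\<^bsub>A\<^esub> inv\<^bsub>A\<^esub> (\<kappa> g \<otimes>\<^bsub>A\<^esub> c (frag_of ?b))"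
      using c_act face[OF \<tau>'(1)] g(1) by simp
    \<comment> \<open>The factor \<open>\<kappa> g\<close> occurs at both ends of the edge and
      cancels, so the choice of lift is immaterial.\<close>
    also have "\<dots> = c (frag_of ?a) \<otimes>\<^bsub>A\<^esub> inv\<^bsub>A\<^esub> c (frag_of ?b)"
      by (rule A.mult_inv_mult_cancel[OF \<kappa>c[OF g(1)] ca cb'])
    also have "\<dots> = c (chain_boundary (Suc 0) (frag_of ?\<tau>'))"
      using edge[OF \<tau>'(1)] by simp
    finally show "z (push (frag_of \<tau>)) = c (chain_boundary (Suc 0) (frag_of \<tau>))"
      using z(2)[OF push_simplex[OF \<tau>]] by simp
  qed
  have zz: "z \<in> carrier (Z1)"
    unfolding A.cocycle_carrier
  proof (intro conjI allI impI z(1))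
    fix x assume x: "singular_chain (Suc (Suc 0)) B x"
    show "z (chain_boundary (Suc (Suc 0)) x) = \<one>\<^bsub>A\<^esub>"
    proof (rule hom_chain_agree[OF A.is_group _ _ _ x])
      show "(\<lambda>x. z (chain_boundary (Suc (Suc 0)) x)) \<in> hom (chain_group (Suc (Suc 0)) B) A"
        by (auto intro!: homI simp: A.cochain_closed[OF z(1)] chain_boundary_add A.cochain_add[OF z(1)] singular_chain_boundary_alt)
      show "(\<lambda>x. \<one>\<^bsub>A\<^esub>) \<in> hom (chain_group (Suc (Suc 0)) B) A"
        by (auto intro!: homI)
      fix \<rho> assume \<rho>: "singular_simplex (Suc (Suc 0)) B \<rho>"
      obtain \<tau> where \<tau>: "singular_simplex (Suc (Suc 0)) Y \<tau>" "simplex_map (Suc (Suc 0)) p \<tau> = \<rho>"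
        using lift_simplex[OF _ \<rho>] by auto
      have \<tau>c: "singular_chain (Suc (Suc 0)) Y (frag_of \<tau>)" using \<tau>(1) by (simp add: singular_chain_of)
      \<comment> \<open>On a lifted 2-simplex \<open>pull\<close> turns the value of
        \<open>z\<close> into the value of \<open>c\<close> on a double boundary.\<close>
      show "z (chain_boundary (Suc (Suc 0)) (frag_of \<rho>)) = \<one>\<^bsub>A\<^esub>"
        using chain_boundary_chain_map[OF \<tau>c, of p] \<tau>(2) pull[OF singular_chain_boundary_alt[OF \<tau>c]]
          chain_boundary_boundary_alt[OF \<tau>c] A.cochain_0[OF c(1)]
        by simp
    qed
  qed
  have "monodromy z = \<kappa>"
  proof (rule extensionalityI[OF _ \<kappa>e])
    fix g assume g: "g \<in> carrier G"
    obtain d where d: "joins \<sigma>0 (moved g) d" using base_translate_joins[OF g] .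
    have c0: "c (frag_of \<sigma>0) \<in> carrier A"
      using A.cochain_closed[OF c(1)] base by (simp add: singular_chain_of)
    have "monodromy z g = c (frag_of (moved g) - frag_of \<sigma>0)"
      using monodromy_eq[OF zz g d] pull[OF joins_chain[OF d]] d by (simp add: joins_def)
    also have "\<dots> = (\<kappa> g \<otimes>\<^bsub>A\<^esub> c (frag_of \<sigma>0)) \<otimes>\<^bsub>A\<^esub> inv\<^bsub>A\<^esub> c (frag_of \<sigma>0)"
      using A.cochain_diff[OF c(1)] translate_simplex[OF base g] base c_act[OF base g]
      by (simp add: singular_chain_of)
    also have "\<dots> = \<kappa> g" using c0 \<kappa>c[OF g] by (simp add: A.m_assoc)
    finally show "monodromy z g = \<kappa> g" .
  qed (simp add: monodromy_def)
  with zz show ?thesis by (rule that)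
qed

lemma monodromy_group_hom: "group_hom (Z1) (hom_group G A) monodromy"
  using A.comm_group_cocycle_group[THEN comm_group.axioms(2)]
    comm_group_hom_group[OF is_group A.comm_group_axioms, THEN comm_group.axioms(2)] monodromy_hom
  by (simp add: group_hom_def group_hom_axioms_def)

theorem cohomology_iso:
  "(\<lambda>C. the_elem (monodromy ` C)) \<in> iso (cohomology_group 1 B A) (hom_group G A)"
proof -
  interpret m: group_hom "Z1" "hom_group G A" monodromy
    by (rule monodromy_group_hom)
  have "monodromy ` carrier (Z1) = carrier (hom_group G A)"
    using monodromy_in monodromy_surj by (blast elim: monodromy_surj)
  from m.FactGroup_iso_set[OF this] show ?thesis
    by (simp add: monodromy_kernel cohomology_group_def)
qed

end

section \<open>Finite groups of exponent 2\<close>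

lemma Z2_sum_carrier: "carrier (Z2_sum k) = PiE {..<k} (\<lambda>_. {0..<2})"
  by (auto simp: carrier_sum_group carrier_integer_mod_group)

lemma group_Z2_sum: "group (Z2_sum k)"
  by simp

lemma card_Z2_sum: "card (carrier (Z2_sum k)) = 2 ^ k"
  by (simp add: Z2_sum_carrier card_PiE)

lemma (in group) exponent_2_imp_comm_group:
  assumes exp2: "\<And>x. x \<in> carrier G \<Longrightarrow> x \<otimes> x = \<one>"
  shows "comm_group G"
proof (rule group_comm_groupI)
  fix x y assume xy: "x \<in> carrier G" "y \<in> carrier G"
  have inv: "inv z = z" if "z \<in> carrier G" for z
    using inv_equality[OF exp2[OF that] that that] .
  show "x \<otimes> y = y \<otimes> x"
    using inv[of "x \<otimes> y"] inv[OF xy(1)] inv[OF xy(2)] xy inv_mult_group[OF xy] by simp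
qed

text \<open>Basis extension over the field with two elements: as long as the image has fewer than
  \<open>2 ^ k\<close> elements, some \<open>x\<close> lies outside it, and a new coordinate is sent
  to \<open>x\<close>.\<close>

lemma (in group) Z2_sum_embedding:
  assumes exp2: "\<And>x. x \<in> carrier G \<Longrightarrow> x \<otimes> x = \<one>" and card: "card (carrier G) = 2 ^ k"
    and "j \<le> k"
  shows "\<exists>h \<in> hom (Z2_sum j) G. inj_on h (carrier (Z2_sum j))"
  using \<open>j \<le> k\<close>
proof (induction j)
  case 0
  have "(\<lambda>_. \<one>) \<in> hom (Z2_sum 0) G" by (auto intro: homI)
  moreover have "inj_on (\<lambda>_. \<one>) (carrier (Z2_sum 0))"
    unfolding Z2_sum_carrier by (auto simp: inj_on_def)
  ultimately show ?case by blast
next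
  case (Suc j)
  then obtain h where h: "h \<in> hom (Z2_sum j) G" "inj_on h (carrier (Z2_sum j))" by auto
  interpret h: group_hom "Z2_sum j" G h
    using h(1) is_group by (simp add: group_hom_def group_hom_axioms_def group_Z2_sum)
  have "card (h ` carrier (Z2_sum j)) = 2 ^ j"
    using card_image[OF h(2)] card_Z2_sum by simp
  moreover have "(2::nat) ^ j < 2 ^ k" using Suc.prems by simp
  ultimately have "h ` carrier (Z2_sum j) \<noteq> carrier G" using card by auto
  moreover have "h ` carrier (Z2_sum j) \<subseteq> carrier G" by auto
  ultimately obtain x where x: "x \<in> carrier G" "x \<notin> h ` carrier (Z2_sum j)" by blast
  define r where "r v = restrict v {..<j}" for v :: "nat \<Rightarrow> int"
  define h' where "h' v = h (r v) \<otimes> (if v j = 0 then \<one> else x)" for v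
  have r: "r v \<in> carrier (Z2_sum j)" if "v \<in> carrier (Z2_sum (Suc j))" for v
    using that unfolding Z2_sum_carrier r_def by (auto simp: PiE_iff)
  have vj: "v j = 0 \<or> v j = 1" if "v \<in> carrier (Z2_sum (Suc j))" for v
  proof -
    have "v j \<in> {0..<2}" using that unfolding Z2_sum_carrier by (auto simp: PiE_iff)
    then show ?thesis by auto
  qed
  have hom: "h' \<in> hom (Z2_sum (Suc j)) G"
  proof (rule homI)
    fix v assume v: "v \<in> carrier (Z2_sum (Suc j))"
    then show "h' v \<in> carrier G" using h.hom_closed[OF r[OF v]] x by (simp add: h'_def)
    fix w assume w: "w \<in> carrier (Z2_sum (Suc j))"
    let ?vw = "v \<otimes>\<^bsub>Z2_sum (Suc j)\<^esub> w"
    have rvw: "r ?vw = r v \<otimes>\<^bsub>Z2_sum j\<^esub> r w" by (auto simp: r_def fun_eq_iff)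
    have "?vw j = (v j + w j) mod 2" by simp
    then have e: "(if ?vw j = 0 then \<one> else x) = (if v j = 0 then \<one> else x) \<otimes> (if w j = 0 then \<one> else x)"
      using vj[OF v] vj[OF w] x exp2 by auto
    have "h' ?vw = (h (r v) \<otimes> h (r w)) \<otimes> ((if v j = 0 then \<one> else x) \<otimes> (if w j = 0 then \<one> else x))"
      unfolding h'_def rvw e h.hom_mult[OF r[OF v] r[OF w]] by (rule refl)
    also have "\<dots> = h' v \<otimes> h' w"
    proof -
      interpret comm_group G by (rule exponent_2_imp_comm_group[OF exp2])
      show ?thesis unfolding h'_def using h.hom_closed[OF r[OF v]] h.hom_closed[OF r[OF w]] x
        by (simp add: m_ac)
    qed
    finally show "h' ?vw = h' v \<otimes> h' w" .
  qed
  interpret h': group_hom "Z2_sum (Suc j)" G h'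
    using hom is_group by (simp add: group_hom_def group_hom_axioms_def group_Z2_sum)
  have "v = \<one>\<^bsub>Z2_sum (Suc j)\<^esub>" if v: "v \<in> carrier (Z2_sum (Suc j))" and 1: "h' v = \<one>" for v
  proof -
    have "v j = 0"
    proof (rule ccontr)
      assume "v j \<noteq> 0"
      \<comment> \<open>The neutral element is rewritten as \<open>x \<otimes> x\<close>; cancelling
        \<open>x\<close> puts \<open>x\<close> into the image of \<open>h\<close>, against its
        choice.\<close>
      then have "h (r v) \<otimes> x = x \<otimes> x" using 1 exp2[OF x(1)] by (simp add: h'_def)
      then have "h (r v) = x" using h.hom_closed[OF r[OF v]] x(1) by simp
      then show False using x(2) r[OF v] by auto
    qed
    then have "h (r v) = \<one>" using 1 h.hom_closed[OF r[OF v]] by (simp add: h'_def)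
    then have rv: "r v = \<one>\<^bsub>Z2_sum j\<^esub>" using h.inj_on_one_iff h(2) r[OF v] by auto
    have z: "v i = 0" if "i < j" for i
      using that fun_cong[OF rv, of i] by (simp add: r_def)
    show ?thesis
    proof (rule extensionalityI[of _ "{..<Suc j}"])
      show "v \<in> extensional {..<Suc j}" using v unfolding Z2_sum_carrier by (simp add: PiE_iff)
      show "v i = \<one>\<^bsub>Z2_sum (Suc j)\<^esub> i" if "i \<in> {..<Suc j}" for i
        using that z \<open>v j = 0\<close> by (cases "i = j") auto
    qed simp
  qed
  then show ?case using hom h'.inj_on_one_iff by blast
qed

lemma (in group) exponent_2_iso_Z2_sum:
  assumes exp2: "\<And>x. x \<in> carrier G \<Longrightarrow> x \<otimes> x = \<one>" and card: "card (carrier G) = 2 ^ k"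
  shows "G \<cong> Z2_sum k"
proof -
  obtain h where h: "h \<in> hom (Z2_sum k) G" "inj_on h (carrier (Z2_sum k))"
    using Z2_sum_embedding[OF exp2 card, of k] by auto
  have fin: "finite (carrier G)" using card by (metis card.infinite power_eq_0_iff zero_neq_numeral)
  have "h ` carrier (Z2_sum k) = carrier G"
    using h fin card card_image[OF h(2)] card_Z2_sum
    by (intro card_subset_eq) (auto simp: hom_def)
  then have "h \<in> iso (Z2_sum k) G" using h by (simp add: iso_def bij_betw_def)
  then show ?thesis using group.iso_sym[OF group_Z2_sum] is_isoI by blast
qed

lemma (in group) exponent_2_filtration:
  assumes exp2: "\<And>x. x \<in> carrier G \<Longrightarrow> x \<otimes> x = \<one>" and card: "card (carrier G) = 2 ^ (f + q)"
    and F: "subgroup F G" "card F = 2 ^ f"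
  shows "G \<cong> Z2_sum (f + q) \<and> G\<lparr>carrier := F\<rparr> \<cong> Z2_sum f \<and> G Mod F \<cong> Z2_sum q"
proof (intro conjI)
  show "G \<cong> Z2_sum (f + q)" by (rule exponent_2_iso_Z2_sum[OF exp2 card])
  have FG: "F \<subseteq> carrier G" using F(1) subgroup.subset by blast
  interpret F: group "G\<lparr>carrier := F\<rparr>" by (rule subgroup_imp_group[OF F(1)])
  show "G\<lparr>carrier := F\<rparr> \<cong> Z2_sum f"
    by (rule F.exponent_2_iso_Z2_sum) (use FG exp2 F(2) in auto)
  \<comment> \<open>Exponent 2 forces commutativity, which makes \<open>F\<close> normal.\<close>
  interpret comm_group G by (rule exponent_2_imp_comm_group[OF exp2])
  interpret N: normal F G by (rule subgroup_imp_normal[OF F(1)])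
  interpret Q: group "G Mod F" by (rule N.factorgroup_is_group)
  show "G Mod F \<cong> Z2_sum q"
  proof (rule Q.exponent_2_iso_Z2_sum)
    fix X assume "X \<in> carrier (G Mod F)"
    then obtain x where x: "x \<in> carrier G" "X = F #> x" by (auto simp: carrier_FactGroup)
    show "X \<otimes>\<^bsub>G Mod F\<^esub> X = \<one>\<^bsub>G Mod F\<^esub>"
      using x exp2[OF x(1)] FG by (simp add: FactGroup_def N.rcos_sum coset_mult_one)
  next
    have "card (rcosets F) * 2 ^ f = (2 ^ (f + q) :: nat)"
      using lagrange[OF F(1)] F(2) card by (simp add: order_def)
    then show "card (carrier (G Mod F)) = 2 ^ q"
      by (simp add: FactGroup_def power_add)
  qed
qed

section \<open>Cohomology classes as characters, and maps between coverings\<close>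

context acyclic_cover
begin

definition class_character :: "('b chain \<Rightarrow> 'a) set \<Rightarrow> 'g \<Rightarrow> 'a" where
  "class_character C = the_elem (monodromy ` C)"

lemma class_character_iso: "class_character \<in> iso (cohomology_group 1 B A) (hom_group G A)"
  using cohomology_iso by (simp add: class_character_def[abs_def])

lemma cohomology_carrier:
  "carrier (cohomology_group 1 B A) =
     (\<lambda>z. coboundary_set 1 B A #>\<^bsub>cochain_group 1 B A\<^esub> z) ` carrier (cocycle_group 1 B A)"
  by (simp add: cohomology_group_def carrier_FactGroup r_coset_def A.cocycle_mult)

lemma class_character_coset:
  assumes z: "z \<in> carrier (cocycle_group 1 B A)"
  shows "class_character (coboundary_set 1 B A #>\<^bsub>cochain_group 1 B A\<^esub> z) = monodromy z"
proof -
  interpret m: group_hom "Z1" "hom_group G A" monodromy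
    by (rule monodromy_group_hom)
  have z': "z \<in> carrier (Z1)" using z by simp
  let ?N = "kernel (Z1) (hom_group G A) monodromy"
  have "monodromy ` (?N #>\<^bsub>Z1\<^esub> z) = {monodromy z}"
  proof -
    have "monodromy (n \<otimes>\<^bsub>Z1\<^esub> z) = monodromy z" if "n \<in> ?N" for n
      using that z' by (simp add: kernel_def)
    moreover have "\<one>\<^bsub>Z1\<^esub> \<in> ?N" by (simp add: kernel_def)
    ultimately show ?thesis unfolding r_coset_def by (auto simp: image_UN) 
  qed
  then show ?thesis
    by (simp add: class_character_def monodromy_kernel r_coset_def A.cocycle_mult)
qed

lemma group_cohomology: "group (cohomology_group 1 B A)"
proof -
  interpret m: group_hom "Z1" "hom_group G A" monodromy
    by (rule monodromy_group_hom)
  show ?thesis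
    using normal.factorgroup_is_group[OF m.normal_kernel]
    by (simp add: cohomology_group_def monodromy_kernel)
qed

end

lemma (in comm_group) cochain_map_coboundary:
  assumes f: "continuous_map W X f" and c: "c \<in> carrier (cochain_group n X G)"
  shows "cochain_map (Suc n) W f (coboundary n X c) = coboundary n W (cochain_map n W f c)"
proof
  fix x
  show "cochain_map (Suc n) W f (coboundary n X c) x = coboundary n W (cochain_map n W f c) x"
    using chain_boundary_chain_map[of "Suc n" W x f]
    by (auto simp: cochain_map_def coboundary_def singular_chain_chain_map[OF _ f] singular_chain_boundary_alt)
qed

lemma (in comm_group) cochain_map_cocycle:
  assumes f: "continuous_map W X f" and z: "z \<in> carrier (cocycle_group n X G)"
  shows "cochain_map n W f z \<in> carrier (cocycle_group n W G)"
  unfolding cocycle_carrier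
proof (intro conjI allI impI)
  show "cochain_map n W f z \<in> carrier (cochain_group n W G)"
    using cochain_pullback[OF _ f] z by (simp add: cocycle_carrier)
  fix x assume x: "singular_chain (Suc n) W x"
  show "cochain_map n W f z (chain_boundary (Suc n) x) = \<one>"
    using cocycle_boundary[OF z singular_chain_chain_map[OF x f]] chain_boundary_chain_map[OF x, of f]
      singular_chain_boundary_alt[OF x]
    by (simp add: cochain_map_def)
qed

lemma cochain_map_mult:
  assumes "continuous_map W X f"
  shows "cochain_map n W f (c \<otimes>\<^bsub>cochain_group n X A\<^esub> d) = cochain_map n W f c \<otimes>\<^bsub>cochain_group n W A\<^esub> cochain_map n W f d"
  using singular_chain_chain_map[OF _ assms]
  by (auto simp: cochain_map_def cochain_group_def hom_group_simps fun_eq_iff)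

text \<open>A map of coverings along a surjection of groups; the case in view has the Borel
  construction above and the classifying space of \<open>P\<close> below. The base simplices
  correspond, so that chains joining translates map to chains joining translates.\<close>

locale cover_morphism = acyclic_cover G Y act B p A \<sigma>0
    + base: acyclic_cover K W actK D q A "simplex_map 0 \<pi> \<sigma>0"
  for G :: "('g, 'm) monoid_scheme" (structure) and Y :: "'y topology" and act and B :: "'b topology" and p
    and A :: "('a, 'k) monoid_scheme" and \<sigma>0 and K :: "('h, 'n) monoid_scheme"
    and W :: "'w topology" and actK and D :: "'d topology" and q and \<pi> +
  fixes \<phi> :: "'g \<Rightarrow> 'h" and r :: "'b \<Rightarrow> 'd"
  assumes \<phi>_hom: "\<phi> \<in> hom G K" and \<phi>_surj: "\<phi> ` carrier G = carrier K"
    and \<pi>_cont: "continuous_map Y W \<pi>" and r_cont: "continuous_map B D r"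
    and r_p: "y \<in> topspace Y \<Longrightarrow> r (p y) = q (\<pi> y)"
    and \<pi>_act: "\<lbrakk>g \<in> carrier G; y \<in> topspace Y\<rbrakk> \<Longrightarrow> \<pi> (act g y) = actK (\<phi> g) (\<pi> y)"
begin

text \<open>A chain in \<open>Y\<close> from the base simplex to its \<open>g\<close>-translate maps
  to such a chain in \<open>W\<close> for \<open>\<phi> g\<close>, and both have the same image in
  \<open>D\<close>.\<close>

lemma monodromy_pullback:
  assumes w: "w \<in> carrier (cocycle_group 1 D A)"
  shows "monodromy (cochain_map 1 B r w) = (\<lambda>g\<in>carrier G. base.monodromy w (\<phi> g))"
proof (rule extensionalityI[of _ "carrier G"])
  fix g assume g: "g \<in> carrier G"
  have w': "w \<in> carrier (cocycle_group (Suc 0) D A)" using w by simp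
  obtain d where d: "joins \<sigma>0 (moved g) d" using base_translate_joins[OF g] .
  have dc: "singular_chain (Suc 0) Y d" by (rule joins_chain[OF d])
  have \<phi>g: "\<phi> g \<in> carrier K" using hom_in_carrier[OF \<phi>_hom g] .
  have "simplex_map 0 \<pi> (moved g) = simplex_map 0 (actK (\<phi> g)) (simplex_map 0 \<pi> \<sigma>0)"
    using \<pi>_act[OF g] singular_simplex_value[OF base] by (auto simp: simplex_map_def fun_eq_iff)
  then have j: "base.joins (simplex_map 0 \<pi> \<sigma>0) (simplex_map 0 (actK (\<phi> g)) (simplex_map 0 \<pi> \<sigma>0)) (chain_map (Suc 0) \<pi> d)"
    using d chain_boundary_chain_map[OF dc, of \<pi>]
    by (simp add: joins_def base.joins_def singular_chain_chain_map[OF dc \<pi>_cont] chain_map_diff)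
  have "chain_map (Suc 0) r (chain_map (Suc 0) p d) = chain_map (Suc 0) (r \<circ> p) d"
    by (simp add: chain_map_compose)
  also have "\<dots> = chain_map (Suc 0) (q \<circ> \<pi>) d"
    by (rule chain_map_eq[OF dc]) (simp add: r_p)
  also have "\<dots> = chain_map (Suc 0) q (chain_map (Suc 0) \<pi> d)"
    by (simp add: chain_map_compose)
  finally have "monodromy (cochain_map (Suc 0) B r w) g = w (chain_map (Suc 0) q (chain_map (Suc 0) \<pi> d))"
    using monodromy_eq[OF A.cochain_map_cocycle[OF r_cont w'] g d] push_chain[OF dc]
    by (simp add: cochain_map_def)
  then show "monodromy (cochain_map 1 B r w) g = (\<lambda>g\<in>carrier G. base.monodromy w (\<phi> g)) g"
    using base.monodromy_eq[OF w' \<phi>g j] g by simp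
qed (simp_all add: monodromy_def)

text \<open>\<open>cohomology_map\<close> pulls back a whole coset and then translates by all
  coboundaries. Pulled-back coboundaries are coboundaries and are absorbed, which leaves one
  coset.\<close>

lemma cohomology_map_coset:
  assumes w: "w \<in> carrier (cocycle_group 1 D A)"
  shows "cohomology_map 1 B A r (coboundary_set 1 D A #>\<^bsub>cochain_group 1 D A\<^esub> w) =
    coboundary_set 1 B A #>\<^bsub>cochain_group 1 B A\<^esub> cochain_map 1 B r w"
proof -
  let ?C = "cochain_group (Suc 0) B A" and ?r = "cochain_map (Suc 0) B r"
  interpret C: comm_group ?C by (rule comm_group_cochain_group[OF A.comm_group_axioms])
  interpret m: group_hom Z1 "hom_group G A" monodromy
    by (rule monodromy_group_hom)
  have N: "coboundary 0 B f \<in> carrier ?C" if "f \<in> carrier (cochain_group 0 B A)" for f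
    by (rule A.coboundary_in[OF that])
  have w': "?r w \<in> carrier ?C"
    using A.cochain_pullback[OF _ r_cont] w by (simp add: A.cocycle_carrier)
  have rN: "?r (coboundary 0 D f) = coboundary 0 B (cochain_map 0 B r f)"
    "cochain_map 0 B r f \<in> carrier (cochain_group 0 B A)" if "f \<in> carrier (cochain_group 0 D A)" for f
    using A.cochain_map_coboundary[OF r_cont that] A.cochain_pullback[OF that r_cont] by auto
  interpret C0: comm_group "cochain_group 0 B A" by (rule comm_group_cochain_group[OF A.comm_group_axioms])
  interpret D0: comm_group "cochain_group 0 D A" by (rule comm_group_cochain_group[OF A.comm_group_axioms])
  have cb: "coboundary 0 B f \<otimes>\<^bsub>?C\<^esub> coboundary 0 B g = coboundary 0 B (f \<otimes>\<^bsub>cochain_group 0 B A\<^esub> g)"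
    if "f \<in> carrier (cochain_group 0 B A)" "g \<in> carrier (cochain_group 0 B A)" for f g
    using hom_mult[OF A.coboundary_hom that] by simp
  have 1: "coboundary 0 B f \<otimes>\<^bsub>?C\<^esub> ?r (coboundary 0 D h \<otimes>\<^bsub>cochain_group (Suc 0) D A\<^esub> w)
      = coboundary 0 B (f \<otimes>\<^bsub>cochain_group 0 B A\<^esub> cochain_map 0 B r h) \<otimes>\<^bsub>?C\<^esub> ?r w"
    if "f \<in> carrier (cochain_group 0 B A)" "h \<in> carrier (cochain_group 0 D A)" for f h
    using rN[OF that(2)] that N w' cb[OF that(1) rN(2)[OF that(2)]]
    by (simp add: cochain_map_mult[OF r_cont] C.m_assoc[symmetric])
  have 2: "cochain_map 0 B r \<one>\<^bsub>cochain_group 0 D A\<^esub> = \<one>\<^bsub>cochain_group 0 B A\<^esub>"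
    using singular_chain_chain_map[OF _ r_cont] 
    by (auto simp: cochain_map_def cochain_group_def hom_group_simps fun_eq_iff)
  \<comment> \<open>The reverse inclusion takes the trivial cochain on \<open>D\<close>, whose
    pulled-back coboundary contributes nothing.\<close>
  have 3: "coboundary 0 B f \<otimes>\<^bsub>?C\<^esub> ?r w = coboundary 0 B f \<otimes>\<^bsub>?C\<^esub> ?r (coboundary 0 D \<one>\<^bsub>cochain_group 0 D A\<^esub> \<otimes>\<^bsub>cochain_group (Suc 0) D A\<^esub> w)"
    if "f \<in> carrier (cochain_group 0 B A)" for f
    using 1[OF that D0.one_closed] that unfolding 2 by simp
  have "cohomology_map (Suc 0) B A r (coboundary_set (Suc 0) D A #>\<^bsub>cochain_group (Suc 0) D A\<^esub> w) =
    coboundary_set (Suc 0) B A #>\<^bsub>?C\<^esub> ?r w"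
    unfolding cohomology_map_def coboundary_set_1 base.coboundary_set_1 set_mult_def r_coset_def
  proof (intro equalityI subsetI; clarsimp)
    fix f h assume "f \<in> carrier (cochain_group 0 B A)" "h \<in> carrier (cochain_group 0 D A)"
    then show "\<exists>x\<in>carrier (cochain_group 0 B A). coboundary 0 B f \<otimes>\<^bsub>?C\<^esub> ?r (coboundary 0 D h \<otimes>\<^bsub>cochain_group (Suc 0) D A\<^esub> w)
       = coboundary 0 B x \<otimes>\<^bsub>?C\<^esub> ?r w"
      using 1 rN(2) C0.m_closed by blast
  next
    fix f assume "f \<in> carrier (cochain_group 0 B A)"
    then show "\<exists>x\<in>carrier (cochain_group 0 B A). \<exists>h\<in>carrier (cochain_group 0 D A).
        coboundary 0 B f \<otimes>\<^bsub>?C\<^esub> ?r w = coboundary 0 B x \<otimes>\<^bsub>?C\<^esub> ?r (coboundary 0 D h \<otimes>\<^bsub>cochain_group (Suc 0) D A\<^esub> w)"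
      using 3 D0.one_closed by blast
  qed
  then show ?thesis by simp
qed

lemma image_characters:
  "class_character ` (cohomology_map 1 B A r ` carrier (cohomology_group 1 D A)) =
    (\<lambda>\<kappa>. \<lambda>g\<in>carrier G. \<kappa> (\<phi> g)) ` carrier (hom_group K A)"
proof -
  have cc: "class_character (cohomology_map 1 B A r (coboundary_set 1 D A #>\<^bsub>cochain_group 1 D A\<^esub> w)) =
      (\<lambda>g\<in>carrier G. base.monodromy w (\<phi> g))" if w: "w \<in> carrier (cocycle_group 1 D A)" for w
    using class_character_coset[OF A.cochain_map_cocycle[OF r_cont w]]
    unfolding cohomology_map_coset[OF w] monodromy_pullback[OF w] .
  have surj: "base.monodromy ` carrier (cocycle_group 1 D A) = carrier (hom_group K A)"
    using base.monodromy_in by (auto elim: base.monodromy_surj)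
  show ?thesis
    unfolding base.cohomology_carrier surj[symmetric] image_image using cc by (rule image_cong[OF refl])
qed

lemma image_subset:
  "cohomology_map 1 B A r ` carrier (cohomology_group 1 D A) \<subseteq> carrier (cohomology_group 1 B A)"
  unfolding base.cohomology_carrier cohomology_carrier
  using cohomology_map_coset A.cochain_map_cocycle[OF r_cont] by auto

text \<open>Surjectivity of \<phi> makes the pullback of characters injective, so the image is
  counted by the characters of \<open>K\<close>.\<close>

theorem card_image_cohomology_map:
  "card (cohomology_map 1 B A r ` carrier (cohomology_group 1 D A)) = card (carrier (hom_group K A))"
proof -
  let ?F = "cohomology_map 1 B A r ` carrier (cohomology_group 1 D A)"
  have "inj_on class_character ?F"
    using class_character_iso image_subset by (auto simp: iso_def bij_betw_def intro: inj_on_subset)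
  then have "card ?F = card ((\<lambda>\<kappa>. \<lambda>g\<in>carrier G. \<kappa> (\<phi> g)) ` carrier (hom_group K A))"
    unfolding image_characters[symmetric] by (rule card_image[symmetric])
  also have "\<dots> = card (carrier (hom_group K A))"
  proof (rule card_image, rule inj_onI)
    fix \<kappa> \<mu> assume km: "\<kappa> \<in> carrier (hom_group K A)" "\<mu> \<in> carrier (hom_group K A)"
      "(\<lambda>g\<in>carrier G. \<kappa> (\<phi> g)) = (\<lambda>g\<in>carrier G. \<mu> (\<phi> g))"
    show "\<kappa> = \<mu>"
    proof (rule extensionalityI[of _ "carrier K"])
      fix k assume "k \<in> carrier K"
      then obtain g where "g \<in> carrier G" "k = \<phi> g" using \<phi>_surj by auto
      then show "\<kappa> k = \<mu> k" using fun_cong[OF km(3), of g] by simp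
    qed (use km in \<open>auto simp: hom_group_carrier\<close>)
  qed
  finally show ?thesis .
qed

text \<open>Closure is checked on characters: by injectivity of \<open>class_character\<close> the
  image consists exactly of the classes whose character is pulled back from \<open>K\<close>, and
  such characters form a subgroup.\<close>

theorem subgroup_image_cohomology_map:
  "subgroup (cohomology_map 1 B A r ` carrier (cohomology_group 1 D A)) (cohomology_group 1 B A)"
proof -
  let ?F = "cohomology_map 1 B A r ` carrier (cohomology_group 1 D A)"
  let ?H = "cohomology_group 1 B A"
  let ?s = "\<lambda>\<kappa>. \<lambda>g\<in>carrier G. \<kappa> (\<phi> g)"
  interpret H: group ?H by (rule group_cohomology)
  interpret X: comm_group "hom_group G A" by (rule comm_group_hom_group[OF is_group A.comm_group_axioms])
  interpret XK: comm_group "hom_group K A" by (rule comm_group_hom_group[OF base.is_group A.comm_group_axioms])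
  interpret c: group_hom ?H "hom_group G A" class_character
    using class_character_iso by unfold_locales (simp add: iso_def)
  have inj: "inj_on class_character (carrier ?H)"
    using class_character_iso by (simp add: iso_def bij_betw_def)
  have "?s \<in> hom (hom_group K A) (hom_group G A)"
  proof (rule homI)
    fix \<kappa> assume "\<kappa> \<in> carrier (hom_group K A)"
    then have "\<kappa> \<in> hom K A" by (simp add: hom_group_carrier)
    then have "\<kappa> \<circ> \<phi> \<in> hom G A" by (rule Group.hom_compose[OF \<phi>_hom])
    then show "?s \<kappa> \<in> carrier (hom_group G A)"
      by (auto simp: hom_group_carrier hom_def)
  next
    fix \<kappa> \<mu> show "?s (\<kappa> \<otimes>\<^bsub>hom_group K A\<^esub> \<mu>) = ?s \<kappa> \<otimes>\<^bsub>hom_group G A\<^esub> ?s \<mu>"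
      using hom_in_carrier[OF \<phi>_hom] by (auto simp: hom_group_simps fun_eq_iff)
  qed
  then interpret s: group_hom "hom_group K A" "hom_group G A" ?s by unfold_locales
  have R: "subgroup (?s ` carrier (hom_group K A)) (hom_group G A)" by (rule s.img_is_subgroup)
  have mem: "C \<in> ?F \<longleftrightarrow> C \<in> carrier ?H \<and> class_character C \<in> ?s ` carrier (hom_group K A)" for C
  proof
    assume "C \<in> ?F" then show "C \<in> carrier ?H \<and> class_character C \<in> ?s ` carrier (hom_group K A)"
      using image_subset image_characters by blast
  next
    assume C: "C \<in> carrier ?H \<and> class_character C \<in> ?s ` carrier (hom_group K A)"
    then have "class_character C \<in> class_character ` ?F" using image_characters by simp
    then obtain C' where C': "C' \<in> ?F" "class_character C = class_character C'" by auto
    then have "C = C'" using inj_onD[OF inj] C image_subset by blast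
    then show "C \<in> ?F" using C' by simp
  qed
  show ?thesis
  proof (rule H.subgroupI)
    show "?F \<subseteq> carrier ?H" by (rule image_subset)
    show "?F \<noteq> {}" using group.is_monoid[OF base.group_cohomology] monoid.one_closed by blast
    show "inv\<^bsub>?H\<^esub> C \<in> ?F" if "C \<in> ?F" for C
      using that subgroup.m_inv_closed[OF R] H.inv_closed[of C] c.hom_inv[of C] unfolding mem by simp
    show "C \<otimes>\<^bsub>?H\<^esub> C' \<in> ?F" if "C \<in> ?F" "C' \<in> ?F" for C C'
      using that subgroup.m_closed[OF R] H.m_closed[of C C'] c.hom_mult[of C C'] unfolding mem by simp
  qed
qed

theorem cohomology_filtration_Z2:
  assumes A2: "\<And>a. a \<in> carrier A \<Longrightarrow> a \<otimes>\<^bsub>A\<^esub> a = \<one>\<^bsub>A\<^esub>"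
    and G: "card (carrier (hom_group G A)) = 2 ^ (m + k)" and K: "card (carrier (hom_group K A)) = 2 ^ m"
  defines "H \<equiv> cohomology_group 1 B A"
    and "F \<equiv> cohomology_map 1 B A r ` carrier (cohomology_group 1 D A)"
  shows "H \<cong> Z2_sum (m + k) \<and> H\<lparr>carrier := F\<rparr> \<cong> Z2_sum m \<and> H Mod F \<cong> Z2_sum k"
proof -
  interpret H: group H unfolding H_def by (rule group_cohomology)
  interpret X: comm_group "hom_group G A" by (rule comm_group_hom_group[OF is_group A.comm_group_axioms])
  interpret c: group_hom H "hom_group G A" class_character
    using class_character_iso unfolding H_def[symmetric] by unfold_locales (simp add: iso_def)
  have bij: "bij_betw class_character (carrier H) (carrier (hom_group G A))"
    using class_character_iso by (simp add: iso_def H_def)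
  show ?thesis
  proof (rule H.exponent_2_filtration)
    fix C assume C: "C \<in> carrier H"
    have "class_character C \<in> hom G A" using c.hom_closed[OF C] by (simp add: hom_group_carrier)
    then have "class_character C \<otimes>\<^bsub>hom_group G A\<^esub> class_character C = \<one>\<^bsub>hom_group G A\<^esub>"
      using A2[OF hom_in_carrier[of "class_character C" G A]] by (auto simp: hom_group_simps fun_eq_iff)
    then have "class_character (C \<otimes>\<^bsub>H\<^esub> C) = class_character \<one>\<^bsub>H\<^esub>" using C by simp
    then show "C \<otimes>\<^bsub>H\<^esub> C = \<one>\<^bsub>H\<^esub>"
      using bij C by (simp add: bij_betw_def inj_on_def)
  next
    show "card (carrier H) = 2 ^ (m + k)" using bij_betw_same_card[OF bij] G by simp
    show "subgroup F H" unfolding F_def H_def by (rule subgroup_image_cohomology_map)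
    show "card F = 2 ^ m" unfolding F_def card_image_cohomology_map K ..
  qed
qed

end

section \<open>The Borel construction of a torus\<close>

definition semidirect :: "(real^2) set \<Rightarrow> (real^2^2) monoid \<Rightarrow> ((real^2) \<times> (real^2^2)) monoid" where
  "semidirect L P = euclidean_group\<lparr>carrier := L \<times> carrier P\<rparr>"

lemma semidirect_simps [simp]:
  "carrier (semidirect L P) = L \<times> carrier P"
  "(a, A) \<otimes>\<^bsub>semidirect L P\<^esub> (b, B) = (a + A *v b, A ** B)"
  "\<one>\<^bsub>semidirect L P\<^esub> = (0, mat 1)"
  by (simp_all add: semidirect_def euclidean_group_def)

text \<open>A product of a quotient map with an identity need not be a quotient map, but openness is
  preserved; this is how \<open>E\<close> times the plane is compared with \<open>E\<close> times
  the torus.\<close>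

lemma open_map_prod_id:
  assumes "open_map X Y f"
  shows "open_map (prod_topology W X) (prod_topology W Y) (\<lambda>(w, x). (w, f x))"
  unfolding open_map_def
proof (intro allI impI)
  fix U assume U: "openin (prod_topology W X) U"
  show "openin (prod_topology W Y) ((\<lambda>(w, x). (w, f x)) ` U)"
    unfolding openin_prod_topology_alt
  proof (intro allI impI)
    fix w y assume "(w, y) \<in> (\<lambda>(w, x). (w, f x)) ` U"
    then obtain x where x: "(w, x) \<in> U" "y = f x" by auto
    then obtain S T where ST: "openin W S" "openin X T" "w \<in> S" "x \<in> T" "S \<times> T \<subseteq> U"
      using U unfolding openin_prod_topology_alt by metis
    then have "S \<times> f ` T \<subseteq> (\<lambda>(w, x). (w, f x)) ` U" by force
    moreover have "openin Y (f ` T)" using assms ST(2) by (auto simp: open_map_def)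
    ultimately show "\<exists>S T. openin W S \<and> openin Y T \<and> w \<in> S \<and> y \<in> T \<and> S \<times> T \<subseteq> (\<lambda>(w, x). (w, f x)) ` U"
      using ST x by blast
  qed
qed

text \<open>The covering argument sees the lattice only as a \<open>P\<close>-invariant subgroup
  with a positive lower bound on lengths; bases enter when characters are counted.\<close>

locale lattice_action =
  fixes L :: "(real^2) set" and P :: "(real^2^2) monoid" and E :: "'e topology" and \<psi> :: "real^2^2 \<Rightarrow> 'e \<Rightarrow> 'e"
  assumes P_mult: "monoid.mult P = (**)" and P_one: "\<one>\<^bsub>P\<^esub> = mat 1"
    and univ: "universal_space P E \<psi>"
    and L_0: "0 \<in> L" and L_add: "\<And>a b. \<lbrakk>a \<in> L; b \<in> L\<rbrakk> \<Longrightarrow> a + b \<in> L" and L_minus: "\<And>a. a \<in> L \<Longrightarrow> - a \<in> L"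
    and P_L: "\<And>A a. \<lbrakk>A \<in> carrier P; a \<in> L\<rbrakk> \<Longrightarrow> A *v a \<in> L"
    and L_discrete: "\<exists>\<epsilon>>0. \<forall>a\<in>L. a \<noteq> 0 \<longrightarrow> \<epsilon> \<le> norm a"
begin

abbreviation L_group :: "(real^2) monoid" where
  "L_group \<equiv> \<lparr>carrier = L, mult = (+), one = 0\<rparr>"
abbreviation coset :: "real^2 \<Rightarrow> (real^2) set" where
  "coset \<equiv> orbit L_group (+)"
abbreviation "E_plane \<equiv> prod_topology E (euclidean :: (real^2) topology)"
abbreviation "E_torus \<equiv> prod_topology E (torus L)"
abbreviation "Borel \<equiv> borel_construction P E \<psi> (torus L) torus_action"
abbreviation "\<Gamma> \<equiv> semidirect L P"
abbreviation "diag \<equiv> \<lambda>g. map_prod (\<psi> g) (torus_action g)"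

sublocale P: group P using univ by (simp add: universal_space_def)

sublocale trans: continuous_action L_group "euclidean :: (real^2) topology" "(+)"
proof -
  have "group L_group"
    by (rule groupI) (use L_0 L_add L_minus in \<open>auto intro: bexI[of _ "- _"]\<close>)
  then show "continuous_action L_group (euclidean :: (real^2) topology) (+)"
    by (auto simp: continuous_action_def continuous_action_axioms_def add.assoc intro: continuous_intros)
qed

text \<open>\<open>group_action\<close> maps into \<open>BijGroup\<close>, whose elements are
  extensional on the space. The pointwise laws of \<open>continuous_action\<close> also fit
  \<open>diag\<close> and \<open>cover_act\<close>, which need not be extensional.\<close>

sublocale univ: continuous_action P E \<psi>
proof -
  interpret a: group_action P "topspace E" \<psi> using univ by (simp add: universal_space_def)
  show "continuous_action P E \<psi>"
  proof
    show "\<psi> \<one>\<^bsub>P\<^esub> e = e" if "e \<in> topspace E" for e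
      using a.id_eq_one that by (metis restrict_apply')
    show "\<psi> (g \<otimes>\<^bsub>P\<^esub> h) e = \<psi> g (\<psi> h e)" if "g \<in> carrier P" "h \<in> carrier P" "e \<in> topspace E" for g h e
      using a.composition_rule that by blast
    show "continuous_map E E (\<psi> g)" if "g \<in> carrier P" for g
      using that univ by (simp add: universal_space_def)
  qed
qed

lemma coset_eq: "coset x = {a + x |a. a \<in> L}"
  by (auto simp: orbit_def)

lemma topspace_torus: "topspace (torus L) = range coset"
  by (auto simp: torus_def topspace_orbit_space orbits_def)

text \<open>One inclusion uses that \<open>A\<close> preserves \<open>L\<close>; the other uses the
  same for its inverse, which also lies in \<open>P\<close>.\<close>

lemma torus_action_coset:
  assumes A: "A \<in> carrier P"
  shows "torus_action A (coset x) = coset (A *v x)"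
proof -
  have "A *v a + A *v x \<in> coset (A *v x)" if "a \<in> L" for a
    using P_L[OF A that] by (auto simp: coset_eq)
  moreover have "b + A *v x \<in> torus_action A (coset x)" if b: "b \<in> L" for b
  proof -
    let ?B = "inv\<^bsub>P\<^esub> A"
    have "A ** ?B = mat 1" using P.r_inv[OF A] by (simp add: P_mult P_one)
    then have "A *v (?B *v b + x) = b + A *v x"
      by (simp add: matrix_vector_right_distrib matrix_vector_mul_assoc)
    moreover have "?B *v b \<in> L" using P_L b A by simp
    ultimately show ?thesis
      unfolding torus_action_def coset_eq by (intro image_eqI[of _ _ "?B *v b + x"]) auto
  qed
  ultimately show ?thesis
    by (auto simp: torus_action_def coset_eq matrix_vector_right_distrib)
qed

lemma torus_quotient: "quotient_map euclidean (torus L) coset"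
  unfolding torus_def by (rule quotient_map_orbit_space)

lemma coset_cont: "continuous_map euclidean (torus L) coset"
  by (rule quotient_imp_continuous_map[OF torus_quotient])

lemma continuous_map_torus_action:
  assumes A: "A \<in> carrier P"
  shows "continuous_map (torus L) (torus L) (torus_action A)"
proof -
  have "continuous_map euclidean euclidean ((*v) A)"
    by (simp add: linear_continuous_on_compose matrix_vector_mult_linear_continuous_on)
  then have "continuous_map euclidean (torus L) (coset \<circ> (*v) A)"
    using coset_cont by (rule continuous_map_compose)
  moreover have "torus_action A \<circ> coset = coset \<circ> (*v) A"
    using torus_action_coset[OF A] by auto
  ultimately show ?thesis
    using continuous_compose_quotient_map[OF torus_quotient] by metis
qed

sublocale diag: continuous_action P "E_torus" diag
proof
  fix x assume "x \<in> topspace (E_torus)"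
  then obtain e y where x: "x = (e, coset y)" "e \<in> topspace E" by (auto simp: topspace_torus)
  show "diag \<one>\<^bsub>P\<^esub> x = x"
    using univ.act_one x torus_action_coset[OF P.one_closed, of y] by (simp add: P_one)
  fix A B assume AB: "A \<in> carrier P" "B \<in> carrier P"
  have "coset ((A ** B) *v y) = torus_action A (torus_action B (coset y))"
    using torus_action_coset AB by (simp add: matrix_vector_mul_assoc)
  then show "diag (A \<otimes>\<^bsub>P\<^esub> B) x = diag A (diag B x)"
    using univ.act_mult[OF AB x(2)] x torus_action_coset[OF P.m_closed[OF AB], of y] by (simp add: P_mult)
next
  fix A assume A: "A \<in> carrier P"
  show "continuous_map (E_torus) (E_torus) (diag A)"
    using univ.act_cont[OF A] continuous_map_torus_action[OF A]
    unfolding map_prod_def by (simp add: continuous_map_prod_top)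
qed

definition cover_act :: "(real^2) \<times> (real^2^2) \<Rightarrow> 'e \<times> (real^2) \<Rightarrow> 'e \<times> (real^2)" where
  "cover_act = (\<lambda>(a, A) (e, x). (\<psi> A e, a + A *v x))"

definition cover_map :: "'e \<times> (real^2) \<Rightarrow> ('e \<times> (real^2) set) set" where
  "cover_map = (\<lambda>(e, x). orbit P diag (e, coset x))"

lemma group_semidirect: "group \<Gamma>"
proof (rule groupI)
  fix g assume "g \<in> carrier \<Gamma>"
  then obtain a A where g: "g = (a, A)" "a \<in> L" "A \<in> carrier P" by auto
  let ?B = "inv\<^bsub>P\<^esub> A"
  have "?B ** A = mat 1" using P.l_inv[OF g(3)] by (simp add: P_mult P_one)
  then have "(?B *v (- a), ?B) \<otimes>\<^bsub>\<Gamma>\<^esub> g = \<one>\<^bsub>\<Gamma>\<^esub>"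
    by (simp add: g flip: matrix_vector_right_distrib)
  moreover have "(?B *v (- a), ?B) \<in> carrier \<Gamma>" using P_L L_minus g by simp
  ultimately show "\<exists>h\<in>carrier \<Gamma>. h \<otimes>\<^bsub>\<Gamma>\<^esub> g = \<one>\<^bsub>\<Gamma>\<^esub>" by blast
qed (use L_0 L_add P_L P.m_closed P.one_closed in
  \<open>auto simp: P_mult P_one matrix_vector_right_distrib matrix_vector_mul_assoc matrix_mul_assoc add.assoc\<close>)

lemma E_wandering:
  assumes "e \<in> topspace E"
  shows "\<exists>U. openin E U \<and> e \<in> U \<and> (\<forall>g\<in>carrier P. g \<noteq> \<one>\<^bsub>P\<^esub> \<longrightarrow> \<psi> g ` U \<inter> U = {})"
  by (rule univ.finite_free_imp_wandering[OF _ _ _ assms])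
    (use univ in \<open>auto simp: universal_space_def\<close>)

sublocale E_cover: regular_cover P E \<psi> "orbit_space P \<psi> E" "orbit P \<psi>"
proof
  show "\<exists>U. openin E U \<and> e \<in> U \<and> (\<forall>g\<in>carrier P. g \<noteq> \<one>\<^bsub>P\<^esub> \<longrightarrow> \<psi> g ` U \<inter> U = {})"
    if "e \<in> topspace E" for e by (rule E_wandering[OF that])
qed (use univ.orbit_cont univ.open_map_orbit univ.orbit_surj univ.orbit_eq_iff in auto)

text \<open>Freeness has two sources: \<open>P\<close> moves every point of \<open>E\<close>, and an
  element with trivial matrix part moves the plane by a lattice vector. The fibres are orbits
  because equality in the Borel construction is equality up to \<open>P\<close> of cosets, that is,
  equality of points up to \<open>P\<close> and \<open>L\<close>.\<close>

sublocale cover: regular_cover \<Gamma> "E_plane" cover_act Borel cover_map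
proof (unfold regular_cover_def continuous_action_def continuous_action_axioms_def regular_cover_axioms_def,
    intro conjI allI impI group_semidirect)
  fix y :: "'e \<times> (real^2)" assume "y \<in> topspace E_plane"
  then obtain e x where y: "y = (e, x)" "e \<in> topspace E" by auto
  show "cover_act \<one>\<^bsub>\<Gamma>\<^esub> y = y"
    using univ.act_one y by (simp add: cover_act_def P_one)
  show "cover_act (g \<otimes>\<^bsub>\<Gamma>\<^esub> h) y = cover_act g (cover_act h y)" if "g \<in> carrier \<Gamma>" "h \<in> carrier \<Gamma>" for g h
    using that y univ.act_mult
    by (auto simp: cover_act_def P_mult matrix_vector_right_distrib matrix_vector_mul_assoc add.assoc)
  show "\<exists>U. openin E_plane U \<and> y \<in> U \<and> (\<forall>g\<in>carrier \<Gamma>. g \<noteq> \<one>\<^bsub>\<Gamma>\<^esub> \<longrightarrow> cover_act g ` U \<inter> U = {})"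
  proof -
    obtain U where U: "openin E U" "e \<in> U" "\<And>g. g \<in> carrier P \<Longrightarrow> g \<noteq> \<one>\<^bsub>P\<^esub> \<Longrightarrow> \<psi> g ` U \<inter> U = {}"
      using E_wandering[OF y(2)] by metis
    obtain \<epsilon> where \<epsilon>: "\<epsilon> > 0" "\<And>a. a \<in> L \<Longrightarrow> a \<noteq> 0 \<Longrightarrow> \<epsilon> \<le> norm a" using L_discrete by metis
    \<comment> \<open>The factor \<open>U\<close> disposes of the matrix part. Radius
      \<open>\<epsilon> / 2\<close> disposes of the rest: a lattice translation that keeps a point
      inside the ball has length below \<epsilon>.\<close>
    define W where "W = U \<times> ball x (\<epsilon> / 2)"
    have "openin E_plane W" using U(1) by (simp add: W_def openin_prod_Times_iff)
    moreover have "y \<in> W" using U(2) y \<epsilon>(1) by (simp add: W_def)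
    moreover have "g = \<one>\<^bsub>\<Gamma>\<^esub>" if g: "g \<in> carrier \<Gamma>" and u: "u \<in> W" "cover_act g u \<in> W" for g u
    proof -
      obtain a A where aA: "g = (a, A)" "a \<in> L" "A \<in> carrier P" using g by auto
      obtain v w where vw: "u = (v, w)" "v \<in> U" "w \<in> ball x (\<epsilon> / 2)" using u by (auto simp: W_def)
      have 1: "\<psi> A v \<in> U" "a + A *v w \<in> ball x (\<epsilon> / 2)" using u aA vw by (auto simp: cover_act_def W_def)
      have "A = \<one>\<^bsub>P\<^esub>" using U(3)[OF aA(3)] 1 vw by (auto simp: disjoint_iff)
      then have A: "A = mat 1" by (simp add: P_one)
      have "dist w (a + w) < \<epsilon>"
        using 1 vw dist_triangle_half_r[of x w \<epsilon> "a + w"] by (simp add: A)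
      then have "norm a < \<epsilon>" by (simp add: dist_norm)
      then have "a = 0" using \<epsilon>(2)[OF aA(2)] by force
      then show ?thesis using aA A by simp
    qed
    ultimately show ?thesis by (intro exI[of _ W]) (auto simp: disjoint_iff)
  qed
next
  fix g assume "g \<in> carrier \<Gamma>"
  then obtain a A where g: "g = (a, A)" "A \<in> carrier P" by auto
  have "continuous_map euclidean euclidean (\<lambda>x. a + A *v x)"
    by (simp add: continuous_on_add[OF continuous_on_const matrix_vector_mult_linear_continuous_on])
  then show "continuous_map E_plane E_plane (cover_act g)"
    using univ.act_cont[OF g(2)] by (simp add: cover_act_def g continuous_map_prod_top)
next
  \<comment> \<open>The covering map factors through \<open>E_torus\<close>; continuity and openness
    are inherited from the quotients by \<open>L\<close> and by \<open>P\<close> in turn.\<close>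
  have eq: "cover_map = orbit P diag \<circ> (\<lambda>(e, x). (e, coset x))" by (auto simp: cover_map_def)
  have B: "Borel = orbit_space P diag (E_torus)" by (simp add: borel_construction_def)
  have "continuous_map E_plane (E_torus) (\<lambda>(e, x). (e, coset x))"
    using coset_cont by (simp add: continuous_map_prod_top)
  then show "continuous_map E_plane Borel cover_map"
    unfolding eq B using diag.orbit_cont by (rule continuous_map_compose)
  have "open_map E_plane (E_torus) (\<lambda>(e, x). (e, coset x))"
    by (rule open_map_prod_id) (use trans.open_map_orbit in \<open>simp add: torus_def\<close>)
  then show "open_map E_plane Borel cover_map"
    unfolding eq B using diag.open_map_orbit by (rule open_map_compose)
  have "(\<lambda>(e, x). (e, coset x)) ` topspace E_plane = topspace (E_torus)"
    by (auto simp: topspace_torus)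
  then show "cover_map ` topspace E_plane = topspace Borel"
    unfolding eq B using diag.orbit_surj by (metis image_comp)
next
  fix y z :: "'e \<times> (real^2)"
  assume "y \<in> topspace E_plane" "z \<in> topspace E_plane"
  then obtain e x e' x' where yz: "y = (e, x)" "z = (e', x')" "e \<in> topspace E" "e' \<in> topspace E" by auto
  have "cover_map y = cover_map z \<longleftrightarrow> (\<exists>A\<in>carrier P. (e', coset x') = diag A (e, coset x))"
    unfolding cover_map_def yz prod.case
    by (rule diag.orbit_eq_iff) (use yz in \<open>auto simp: topspace_torus\<close>)
  also have "\<dots> \<longleftrightarrow> (\<exists>A\<in>carrier P. e' = \<psi> A e \<and> coset (A *v x) = coset x')"
    using torus_action_coset by auto
  also have "\<dots> \<longleftrightarrow> (\<exists>A\<in>carrier P. e' = \<psi> A e \<and> (\<exists>a\<in>L. x' = a + A *v x))"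
    using trans.orbit_eq_iff by simp
  also have "\<dots> \<longleftrightarrow> (\<exists>g\<in>carrier \<Gamma>. z = cover_act g y)"
    by (auto simp: yz cover_act_def)
  finally show "cover_map y = cover_map z \<longleftrightarrow> (\<exists>g\<in>carrier \<Gamma>. z = cover_act g y)" .
qed

lemma image_fst_orbit: "fst ` orbit P diag (e, t) = orbit P \<psi> e"
  by (force simp: orbit_def)

lemma continuous_map_image_fst: "continuous_map Borel (orbit_space P \<psi> E) ((`) fst)"
proof -
  have eq: "(`) fst \<circ> orbit P diag = orbit P \<psi> \<circ> fst"
    using image_fst_orbit by auto
  moreover have "continuous_map (E_torus) (orbit_space P \<psi> E) (orbit P \<psi> \<circ> fst)"
    by (rule continuous_map_compose[OF continuous_map_fst univ.orbit_cont])
  ultimately show ?thesis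
    unfolding borel_construction_def
    by (intro continuous_compose_quotient_map[OF quotient_map_orbit_space]) (simp only: eq)
qed

theorem equivariant_filtration:
  fixes A :: "('a, 'k) monoid_scheme"
  assumes A: "comm_group A" and A2: "\<And>a. a \<in> carrier A \<Longrightarrow> a \<otimes>\<^bsub>A\<^esub> a = \<one>\<^bsub>A\<^esub>"
    and G: "card (carrier (hom_group \<Gamma> A)) = 2 ^ (m + k)" and K: "card (carrier (hom_group P A)) = 2 ^ m"
  defines "H \<equiv> equivariant_cohomology 1 P E \<psi> (torus L) torus_action A"
    and "F \<equiv> equivariant_F1H1 P E \<psi> (torus L) torus_action A"
  shows "H \<cong> Z2_sum (m + k) \<and> H\<lparr>carrier := F\<rparr> \<cong> Z2_sum m \<and> H Mod F \<cong> Z2_sum k"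
proof -
  interpret A: comm_group A by (rule A)
  have "topspace E \<noteq> {}" using univ unfolding universal_space_def by blast
  then obtain e where e: "e \<in> topspace E" by blast
  define \<sigma>0 where "\<sigma>0 = (\<lambda>_\<in>standard_simplex 0. (e, 0 :: real^2))"
  have \<sigma>0: "singular_simplex 0 E_plane \<sigma>0"
    using e by (auto simp: singular_simplex_def \<sigma>0_def)
  have E: "contractible_space E" using univ by (simp add: universal_space_def)
  have "contractible_space (euclidean :: (real^2) topology)"
    using contractible_space_top_of_set[of "UNIV :: (real^2) set"] convex_imp_contractible[OF convex_UNIV] by simp
  then have Y: "contractible_space E_plane" using E by (simp add: contractible_space_prod_topology)
  have fst: "continuous_map E_plane E fst" by (rule continuous_map_fst)
  \<comment> \<open>Forgetting the plane (\<open>fst\<close>) is equivariant along forgetting the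
    translation part (\<open>snd\<close>), and induces the bundle projection on the
    quotients.\<close>
  interpret m: cover_morphism \<Gamma> E_plane cover_act Borel cover_map A \<sigma>0 P E \<psi> "orbit_space P \<psi> E" "orbit P \<psi>" fst snd "(`) fst"
  proof
    show "singular_simplex 0 E_plane \<sigma>0" "contractible_space E_plane" "contractible_space E" by fact+
    show "singular_simplex 0 E (simplex_map 0 fst \<sigma>0)" by (rule singular_simplex_simplex_map[OF \<sigma>0 fst])
    show "snd \<in> hom \<Gamma> P" by (auto simp: hom_def P_mult)
    show "snd ` carrier \<Gamma> = carrier P" using L_0 by auto
    show "continuous_map Borel (orbit_space P \<psi> E) ((`) fst)" by (rule continuous_map_image_fst)
    show "fst ` cover_map y = orbit P \<psi> (fst y)" for y
      by (simp add: cover_map_def case_prod_unfold image_fst_orbit)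
  qed (auto simp: fst cover_act_def)
  show ?thesis
    using m.cohomology_filtration_Z2[OF A2 G K]
    unfolding H_def F_def equivariant_cohomology_def equivariant_F1H1_def .
qed

end

section \<open>Counting characters\<close>

text \<open>The witness for \<open>onto\<close> may fail to be extensional; the hypothesis on
  \<open>restrict\<close> moves it into the carrier of \<open>hom_group\<close> without changing its
  invariant \<open>r\<close>.\<close>

lemma card_hom_group_eq:
  assumes inj: "\<And>f g. \<lbrakk>f \<in> hom G A; g \<in> hom G A; r f = r g\<rbrakk> \<Longrightarrow> \<forall>x\<in>carrier G. f x = g x"
    and into: "\<And>f. f \<in> hom G A \<Longrightarrow> r f \<in> I"
    and onto: "\<And>i. i \<in> I \<Longrightarrow> \<exists>f\<in>hom G A. r f = i"
    and restrict: "\<And>f. r (restrict f (carrier G)) = r f"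
    and G: "group G"
  shows "card (carrier (hom_group G A)) = card I"
proof -
  interpret G: group G by fact
  have "bij_betw r (carrier (hom_group G A)) I"
    unfolding bij_betw_def
  proof
    show "inj_on r (carrier (hom_group G A))"
    proof (rule inj_onI)
      fix f g assume fg: "f \<in> carrier (hom_group G A)" "g \<in> carrier (hom_group G A)" "r f = r g"
      then show "f = g"
        using inj by (intro extensionalityI[of f "carrier G" g]) (auto simp: hom_group_carrier)
    qed
    show "r ` carrier (hom_group G A) = I"
    proof
      show "r ` carrier (hom_group G A) \<subseteq> I" using into by (auto simp: hom_group_carrier)
      show "I \<subseteq> r ` carrier (hom_group G A)"
      proof
        fix i assume "i \<in> I"
        then obtain f where f: "f \<in> hom G A" "r f = i" using onto by blast
        have "restrict f (carrier G) \<in> carrier (hom_group G A)"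
          using f(1) by (auto simp: hom_group_carrier hom_def)
        then show "i \<in> r ` carrier (hom_group G A)"
          using restrict[of f] f(2) by (metis image_eqI)
      qed
    qed
  qed
  then show ?thesis by (rule bij_betw_same_card)
qed

lemma Z2_carrier: "carrier Z2 = {0, 1}"
  by (auto simp: carrier_integer_mod_group)

lemma Z2_hom_pow:
  assumes "group G" "f \<in> hom G Z2" "x \<in> carrier G"
  shows "f (x [^]\<^bsub>G\<^esub> (i::int)) = (i * f x) mod 2"
proof -
  interpret f: group_hom G Z2 f
    using assms by (simp add: group_hom_def group_hom_axioms_def)
  show ?thesis
    using f.hom_int_pow[OF assms(3), of i] assms(3) by (simp add: int_pow_integer_mod_group)
qed

lemma Z2_hom_value: "\<lbrakk>f \<in> hom G Z2; x \<in> carrier G\<rbrakk> \<Longrightarrow> f x = 0 \<or> f x = 1"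
  using hom_in_carrier[of f G Z2 x] by (auto simp: Z2_carrier)

lemma Z2_hom_mult: "\<lbrakk>f \<in> hom G Z2; x \<in> carrier G; y \<in> carrier G\<rbrakk> \<Longrightarrow> f (x \<otimes>\<^bsub>G\<^esub> y) = (f x + f y) mod 2"
  using hom_mult[of f G Z2 x y] by simp

lemma (in group) int_pow_eq_iff:
  assumes x: "x \<in> carrier G"
  shows "x [^] (i::int) = x [^] (j::int) \<longleftrightarrow> int (ord x) dvd i - j"
proof -
  have "x [^] (i - j) = x [^] i \<otimes> inv (x [^] j)" by (rule int_pow_diff[OF x])
  also have "\<dots> = \<one> \<longleftrightarrow> x [^] i = x [^] j"
    using x by (metis int_pow_closed inv_closed inv_equality inv_inv r_inv)
  finally show ?thesis using int_pow_eq_id[OF x, of "i - j"] by simp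
qed

text \<open>A character is fixed by its value at a generator, and this value must be killed by
  \<open>n\<close>: it is free for even \<open>n\<close> and 0 for odd \<open>n\<close>.\<close>

lemma card_characters_cyclic:
  fixes G (structure)
  assumes "is_cyclic_of_order n G" "n > 0"
  shows "card (carrier (hom_group G Z2)) = (if even n then 2 else 1)"
proof -
  interpret group G using assms by (simp add: is_cyclic_of_order_def)
  obtain x where x: "x \<in> carrier G" "carrier G = range (\<lambda>i::int. x [^] i)"
    using assms cyclic_group by (auto simp: is_cyclic_of_order_def)
  have n: "card (carrier G) = n" using assms by (simp add: is_cyclic_of_order_def order_def)
  have "generate G {x} = carrier G" using generate_pow[OF x(1)] x(2) by auto
  then have ord: "ord x = n" using generate_pow_card[OF x(1)] n by simp
  define I where "I = {a \<in> {0, 1 :: int}. even n \<or> a = 0}"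
  have "card (carrier (hom_group G Z2)) = card I"
  proof (rule card_hom_group_eq[where r = "\<lambda>f. f x"])
    fix f g assume fg: "f \<in> hom G Z2" "g \<in> hom G Z2" "f x = g x"
    show "\<forall>y\<in>carrier G. f y = g y"
      unfolding x(2) using Z2_hom_pow[OF is_group fg(1) x(1)] Z2_hom_pow[OF is_group fg(2) x(1)] fg(3) by auto
  next
    fix f assume f: "f \<in> hom G Z2"
    have "f (x [^] int n) = f (x [^] (0::int))"
      using int_pow_eq_iff[OF x(1), of "int n" 0] ord by simp
    then have "(int n * f x) mod 2 = 0" unfolding Z2_hom_pow[OF is_group f x(1)] by simp
    then show "f x \<in> I" using Z2_hom_value[OF f x(1)] by (auto simp: I_def)
  next
    fix a assume a: "a \<in> I"
    \<comment> \<open>A discrete logarithm, determined only modulo \<open>n\<close>. The ambiguity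
      disappears in \<open>a * k y\<close> modulo 2, as either \<open>n\<close> is even or
      \<open>a\<close> is 0.\<close>
    define k where "k y = (SOME i::int. y = x [^] i)" for y
    have k: "y = x [^] k y" if "y \<in> carrier G" for y
      using that x(2) unfolding k_def by (metis (mono_tags, lifting) rangeE someI_ex)
    have par: "(a * k (x [^] i)) mod 2 = (a * i) mod 2" for i
    proof -
      have "int n dvd k (x [^] i) - i"
        using k[of "x [^] i"] x(1) int_pow_eq_iff[OF x(1), of "k (x [^] i)" i] ord by simp
      then have "2 dvd a * (k (x [^] i) - i)"
        using a by (auto simp: I_def dvd_def)
      then show ?thesis by (simp add: mod_eq_dvd_iff right_diff_distrib)
    qed
    define f where "f y = (a * k y) mod 2" for y
    have "f \<in> hom G Z2"
    proof (rule homI)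
      fix y z assume yz: "y \<in> carrier G" "z \<in> carrier G"
      show "f y \<in> carrier Z2" by (auto simp: f_def Z2_carrier)
      have "y \<otimes> z = x [^] (k y + k z)"
        using k[OF yz(1)] k[OF yz(2)] int_pow_mult[OF x(1)] by simp
      then show "f (y \<otimes> z) = f y \<otimes>\<^bsub>Z2\<^esub> f z"
        using par[of "k y + k z"] by (simp add: f_def distrib_left mod_simps)
    qed
    moreover have "f x = a"
      using par[of 1] a x(1) by (auto simp: f_def I_def)
    ultimately show "\<exists>f\<in>hom G Z2. f x = a" by blast
  qed (use x is_group in auto)
  also have "I = (if even n then {0, 1} else {0})" by (auto simp: I_def)
  finally show ?thesis by simp
qed

section \<open>Dihedral groups by generators and relations\<close>

locale dihedral_relations = group G for G (structure) +
  fixes C s and n :: nat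
  assumes C: "C \<in> carrier G" and s: "s \<in> carrier G"
    and gen: "generate G {C, s} = carrier G"
    and Cn: "C [^] n = \<one>" and s2: "s [^] (2::nat) = \<one>" and sCsC: "s \<otimes> C \<otimes> s \<otimes> C = \<one>"
    and n: "n > 0"
begin

definition word :: "int \<Rightarrow> int \<Rightarrow> 'a" where "word i j = C [^] i \<otimes> s [^] j"

lemma word_closed: "word i j \<in> carrier G"
  using C s by (simp add: word_def)

lemma s_squared: "s \<otimes> s = \<one>"
  using s2 s by (simp add: numeral_2_eq_2)

lemma s_pow: "s [^] (j::int) = s [^] (j mod 2)"
proof -
  have "s [^] (j::int) = s [^] (2 * (j div 2) + j mod 2)" by simp
  also have "\<dots> = (s [^] (2::int)) [^] (j div 2) \<otimes> s [^] (j mod 2)"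
    using s by (simp only: int_pow_mult int_pow_pow)
  also have "s [^] (2::int) = \<one>" using s2 s by (metis int_pow_int of_nat_numeral)
  finally show ?thesis using s by simp
qed

lemma C_pow: "C [^] (i::int) = C [^] (i mod int n)"
proof -
  have "C [^] (i::int) = C [^] (int n * (i div int n) + i mod int n)" by simp
  also have "\<dots> = (C [^] int n) [^] (i div int n) \<otimes> C [^] (i mod int n)"
    using C by (simp only: int_pow_mult int_pow_pow)
  also have "C [^] int n = \<one>" using Cn by (simp add: int_pow_int)
  finally show ?thesis using C by simp
qed

text \<open>Conjugation by \<open>s\<close> is an endomorphism that inverts \<open>C\<close>, hence
  inverts every power of \<open>C\<close>.\<close>

lemma s_C_pow: "s \<otimes> C [^] (i::int) = C [^] (- i) \<otimes> s"
proof -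
  have "s \<otimes> C \<otimes> s = inv C"
    using inv_equality[of "s \<otimes> C \<otimes> s" C] sCsC C s by simp
  then have c: "s \<otimes> C \<otimes> inv s = inv C"
    using s_squared inv_equality[of s s] s by simp
  have "s \<otimes> C [^] i \<otimes> inv s = (s \<otimes> C \<otimes> inv s) [^] i"
  proof -
    have h: "(\<lambda>x. s \<otimes> x \<otimes> inv s) \<in> hom G G"
    proof (rule homI)
      fix x y assume xy: "x \<in> carrier G" "y \<in> carrier G"
      show "s \<otimes> x \<otimes> inv s \<in> carrier G" using xy s by simp
      have "s \<otimes> x \<otimes> inv s \<otimes> (s \<otimes> y \<otimes> inv s) = s \<otimes> x \<otimes> (inv s \<otimes> s) \<otimes> y \<otimes> inv s"
        using xy s by (simp only: m_assoc m_closed inv_closed)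
      then show "s \<otimes> (x \<otimes> y) \<otimes> inv s = s \<otimes> x \<otimes> inv s \<otimes> (s \<otimes> y \<otimes> inv s)"
        using xy s by (simp add: m_assoc)
    qed
    interpret h: group_hom G G "\<lambda>x. s \<otimes> x \<otimes> inv s"
      using h by unfold_locales
    show ?thesis by (rule h.hom_int_pow[OF C])
  qed
  also have "\<dots> = C [^] (- i)" unfolding c using C by (simp add: int_pow_inv int_pow_neg)
  finally have "s \<otimes> C [^] i \<otimes> inv s \<otimes> s = C [^] (- i) \<otimes> s" by simp
  then show ?thesis using C s by (simp add: m_assoc)
qed

lemma word_mult: "word i j \<otimes> word k l = word (i + (if even j then k else - k)) (j + l)"
proof (cases "even j")
  case True
  then have "s [^] j = \<one>" using s_pow[of j] s by simp
  moreover have "s [^] (j + l) = s [^] l"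
  proof -
    have "(j + l) mod 2 = l mod 2" using True by presburger
    then show ?thesis using s_pow[of "j + l"] s_pow[of l] by metis
  qed
  ultimately show ?thesis using True C s by (simp add: word_def int_pow_mult m_assoc)
next
  case False
  then have sj: "s [^] j = s" using s_pow[of j] s by (simp add: odd_iff_mod_2_eq_one)
  have "word i j \<otimes> word k l = C [^] i \<otimes> (s \<otimes> C [^] k) \<otimes> s [^] l"
    using C s by (simp add: word_def sj m_assoc)
  also have "\<dots> = (C [^] i \<otimes> C [^] (- k)) \<otimes> (s [^] j \<otimes> s [^] l)"
    using C s by (simp add: s_C_pow sj m_assoc)
  also have "\<dots> = word (i + - k) (j + l)"
    unfolding word_def int_pow_mult[OF C] int_pow_mult[OF s] ..
  finally show ?thesis using False by simp
qed

text \<open>The relations alone bring every product to this normal form. Uniqueness of the form is a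
  matter of the order, which the locale leaves open: \<open>G\<close> may be a proper quotient of
  the dihedral group.\<close>

lemma carrier_eq_words: "carrier G = (\<lambda>(i, j). word i j) ` ({0..<int n} \<times> {0..<2})"
proof
  let ?W = "(\<lambda>(i, j). word i j) ` ({0..<int n} \<times> {0..<2})"
  show "?W \<subseteq> carrier G" using word_closed by auto
  have W: "word i j \<in> ?W" for i j
  proof (rule image_eqI[of _ _ "(i mod int n, j mod 2)"])
    show "word i j = (case (i mod int n, j mod 2) of (i, j) \<Rightarrow> word i j)"
      using s_pow[of j] C_pow[of i] by (simp add: word_def)
  qed (use n in auto)
  have "subgroup ?W G"
  proof (rule subgroupI)
    show "?W \<subseteq> carrier G" using word_closed by auto
    show "?W \<noteq> {}" using W by blast
    fix x assume "x \<in> ?W"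
    then obtain i j where x: "x = word i j" by auto
    \<comment> \<open>For even \<open>j\<close> the word is a power of \<open>C\<close>; for odd
      \<open>j\<close> it is an involution, so its inverse keeps the exponent
      \<open>i\<close>.\<close>
    have "word (if even j then - i else i) (- j) \<otimes> word i j = \<one>"
      unfolding word_mult by (simp add: word_def)
    then have "inv x = word (if even j then - i else i) (- j)"
      unfolding x by (intro inv_equality word_closed)
    then show "inv x \<in> ?W" using W by simp
    fix y assume "y \<in> ?W"
    then show "x \<otimes> y \<in> ?W" using x W by (auto simp: word_mult)
  qed
  moreover have "{C, s} \<subseteq> ?W"
  proof -
    have "word 1 0 = C" "word 0 1 = s" using C s by (simp_all add: word_def)
    then show ?thesis using W[of 1 0] W[of 0 1] by (simp only: insert_subset empty_subsetI)
  qed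
  ultimately show "carrier G \<subseteq> ?W"
    using generate_subgroup_incl gen by blast
qed

text \<open>Two coinciding normal forms would yield a trivial power of \<open>C\<close> with
  exponent strictly between 0 and \<open>n\<close>, or \<open>s\<close> as a power of
  \<open>C\<close>.\<close>

lemma order_eq:
  assumes "\<And>i::int. 0 < i \<Longrightarrow> i < int n \<Longrightarrow> C [^] i \<noteq> \<one>" "\<And>i::int. C [^] i \<noteq> s"
  shows "order G = 2 * n"
proof -
  have key: "i = k" if "C [^] i = C [^] k" "i \<in> {0..<int n}" "k \<in> {0..<int n}" for i k :: int
  proof -
    have "C [^] (i - k) = \<one>" "C [^] (k - i) = \<one>" using that C by (simp_all add: int_pow_diff)
    then show ?thesis using assms(1)[of "i - k"] assms(1)[of "k - i"] that by force
  qed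
  have no: "C [^] i \<noteq> C [^] k \<otimes> s" for i k :: int
  proof
    assume "C [^] i = C [^] k \<otimes> s"
    then have "C [^] (- k) \<otimes> C [^] i = C [^] (- k) \<otimes> C [^] k \<otimes> s" using C s by (simp add: m_assoc)
    also have "\<dots> = s" using C s by (simp flip: int_pow_mult)
    finally have "C [^] (- k + i) = s" unfolding int_pow_mult[OF C] .
    then show False using assms(2) by blast
  qed
  have "inj_on (\<lambda>(i, j). word i j) ({0..<int n} \<times> {0..<2})"
  proof (rule inj_onI, clarify)
    fix i j k l :: int
    assume ij: "i \<in> {0..<int n}" "j \<in> {0..<2}" "k \<in> {0..<int n}" "l \<in> {0..<2}" and eq: "word i j = word k l"
    have "j = 0 \<or> j = 1" "l = 0 \<or> l = 1" using ij by auto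
    then show "i = k \<and> j = l"
      using eq C s key[OF _ ij(1,3)] no[of i k] no[of k i]
      by (auto simp: word_def)
  qed
  then have "card (carrier G) = card ({0..<int n} \<times> {0..<2::int})"
    unfolding carrier_eq_words by (rule card_image)
  then show ?thesis by (simp add: order_def)
qed

text \<open>Modulo 2 the relation between \<open>C\<close> and \<open>s\<close> reads 0 = 0, so the
  only constraint on the two values is that \<open>C [^] n\<close> forces 0 at \<open>C\<close> for
  odd \<open>n\<close>. The order makes normal forms unique, so exponents can serve to define a
  character.\<close>

lemma card_characters:
  assumes order: "order G = 2 * n"
  shows "card (carrier (hom_group G Z2)) = (if even n then 4 else 2)"
proof -
  define D where "D = {0..<int n} \<times> {0..<2::int}"
  have inj: "inj_on (\<lambda>(i, j). word i j) D"
  proof (rule eq_card_imp_inj_on)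
    show "finite D" by (simp add: D_def)
    show "card ((\<lambda>(i, j). word i j) ` D) = card D"
      using order carrier_eq_words by (simp add: order_def D_def)
  qed
  define I where "I = {(a, b). a \<in> {0, 1 :: int} \<and> b \<in> {0, 1 :: int} \<and> (even n \<or> a = 0)}"
  have val: "f (word i j) = (i * f C + j * f s) mod 2" if f: "f \<in> hom G Z2" for f i j
    using Z2_hom_mult[OF f, of "C [^] i" "s [^] j"] Z2_hom_pow[OF is_group f C, of i] Z2_hom_pow[OF is_group f s, of j] C s
    by (simp add: word_def mod_simps)
  have "card (carrier (hom_group G Z2)) = card I"
  proof (rule card_hom_group_eq[where r = "\<lambda>f. (f C, f s)"])
    fix f g assume fg: "f \<in> hom G Z2" "g \<in> hom G Z2" "(f C, f s) = (g C, g s)"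
    then show "\<forall>x\<in>carrier G. f x = g x"
      unfolding carrier_eq_words using val[OF fg(1)] val[OF fg(2)] by auto
  next
    fix f assume f: "f \<in> hom G Z2"
    have "f (C [^] int n) = f (C [^] (0::int))" using Cn by (simp add: int_pow_int)
    then have "(int n * f C) mod 2 = 0" unfolding Z2_hom_pow[OF is_group f C] by simp
    then show "(f C, f s) \<in> I" using Z2_hom_value[OF f C] Z2_hom_value[OF f s] by (auto simp: I_def)
  next
    fix ab assume "ab \<in> I"
    then obtain a b where ab: "ab = (a, b)" "a \<in> {0, 1}" "b \<in> {0, 1}" "even n \<or> a = 0" by (auto simp: I_def)
    define k where "k = inv_into D (\<lambda>(i, j). word i j)"
    define f where "f x = (a * fst (k x) + b * snd (k x)) mod 2" for x
    have fw: "f (word i j) = (a * i + b * j) mod 2" for i j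
    proof -
      have "(i mod int n, j mod 2) \<in> D" using n by (auto simp: D_def)
      then have "k (word (i mod int n) (j mod 2)) = (i mod int n, j mod 2)"
        using inv_into_f_f[OF inj, of "(i mod int n, j mod 2)"] by (simp add: k_def)
      then have "k (word i j) = (i mod int n, j mod 2)"
        using s_pow[of j] C_pow[of i] by (simp add: word_def)
      moreover have "(a * (i mod int n)) mod 2 = (a * i) mod 2"
        using ab(4)
      proof
        assume "even n"
        then have "(i mod int n) mod 2 = i mod 2" by (simp add: mod_mod_cancel)
        then show ?thesis by (metis mod_mult_right_eq)
      qed simp
      ultimately show ?thesis by (simp add: f_def) (metis mod_add_cong mod_mult_right_eq)
    qed
    have "f \<in> hom G Z2"
    proof (rule homI)
      fix x y assume "x \<in> carrier G" "y \<in> carrier G"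
      then obtain i j k l where xy: "x = word i j" "y = word k l" by (auto simp: carrier_eq_words)
      show "f x \<in> carrier Z2" by (auto simp: f_def Z2_carrier)
      \<comment> \<open>The sign with which \<open>s\<close> twists the exponents of
        \<open>C\<close> is invisible modulo 2.\<close>
      have "(a * (i + (if even j then k else - k)) + b * (j + l)) mod 2 = ((a * i + b * j) + (a * k + b * l)) mod 2"
        by (simp add: mod_eq_dvd_iff algebra_simps)
      then show "f (x \<otimes> y) = f x \<otimes>\<^bsub>Z2\<^esub> f y"
        unfolding xy word_mult fw by (simp add: mod_simps)
    qed
    moreover have "f C = a" "f s = b"
      using fw[of 1 0] fw[of 0 1] ab C s by (auto simp: word_def)
    ultimately show "\<exists>f\<in>hom G Z2. (f C, f s) = ab" using ab by auto
  qed (use C s is_group in auto)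
  also have "I = (if even n then {0, 1} \<times> {0, 1} else {0} \<times> {0, 1})" by (auto simp: I_def)
  finally show ?thesis by (simp add: card_cartesian_product)
qed

end

lemma card_characters_dihedral:
  assumes "is_dihedral n G" "n > 0"
  shows "card (carrier (hom_group G Z2)) = (if even n then 4 else 2)"
proof -
  from assms obtain C s where "dihedral_relations G C s n" and "order G = 2 * n"
    by (auto simp: is_dihedral_def dihedral_relations_def dihedral_relations_axioms_def)
  then show ?thesis by (rule dihedral_relations.card_characters)
qed

lemma is_cyclic_of_order_iso:
  assumes G: "is_cyclic_of_order n G" and h: "h \<in> iso G H" and H: "group H"
  shows "is_cyclic_of_order n H"
proof -
  interpret G: group G using G by (simp add: is_cyclic_of_order_def)
  have "h \<in> epi G H" using h by (simp add: iso_iff_mon_epi)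
  moreover have "order H = order G"
    using bij_betw_same_card[of h "carrier G" "carrier H"] h by (simp add: iso_def order_def)
  ultimately show ?thesis
    using G H G.cyclic_group_epimorphic_image by (auto simp: is_cyclic_of_order_def)
qed

lemma is_dihedral_iso:
  assumes G: "is_dihedral n G" and h: "h \<in> iso G H" and H: "group H"
  shows "is_dihedral n H"
proof -
  interpret H: group H by fact
  interpret G: group G using G by (simp add: is_dihedral_def)
  interpret h: group_hom G H h using h by unfold_locales (simp add: iso_def)
  obtain C s where Cs: "C \<in> carrier G" "s \<in> carrier G" "generate G {C, s} = carrier G"
    "C [^]\<^bsub>G\<^esub> n = \<one>\<^bsub>G\<^esub>" "s [^]\<^bsub>G\<^esub> (2::nat) = \<one>\<^bsub>G\<^esub>" "s \<otimes>\<^bsub>G\<^esub> C \<otimes>\<^bsub>G\<^esub> s \<otimes>\<^bsub>G\<^esub> C = \<one>\<^bsub>G\<^esub>"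
    and order: "order G = 2 * n"
    using G by (auto simp: is_dihedral_def)
  have "order H = 2 * n"
    using bij_betw_same_card[of h "carrier G" "carrier H"] h order by (simp add: iso_def order_def)
  moreover have "generate H {h C, h s} = carrier H"
    using h.generate_img[of "{C, s}"] Cs h by (simp add: iso_def bij_betw_def)
  moreover have "h C [^]\<^bsub>H\<^esub> n = \<one>\<^bsub>H\<^esub>" "h s [^]\<^bsub>H\<^esub> (2::nat) = \<one>\<^bsub>H\<^esub>"
    using h.hom_nat_pow[OF Cs(1), of n] h.hom_nat_pow[OF Cs(2), of 2] Cs by simp_all
  moreover have "h s \<otimes>\<^bsub>H\<^esub> h C \<otimes>\<^bsub>H\<^esub> h s \<otimes>\<^bsub>H\<^esub> h C = \<one>\<^bsub>H\<^esub>"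
  proof -
    have "h (s \<otimes>\<^bsub>G\<^esub> C \<otimes>\<^bsub>G\<^esub> s \<otimes>\<^bsub>G\<^esub> C) = \<one>\<^bsub>H\<^esub>" unfolding Cs(6) by simp
    then show ?thesis using Cs(1,2) by simp
  qed
  ultimately show ?thesis using H Cs unfolding is_dihedral_def by (meson h.hom_closed)
qed

lemma (in group) is_cyclic_of_order_generate:
  assumes x: "x \<in> carrier G" and n: "ord x = n"
  shows "is_cyclic_of_order n (G\<lparr>carrier := generate G {x}\<rparr>)"
proof -
  let ?H = "G\<lparr>carrier := generate G {x}\<rparr>"
  have sub: "subgroup (generate G {x}) G" by (rule generate_is_subgroup) (use x in simp)
  interpret H: group ?H by (rule subgroup_imp_group[OF sub])
  have "cyclic_group ?H"
    unfolding H.cyclic_group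
  proof
    show xH: "x \<in> carrier ?H" by (simp add: generate.incl)
    show "carrier ?H = range (\<lambda>i::int. x [^]\<^bsub>?H\<^esub> i)"
    proof -
      have "x [^]\<^bsub>?H\<^esub> i = x [^] i" for i :: int
        using int_pow_consistent[OF sub, of x] xH by simp
      then show ?thesis using generate_pow[OF x] by (simp add: full_SetCompr_eq)
    qed
  qed
  then show ?thesis
    using H.is_group generate_pow_card[OF x] n by (simp add: is_cyclic_of_order_def order_def)
qed

text \<open>The last two hypotheses prevent a collapse to a proper quotient: the powers of
  \<open>C\<close> below \<open>n\<close> are distinct, and \<open>s\<close> is not among
  them.\<close>

lemma (in group) is_dihedral_generate:
  assumes C: "C \<in> carrier G" and s: "s \<in> carrier G" and n: "n > 0"
    and Cn: "C [^] n = \<one>" and s2: "s \<otimes> s = \<one>" and sCsC: "s \<otimes> C \<otimes> s \<otimes> C = \<one>"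
    and C1: "\<And>i::int. 0 < i \<Longrightarrow> i < int n \<Longrightarrow> C [^] i \<noteq> \<one>" and Cs: "\<And>i::int. C [^] i \<noteq> s"
  shows "is_dihedral n (G\<lparr>carrier := generate G {C, s}\<rparr>)"
proof -
  let ?H = "G\<lparr>carrier := generate G {C, s}\<rparr>"
  have sub: "subgroup (generate G {C, s}) G" by (rule generate_is_subgroup) (use C s in simp)
  interpret H: group ?H by (rule subgroup_imp_group[OF sub])
  have in_H: "C \<in> generate G {C, s}" "s \<in> generate G {C, s}" by (auto intro: generate.incl)
  have pow: "x [^]\<^bsub>?H\<^esub> (i::int) = x [^] i" if "x \<in> generate G {C, s}" for x i
    using int_pow_consistent[OF sub that] by simp
  have npow: "x [^]\<^bsub>?H\<^esub> (i::nat) = x [^] i" for x i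
    using nat_pow_consistent by simp
  interpret d: dihedral_relations ?H C s n
  proof
    show "generate ?H {C, s} = carrier ?H"
      using generate_consistent[OF _ sub, of "{C, s}"] in_H by simp
    show "C [^]\<^bsub>?H\<^esub> n = \<one>\<^bsub>?H\<^esub>" "s [^]\<^bsub>?H\<^esub> (2::nat) = \<one>\<^bsub>?H\<^esub>"
      using Cn s2 s by (simp_all add: npow numeral_2_eq_2)
  qed (use in_H sCsC n in simp_all)
  have "order ?H = 2 * n"
    by (rule d.order_eq) (use C1 Cs pow in_H in simp_all)
  then show ?thesis
    using H.is_group d.C d.s d.gen d.Cn d.s2 d.sCsC unfolding is_dihedral_def by blast
qed

section \<open>Characters of the semidirect product and of the lattice\<close>

context lattice_action
begin

definition invariant_characters :: "('a, 'k) monoid_scheme \<Rightarrow> (real^2 \<Rightarrow> 'a) set" where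
  "invariant_characters A =
     {\<alpha> \<in> carrier (hom_group L_group A). \<forall>X\<in>carrier P. \<forall>a\<in>L. \<alpha> (X *v a) = \<alpha> a}"

text \<open>Conjugation by \<open>X\<close> moves the translation by \<open>a\<close> to that by
  \<open>X *v a\<close>, and an abelian \<open>A\<close> cannot see conjugation; hence the
  invariance. The splitting allows the two restrictions to be prescribed independently.\<close>

lemma card_hom_semidirect:
  fixes A :: "('a, 'k) monoid_scheme"
  assumes "comm_group A"
  shows "card (carrier (hom_group \<Gamma> A)) = card (invariant_characters A) * card (carrier (hom_group P A))"
proof -
  interpret A: comm_group A by fact
  have P1: "mat 1 \<in> carrier P" using P.one_closed by (simp add: P_one)
  have "card (carrier (hom_group \<Gamma> A)) = card (invariant_characters A \<times> carrier (hom_group P A))"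
  proof (rule card_hom_group_eq[where r = "\<lambda>f. (\<lambda>a\<in>L. f (a, mat 1), \<lambda>X\<in>carrier P. f (0, X))"])
    fix f g assume f: "f \<in> hom \<Gamma> A" and g: "g \<in> hom \<Gamma> A"
      and eq: "(\<lambda>a\<in>L. f (a, mat 1), \<lambda>X\<in>carrier P. f (0, X)) = (\<lambda>a\<in>L. g (a, mat 1), \<lambda>X\<in>carrier P. g (0, X))"
    have dec: "h (a, X) = h (a, mat 1) \<otimes>\<^bsub>A\<^esub> h (0, X)" if "h \<in> hom \<Gamma> A" "a \<in> L" "X \<in> carrier P" for h a X
      using hom_mult[OF that(1), of "(a, mat 1)" "(0, X)"] that(2,3) P1 L_0 by simp
    have "f (a, X) = g (a, X)" if "a \<in> L" "X \<in> carrier P" for a X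
    proof -
      have "(\<lambda>a\<in>L. f (a, mat 1)) = (\<lambda>a\<in>L. g (a, mat 1))" "(\<lambda>X\<in>carrier P. f (0, X)) = (\<lambda>X\<in>carrier P. g (0, X))"
        using eq by (simp_all only: prod.inject)
      from fun_cong[OF this(1), of a] fun_cong[OF this(2), of X] show ?thesis
        using dec[OF f that] dec[OF g that] that by simp
    qed
    then show "\<forall>x\<in>carrier \<Gamma>. f x = g x" by auto
  next
    fix f assume f: "f \<in> hom \<Gamma> A"
    have cl: "f (a, X) \<in> carrier A" if "a \<in> L" "X \<in> carrier P" for a X
      using hom_in_carrier[OF f, of "(a, X)"] that by simp
    have mult: "f (a + X *v b, X ** Y) = f (a, X) \<otimes>\<^bsub>A\<^esub> f (b, Y)"
      if "a \<in> L" "X \<in> carrier P" "b \<in> L" "Y \<in> carrier P" for a X b Y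
      using hom_mult[OF f, of "(a, X)" "(b, Y)"] that by simp
    have inv: "f (X *v a, mat 1) = f (a, mat 1)" if "a \<in> L" "X \<in> carrier P" for a X
    proof -
      \<comment> \<open>The element with translation part \<open>X *v a\<close> and matrix part
        \<open>X\<close> is factored in both orders.\<close>
      have "f (0, X) \<otimes>\<^bsub>A\<^esub> f (a, mat 1) = f (X *v a, X)"
        using mult[of 0 X a "mat 1"] that L_0 P1 by simp
      also have "\<dots> = f (0, X) \<otimes>\<^bsub>A\<^esub> f (X *v a, mat 1)"
        using mult[of "X *v a" "mat 1" 0 X] that L_0 P1 P_L cl by (simp add: A.m_comm)
      finally show ?thesis using cl that L_0 P1 P_L by simp
    qed
    have 1: "(\<lambda>a\<in>L. f (a, mat 1)) \<in> invariant_characters A"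
      unfolding invariant_characters_def hom_group_carrier
      using cl mult[of _ "mat 1" _ "mat 1"] inv P1 L_add P_L
      by (auto intro!: homI)
    have 2: "(\<lambda>X\<in>carrier P. f (0, X)) \<in> carrier (hom_group P A)"
      unfolding hom_group_carrier
      using cl L_0 mult[of 0 _ 0] P.m_closed by (auto intro!: homI simp: P_mult)
    show "(\<lambda>a\<in>L. f (a, mat 1), \<lambda>X\<in>carrier P. f (0, X)) \<in> invariant_characters A \<times> carrier (hom_group P A)"
      using 1 2 by blast
  next
    fix i assume "i \<in> invariant_characters A \<times> carrier (hom_group P A)"
    then obtain \<alpha> \<beta> where i: "i = (\<alpha>, \<beta>)" and \<alpha>: "\<alpha> \<in> hom L_group A" "\<alpha> \<in> extensional L"
      and inv: "\<And>X a. \<lbrakk>X \<in> carrier P; a \<in> L\<rbrakk> \<Longrightarrow> \<alpha> (X *v a) = \<alpha> a"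
      and \<beta>: "\<beta> \<in> hom P A" "\<beta> \<in> extensional (carrier P)"
      by (auto simp: invariant_characters_def hom_group_carrier)
    have \<alpha>cl: "\<alpha> a \<in> carrier A" if "a \<in> L" for a using hom_in_carrier[OF \<alpha>(1)] that by simp
    have \<alpha>m: "\<alpha> (a + b) = \<alpha> a \<otimes>\<^bsub>A\<^esub> \<alpha> b" if "a \<in> L" "b \<in> L" for a b using hom_mult[OF \<alpha>(1)] that by simp
    have \<beta>cl: "\<beta> X \<in> carrier A" if "X \<in> carrier P" for X using hom_in_carrier[OF \<beta>(1)] that by simp
    have \<beta>m: "\<beta> (X ** Y) = \<beta> X \<otimes>\<^bsub>A\<^esub> \<beta> Y" if "X \<in> carrier P" "Y \<in> carrier P" for X Y
      using hom_mult[OF \<beta>(1)] that by (simp add: P_mult)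
    have \<alpha>0: "\<alpha> 0 = \<one>\<^bsub>A\<^esub>" using \<alpha>m[OF L_0 L_0] \<alpha>cl[OF L_0] by simp
    have \<beta>1: "\<beta> (mat 1) = \<one>\<^bsub>A\<^esub>" using \<beta>m[OF P1 P1] \<beta>cl[OF P1] by simp
    let ?f = "\<lambda>(a, X). \<alpha> a \<otimes>\<^bsub>A\<^esub> \<beta> X"
    have "?f \<in> hom \<Gamma> A"
    proof (rule homI)
      fix x y assume "x \<in> carrier \<Gamma>" "y \<in> carrier \<Gamma>"
      then obtain a X b Y where xy: "x = (a, X)" "y = (b, Y)" "a \<in> L" "X \<in> carrier P" "b \<in> L" "Y \<in> carrier P" by auto
      show "?f x \<in> carrier A" using xy \<alpha>cl \<beta>cl by simp
      \<comment> \<open>Invariance replaces \<open>\<alpha> (X *v b)\<close> by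
        \<open>\<alpha> b\<close>, which undoes the twist in the group law.\<close>
      show "?f (x \<otimes>\<^bsub>\<Gamma>\<^esub> y) = ?f x \<otimes>\<^bsub>A\<^esub> ?f y"
        using xy by (simp add: \<alpha>m P_L inv \<beta>m \<alpha>cl \<beta>cl A.m_ac)
    qed
    moreover have "(\<lambda>a\<in>L. ?f (a, mat 1)) = \<alpha>"
      using \<alpha>(2) \<alpha>cl by (intro extensionalityI[of _ L]) (auto simp: \<beta>1)
    moreover have "(\<lambda>X\<in>carrier P. ?f (0, X)) = \<beta>"
      using \<beta>(2) \<beta>cl by (intro extensionalityI[of _ "carrier P"]) (auto simp: \<alpha>0)
    ultimately show "\<exists>f\<in>hom \<Gamma> A. (\<lambda>a\<in>L. f (a, mat 1), \<lambda>X\<in>carrier P. f (0, X)) = i"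
      unfolding i by (intro bexI[of _ ?f]) auto
  qed (use group_semidirect P1 L_0 in \<open>auto simp: fun_eq_iff restrict_def\<close>)
  then show ?thesis by (simp add: card_cartesian_product)
qed

end

text \<open>The quadruple lists the coordinates of the images of \<open>u\<close> and
  \<open>v\<close>. It stays the same when basis and matrix are transported by one linear
  isomorphism, so it can be computed on the standard lattice.\<close>

definition basis_matrix :: "real^2 \<Rightarrow> real^2 \<Rightarrow> real^2^2 \<Rightarrow> int \<times> int \<times> int \<times> int \<Rightarrow> bool" where
  "basis_matrix u v X = (\<lambda>(p, q, r, t).
     X *v u = of_int p *\<^sub>R u + of_int q *\<^sub>R v \<and> X *v v = of_int r *\<^sub>R u + of_int t *\<^sub>R v)"

text \<open>Values on the lattice basis of the characters that are fixed by all the given integer matrices.\<close>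

definition invariant_values :: "(int \<times> int \<times> int \<times> int) list \<Rightarrow> (int \<times> int) set" where
  "invariant_values Qs = {(x, y). x \<in> {0, 1} \<and> y \<in> {0, 1} \<and>
     (\<forall>(p, q, r, t)\<in>set Qs. (p * x + q * y) mod 2 = x \<and> (r * x + t * y) mod 2 = y)}"

text \<open>Linear independence over the reals, written with coefficients because the set
  \<open>{u, v}\<close> would hide the case \<open>u = v\<close>.\<close>

definition lattice_basis :: "real^2 \<Rightarrow> real^2 \<Rightarrow> bool" where
  "lattice_basis u v \<longleftrightarrow> (\<forall>a b. a *\<^sub>R u + b *\<^sub>R v = 0 \<longrightarrow> a = 0 \<and> b = 0)"

lemma lattice_basis_unique:
  assumes "lattice_basis u v" "a *\<^sub>R u + b *\<^sub>R v = c *\<^sub>R u + d *\<^sub>R v"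
  shows "a = c \<and> b = d"
proof -
  have "(a - c) *\<^sub>R u + (b - d) *\<^sub>R v = 0" using assms(2) by (simp add: algebra_simps)
  then show ?thesis using assms(1) unfolding lattice_basis_def by fastforce
qed

lemma lattice_spanI: "of_int m *\<^sub>R u + of_int n *\<^sub>R v \<in> lattice_span u v"
  by (auto simp: lattice_span_def)

text \<open>An injective linear map stretches lengths by at least some \<open>B > 0\<close>, and a
  nonzero integer vector has norm at least 1.\<close>

lemma lattice_span_discrete:
  assumes "lattice_basis u v"
  shows "\<exists>\<epsilon>>0. \<forall>a\<in>lattice_span u v. a \<noteq> 0 \<longrightarrow> \<epsilon> \<le> norm a"
proof -
  define f where "f x = (x $ 1) *\<^sub>R u + (x $ 2) *\<^sub>R v" for x :: "real^2"
  have lin: "linear f" by (rule linearI) (simp_all add: f_def algebra_simps)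
  have "inj f"
  proof (rule injI)
    fix x y assume "f x = f y"
    then show "x = y" using lattice_basis_unique[OF assms] unfolding f_def vec_eq_iff forall_2 by blast
  qed
  then obtain B where B: "B > 0" "\<And>x. norm (f x) \<ge> B * norm x"
    using linear_inj_bounded_below_pos[OF lin] by metis
  have "B \<le> norm a" if a: "a \<in> lattice_span u v" "a \<noteq> 0" for a
  proof -
    obtain m n where mn: "a = of_int m *\<^sub>R u + of_int n *\<^sub>R v" using a by (auto simp: lattice_span_def)
    define x :: "real^2" where "x = vector [of_int m, of_int n]"
    have fx: "f x = a" by (simp add: f_def x_def mn)
    have "m \<noteq> 0 \<or> n \<noteq> 0" using a(2) mn by auto
    then have "1 \<le> \<bar>x $ 1\<bar> \<or> 1 \<le> \<bar>x $ 2\<bar>" by (auto simp: x_def simp flip: of_int_abs)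
    then have "1 \<le> norm x"
      using component_le_norm_cart[of x 1] component_le_norm_cart[of x 2] by linarith
    then have "B * 1 \<le> B * norm x" using B(1) by (intro mult_left_mono) auto
    then show ?thesis using B(2)[of x] fx by simp
  qed
  then show ?thesis using B(1) by blast
qed

text \<open>Any pair of values on the basis extends to a character of the lattice. Invariance need
  only be tested on generators of \<open>P\<close> and basis vectors, where it becomes two
  congruences modulo 2.\<close>

lemma (in lattice_action) card_invariant_characters:
  assumes L: "L = lattice_span u v" and basis: "lattice_basis u v"
    and gen: "generate P (set Xs) = carrier P"
    and mats: "list_all2 (basis_matrix u v) Xs Qs"
  shows "card (invariant_characters Z2) = card (invariant_values Qs)"
proof -
  have Xs: "X \<in> carrier P" if "X \<in> set Xs" for X using gen generate.incl[OF that, of P] by simp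
  have uv: "u \<in> L" "v \<in> L"
    using lattice_spanI[of 1 u 0 v] lattice_spanI[of 0 u 1 v] by (simp_all add: L)
  have val: "\<alpha> (of_int m *\<^sub>R u + of_int n *\<^sub>R v) = (m * \<alpha> u + n * \<alpha> v) mod 2"
    if \<alpha>: "\<alpha> \<in> hom L_group Z2" for \<alpha> m n
  proof -
    have pow: "a [^]\<^bsub>L_group\<^esub> (k::int) = of_int k *\<^sub>R a" if "a \<in> L" for a k
    proof -
      have nat: "a [^]\<^bsub>L_group\<^esub> (i::nat) = of_nat i *\<^sub>R a" for i
        by (induction i) (simp_all add: algebra_simps)
      have inv: "inv\<^bsub>L_group\<^esub> b = - b" if "b \<in> L" for b
        by (rule trans.inv_equality) (use that L_minus in auto)
      have inL: "of_nat i *\<^sub>R a \<in> L" for i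
        using trans.nat_pow_closed[of a i] that by (simp add: nat)
      show ?thesis
        by (cases k rule: int_cases2) (simp_all add: int_pow_int nat trans.int_pow_neg that inv inL)
    qed
    have inL: "of_int k *\<^sub>R a \<in> L" if "a \<in> L" for a k
      using trans.int_pow_closed[of a k] pow[OF that] that by simp
    have "\<alpha> (of_int m *\<^sub>R u + of_int n *\<^sub>R v) = (\<alpha> (of_int m *\<^sub>R u) + \<alpha> (of_int n *\<^sub>R v)) mod 2"
      using Z2_hom_mult[OF \<alpha>, of "of_int m *\<^sub>R u" "of_int n *\<^sub>R v"] inL uv by simp
    also have "\<dots> = (m * \<alpha> u + n * \<alpha> v) mod 2"
      using Z2_hom_pow[OF trans.is_group \<alpha>, of u m] Z2_hom_pow[OF trans.is_group \<alpha>, of v n] uv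
      by (simp add: pow mod_simps)
    finally show ?thesis .
  qed
  have "bij_betw (\<lambda>\<alpha>. (\<alpha> u, \<alpha> v)) (invariant_characters Z2) (invariant_values Qs)"
    unfolding bij_betw_def
  proof
    show "inj_on (\<lambda>\<alpha>. (\<alpha> u, \<alpha> v)) (invariant_characters Z2)"
    proof (rule inj_onI)
      fix \<alpha> \<beta> assume ab: "\<alpha> \<in> invariant_characters Z2" "\<beta> \<in> invariant_characters Z2" "(\<alpha> u, \<alpha> v) = (\<beta> u, \<beta> v)"
      then have h: "\<alpha> \<in> hom L_group Z2" "\<beta> \<in> hom L_group Z2" "\<alpha> \<in> extensional L" "\<beta> \<in> extensional L"
        by (auto simp: invariant_characters_def hom_group_carrier)
      show "\<alpha> = \<beta>"
      proof (rule extensionalityI[OF h(3,4)])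
        fix a assume "a \<in> L"
        then obtain m n where "a = of_int m *\<^sub>R u + of_int n *\<^sub>R v" by (auto simp: L lattice_span_def)
        then show "\<alpha> a = \<beta> a" using val[OF h(1)] val[OF h(2)] ab(3) by simp
      qed
    qed
    show "(\<lambda>\<alpha>. (\<alpha> u, \<alpha> v)) ` invariant_characters Z2 = invariant_values Qs"
    proof (intro equalityI subsetI)
      fix xy assume "xy \<in> (\<lambda>\<alpha>. (\<alpha> u, \<alpha> v)) ` invariant_characters Z2"
      then obtain \<alpha> where xy: "xy = (\<alpha> u, \<alpha> v)" and \<alpha>: "\<alpha> \<in> hom L_group Z2"
        and inv: "\<And>X a. \<lbrakk>X \<in> carrier P; a \<in> L\<rbrakk> \<Longrightarrow> \<alpha> (X *v a) = \<alpha> a"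
        by (auto simp: invariant_characters_def hom_group_carrier)
      have "(p * \<alpha> u + q * \<alpha> v) mod 2 = \<alpha> u \<and> (r * \<alpha> u + t * \<alpha> v) mod 2 = \<alpha> v"
        if Q: "(p, q, r, t) \<in> set Qs" for p q r t
      proof -
        obtain X where X: "X \<in> set Xs" "basis_matrix u v X (p, q, r, t)"
          using mats Q by (metis in_set_conv_nth list_all2_conv_all_nth)
        then have "\<alpha> (X *v u) = (p * \<alpha> u + q * \<alpha> v) mod 2" "\<alpha> (X *v v) = (r * \<alpha> u + t * \<alpha> v) mod 2"
          using val[OF \<alpha>] by (auto simp: basis_matrix_def)
        then show ?thesis using inv[OF Xs[OF X(1)]] uv by simp
      qed
      moreover have "\<alpha> u \<in> {0, 1}" "\<alpha> v \<in> {0, 1}"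
        using Z2_hom_value[OF \<alpha>, of u] Z2_hom_value[OF \<alpha>, of v] uv by auto
      ultimately show "xy \<in> invariant_values Qs" by (auto simp: invariant_values_def xy)
    next
      fix xy assume xy': "xy \<in> invariant_values Qs"
      then obtain x y where xy: "xy = (x, y)" "x \<in> {0, 1}" "y \<in> {0, 1}"
        and inv: "\<And>p q r t. (p, q, r, t) \<in> set Qs \<Longrightarrow> (p * x + q * y) mod 2 = x \<and> (r * x + t * y) mod 2 = y"
        by (fastforce simp: invariant_values_def)
      \<comment> \<open>Integer coordinates of a lattice vector, unique by
        \<open>lattice_basis\<close>, which makes \<alpha> well defined.\<close>
      define k where "k a = (SOME mn. a = of_int (fst mn) *\<^sub>R u + of_int (snd mn) *\<^sub>R v)" for a :: "real^2"
      define \<alpha> where "\<alpha> = (\<lambda>a\<in>L. (fst (k a) * x + snd (k a) * y) mod 2)"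
      have k: "k (of_int m *\<^sub>R u + of_int n *\<^sub>R v) = (m, n)" for m n
      proof -
        have "of_int m *\<^sub>R u + of_int n *\<^sub>R v = of_int (fst (m, n)) *\<^sub>R u + of_int (snd (m, n)) *\<^sub>R v" by simp
        then have "of_int m *\<^sub>R u + of_int n *\<^sub>R v =
            of_int (fst (k (of_int m *\<^sub>R u + of_int n *\<^sub>R v))) *\<^sub>R u + of_int (snd (k (of_int m *\<^sub>R u + of_int n *\<^sub>R v))) *\<^sub>R v"
          unfolding k_def by (rule someI)
        from lattice_basis_unique[OF basis this] show ?thesis by (simp add: prod_eq_iff)
      qed
      have \<alpha>v: "\<alpha> (of_int m *\<^sub>R u + of_int n *\<^sub>R v) = (m * x + n * y) mod 2" for m n
        using lattice_spanI[of m u n v] by (simp add: \<alpha>_def k L)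
      have \<alpha>u: "\<alpha> u = x" "\<alpha> v = y"
        using \<alpha>v[of 1 0] \<alpha>v[of 0 1] xy by auto
      have \<alpha>h: "\<alpha> \<in> hom L_group Z2"
      proof (rule homI)
        fix a b assume "a \<in> carrier L_group" "b \<in> carrier L_group"
        then obtain m n i j where ab: "a = of_int m *\<^sub>R u + of_int n *\<^sub>R v" "b = of_int i *\<^sub>R u + of_int j *\<^sub>R v"
          by (auto simp: L lattice_span_def)
        show "\<alpha> a \<in> carrier Z2" by (auto simp: ab \<alpha>v Z2_carrier)
        have "a + b = of_int (m + i) *\<^sub>R u + of_int (n + j) *\<^sub>R v" by (simp add: ab algebra_simps)
        then have "\<alpha> (a + b) = ((m + i) * x + (n + j) * y) mod 2" by (simp only: \<alpha>v)
        also have "(m + i) * x + (n + j) * y = (m * x + n * y) + (i * x + j * y)" by (simp add: algebra_simps)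
        also have "\<dots> mod 2 = (\<alpha> a + \<alpha> b) mod 2" unfolding ab \<alpha>v by (simp only: mod_add_eq)
        finally show "\<alpha> (a \<otimes>\<^bsub>L_group\<^esub> b) = \<alpha> a \<otimes>\<^bsub>Z2\<^esub> \<alpha> b" by simp
      qed
      have base: "\<alpha> (X *v a) = \<alpha> a" if X: "X \<in> set Xs" and a: "a \<in> L" for X a
      proof -
        obtain p q r t where Q: "(p, q, r, t) \<in> set Qs" "basis_matrix u v X (p, q, r, t)"
          using mats X by (metis in_set_conv_nth list_all2_conv_all_nth prod_cases4)
        obtain m n where mn: "a = of_int m *\<^sub>R u + of_int n *\<^sub>R v" using a by (auto simp: L lattice_span_def)
        have "X *v a = of_int m *\<^sub>R (X *v u) + of_int n *\<^sub>R (X *v v)"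
          unfolding mn by (simp add: matrix_vector_right_distrib scaleR_matrix_vector_assoc matrix_vector_mult_scaleR)
        also have "\<dots> = of_int (m * p + n * r) *\<^sub>R u + of_int (m * q + n * t) *\<^sub>R v"
          using Q(2) by (simp add: basis_matrix_def algebra_simps)
        finally have "\<alpha> (X *v a) = ((m * p + n * r) * x + (m * q + n * t) * y) mod 2" by (simp only: \<alpha>v)
        also have "(m * p + n * r) * x + (m * q + n * t) * y = m * (p * x + q * y) + n * (r * x + t * y)"
          by (simp add: algebra_simps)
        also have "\<dots> mod 2 = (m * ((p * x + q * y) mod 2) + n * ((r * x + t * y) mod 2)) mod 2"
          by (intro mod_add_cong) (simp_all add: mod_mult_right_eq)
        also have "\<dots> = \<alpha> a" using inv[OF Q(1)] by (simp add: mn \<alpha>v)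
        finally show ?thesis .
      qed
      have "\<forall>a\<in>L. \<alpha> (X *v a) = \<alpha> a" if "X \<in> generate P (set Xs)" for X
        using that
      proof (induction rule: generate.induct)
        case (inv X)
        have XX: "X \<in> carrier P" "inv\<^bsub>P\<^esub> X \<in> carrier P" using Xs[OF inv] by auto
        show ?case
        proof
          fix a assume a: "a \<in> L"
          \<comment> \<open>For the inverse of a generator, invariance under the generator is read
            at the preimage of \<open>a\<close>.\<close>
          have "\<alpha> (X *v (inv\<^bsub>P\<^esub> X *v a)) = \<alpha> (inv\<^bsub>P\<^esub> X *v a)"
            by (rule base[OF inv]) (use P_L XX a in blast)
          moreover have "X *v (inv\<^bsub>P\<^esub> X *v a) = a"
            using P.r_inv[OF XX(1)] by (simp add: matrix_vector_mul_assoc P_mult P_one)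
          ultimately show "\<alpha> (inv\<^bsub>P\<^esub> X *v a) = \<alpha> a" by simp
        qed
      next
        case (eng X Y)
        then have "X \<in> carrier P" "Y \<in> carrier P" using gen by simp_all
        then show ?case using eng.IH P_L by (simp add: P_mult flip: matrix_vector_mul_assoc)
      qed (use base in \<open>auto simp: P_one\<close>)
      then have "\<alpha> \<in> invariant_characters Z2"
        using \<alpha>h gen by (simp add: invariant_characters_def hom_group_carrier \<alpha>_def)
      then show "xy \<in> (\<lambda>\<alpha>. (\<alpha> u, \<alpha> v)) ` invariant_characters Z2"
        using \<alpha>u xy by (intro image_eqI[of _ _ \<alpha>]) auto
    qed
  qed
  then show ?thesis by (rule bij_betw_same_card)
qed


section \<open>Plane point groups\<close>

lemma group_orthogonal_group: "group orthogonal_group"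
proof (rule groupI)
  fix A :: "real^2^2" assume "A \<in> carrier orthogonal_group"
  then have "orthogonal_matrix A" by (simp add: orthogonal_group_def)
  then show "\<exists>B\<in>carrier orthogonal_group. B \<otimes>\<^bsub>orthogonal_group\<^esub> A = \<one>\<^bsub>orthogonal_group\<^esub>"
    by (intro bexI[of _ "transpose A"]) (auto simp: orthogonal_group_def orthogonal_matrix_def)
qed (auto simp: orthogonal_group_def orthogonal_matrix_mul orthogonal_matrix_id matrix_mul_assoc)

interpretation orth: group orthogonal_group by (rule group_orthogonal_group)

abbreviation gen_O :: "(real^2^2) set \<Rightarrow> (real^2^2) set" where
  "gen_O \<equiv> generate orthogonal_group"

lemma orthogonal_group_simps:
  "carrier orthogonal_group = {A. orthogonal_matrix A}"
  "A \<otimes>\<^bsub>orthogonal_group\<^esub> B = A ** B"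
  "\<one>\<^bsub>orthogonal_group\<^esub> = mat 1"
  by (simp_all add: orthogonal_group_def)

lemma group_euclidean_group: "group euclidean_group"
proof (rule groupI)
  fix g assume "g \<in> carrier euclidean_group"
  then obtain c A where g: "g = (c, A)" "orthogonal_matrix A" by (auto simp: euclidean_group_def)
  then show "\<exists>h\<in>carrier euclidean_group. h \<otimes>\<^bsub>euclidean_group\<^esub> g = \<one>\<^bsub>euclidean_group\<^esub>"
    by (intro bexI[of _ "(- (transpose A *v c), transpose A)"])
      (auto simp: euclidean_group_def orthogonal_matrix_def)
qed (auto simp: euclidean_group_def orthogonal_matrix_mul orthogonal_matrix_id matrix_mul_assoc
    matrix_vector_right_distrib matrix_vector_mul_assoc add.assoc)

text \<open>Conjugating the translation by \<open>a\<close> with an element whose linear part is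
  \<open>A\<close> gives the translation by \<open>A *v a\<close>.\<close>

lemma point_group_preserves_lattice:
  assumes S: "subgroup S euclidean_group" and A: "A \<in> carrier (point_group S)" and a: "a \<in> translation_lattice S"
  shows "A *v a \<in> translation_lattice S"
proof -
  interpret E: group euclidean_group by (rule group_euclidean_group)
  obtain c where c: "(c, A) \<in> S" using A by (auto simp: point_group_def)
  obtain d B where dB: "inv\<^bsub>euclidean_group\<^esub> (c, A) = (d, B)" by (cases "inv\<^bsub>euclidean_group\<^esub> (c, A)")
  have B: "(d, B) \<in> S" using subgroup.m_inv_closed[OF S c] dB by simp
  have "(c, A) \<otimes>\<^bsub>euclidean_group\<^esub> (d, B) = \<one>\<^bsub>euclidean_group\<^esub>"
    using E.r_inv[OF subgroup.mem_carrier[OF S c]] dB by simp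
  then have 1: "c + A *v d = 0" "A ** B = mat 1" by (auto simp: euclidean_group_def)
  have "((c, A) \<otimes>\<^bsub>euclidean_group\<^esub> (a, mat 1)) \<otimes>\<^bsub>euclidean_group\<^esub> (d, B) \<in> S"
    using subgroup.m_closed[OF S] c B a by (simp add: translation_lattice_def)
  moreover have "((c, A) \<otimes>\<^bsub>euclidean_group\<^esub> (a, mat 1)) \<otimes>\<^bsub>euclidean_group\<^esub> (d, B) = (c + A *v d + A *v a, A ** B)"
    by (simp add: euclidean_group_def add_ac)
  ultimately show ?thesis by (simp add: translation_lattice_def 1)
qed

section \<open>Rotations and reflections of the plane\<close>

lemma mat2_eq_iff:
  "(A :: real^2^2) = B \<longleftrightarrow> A $ 1 $ 1 = B $ 1 $ 1 \<and> A $ 1 $ 2 = B $ 1 $ 2 \<and> A $ 2 $ 1 = B $ 2 $ 1 \<and> A $ 2 $ 2 = B $ 2 $ 2"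
  by (auto simp: vec_eq_iff forall_2)

lemma vec2_eq_iff: "(x :: real^2) = y \<longleftrightarrow> x $ 1 = y $ 1 \<and> x $ 2 = y $ 2"
  by (simp add: vec_eq_iff forall_2)

lemmas mat2_simps = mat2_eq_iff vec2_eq_iff matrix_matrix_mult_def matrix_vector_mult_def sum_2 mat_def
  orthogonal_matrix transpose_def rotation_def sigma_x_def sigma_y_def

abbreviation rot :: "nat \<Rightarrow> real^2^2" where
  "rot n \<equiv> rotation (2 * pi / real n)"

lemma rotation_add: "rotation a ** rotation b = rotation (a + b)"
  by (simp add: mat2_simps cos_add sin_add)

lemma rotation_0: "rotation 0 = mat 1"
  by (simp add: mat2_simps)

lemma orthogonal_rotation: "orthogonal_matrix (rotation a)"
  by (simp add: mat2_simps flip: power2_eq_square)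

lemma det_rotation: "det (rotation a) = 1"
  by (simp add: det_2 rotation_def flip: power2_eq_square)

lemma rotation_int_pow: "rotation a [^]\<^bsub>orthogonal_group\<^esub> (i::int) = rotation (of_int i * a)"
proof -
  have r: "rotation b \<in> carrier orthogonal_group" for b by (simp add: orthogonal_group_simps orthogonal_rotation)
  have nat: "rotation a [^]\<^bsub>orthogonal_group\<^esub> (k::nat) = rotation (of_nat k * a)" for k
    by (induction k) (simp_all add: orthogonal_group_simps rotation_0 rotation_add algebra_simps)
  have inv: "inv\<^bsub>orthogonal_group\<^esub> rotation b = rotation (- b)" for b
    by (rule orth.inv_equality) (use r in \<open>auto simp: orthogonal_group_simps rotation_add rotation_0\<close>)
  show ?thesis
    by (cases i rule: int_cases2) (simp_all add: int_pow_int nat orth.int_pow_neg r inv)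
qed

text \<open>The cosine entry alone decides: cosine 1 already forces a multiple of the full
  turn.\<close>

lemma rotation_root_pow_eq_1:
  assumes "n > 0"
  shows "rot n [^]\<^bsub>orthogonal_group\<^esub> (i::int) = mat 1 \<longleftrightarrow> int n dvd i"
proof
  assume "rot n [^]\<^bsub>orthogonal_group\<^esub> i = mat 1"
  then have "cos (of_int i * (2 * pi / real n)) = 1"
    unfolding rotation_int_pow by (simp add: mat2_simps)
  then obtain k :: int where "of_int i * (2 * pi / real n) = of_int k * 2 * pi"
    using cos_one_2pi_int by auto
  then have "real_of_int i = of_int k * real n"
    using assms by (simp add: field_simps)
  then have "i = k * int n" by (metis of_int_eq_iff of_int_mult of_int_of_nat_eq)
  then show "int n dvd i" by simp
next
  assume "int n dvd i"
  then obtain k where "i = int n * k" by auto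
  then have "of_int i * (2 * pi / real n) = 2 * pi * of_int k" using assms by simp
  then show "rot n [^]\<^bsub>orthogonal_group\<^esub> i = mat 1"
    unfolding rotation_int_pow by (simp add: mat2_simps sin_int_2pin cos_int_2pin)
qed

lemma is_cyclic_rotations:
  assumes "n > 0"
  shows "is_cyclic_of_order n (orthogonal_group\<lparr>carrier := gen_O {rot n}\<rparr>)"
proof (rule orth.is_cyclic_of_order_generate)
  show r: "rot n \<in> carrier orthogonal_group"
    by (simp add: orthogonal_group_simps orthogonal_rotation)
  show "orth.ord (rot n) = n"
    unfolding orth.ord_unique[OF r]
    using rotation_root_pow_eq_1[OF assms] by (metis int_dvd_int_iff int_pow_int orthogonal_group_simps(3))
qed

lemma is_dihedral_reflection:
  assumes "n > 0" and s: "s \<in> {sigma_x, sigma_y}"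
  shows "is_dihedral n (orthogonal_group\<lparr>carrier := gen_O {rot n, s}\<rparr>)"
proof (rule orth.is_dihedral_generate[OF _ _ assms(1)])
  let ?r = "rot n"
  show "?r \<in> carrier orthogonal_group" by (simp add: orthogonal_group_simps orthogonal_rotation)
  show "s \<in> carrier orthogonal_group" using s by (auto simp: orthogonal_group_simps mat2_simps)
  show "?r [^]\<^bsub>orthogonal_group\<^esub> n = \<one>\<^bsub>orthogonal_group\<^esub>"
    using rotation_root_pow_eq_1[OF assms(1), of "int n"] by (simp add: int_pow_int orthogonal_group_simps)
  show "s \<otimes>\<^bsub>orthogonal_group\<^esub> s = \<one>\<^bsub>orthogonal_group\<^esub>"
    using s by (auto simp: orthogonal_group_simps mat2_simps)
  have "s ** rotation a ** s ** rotation a = mat 1" for a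
    using s by (auto simp: mat2_simps simp flip: power2_eq_square)
  then show "s \<otimes>\<^bsub>orthogonal_group\<^esub> ?r \<otimes>\<^bsub>orthogonal_group\<^esub> s \<otimes>\<^bsub>orthogonal_group\<^esub> ?r = \<one>\<^bsub>orthogonal_group\<^esub>"
    by (simp add: orthogonal_group_simps)
  show "?r [^]\<^bsub>orthogonal_group\<^esub> i \<noteq> \<one>\<^bsub>orthogonal_group\<^esub>" if "0 < i" "i < int n" for i :: int
    using rotation_root_pow_eq_1[OF assms(1), of i] that by (auto simp: orthogonal_group_simps zdvd_not_zless)
  \<comment> \<open>The determinant keeps the reflection apart from every power of the rotation,
    also for \<open>n = 1\<close> and \<open>n = 2\<close>.\<close>
  have "det s = - 1" using s by (auto simp: det_2 sigma_x_def sigma_y_def)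
  then show "?r [^]\<^bsub>orthogonal_group\<^esub> i \<noteq> s" for i :: int
    unfolding rotation_int_pow using det_rotation[of "of_int i * (2 * pi / real n)"] by auto
qed

lemma (in group) generate_eqI:
  assumes "X \<subseteq> carrier G" "Y \<subseteq> carrier G" "X \<subseteq> generate G Y" "Y \<subseteq> generate G X"
  shows "generate G X = generate G Y"
  using assms generate_subgroup_incl generate_is_subgroup by (metis equalityI)

lemma rotation_special:
  "rotation (2 * pi) = mat 1"
  "rotation pi = sigma_x ** sigma_y"
  "sigma_y = rotation pi ** sigma_x"
  by (simp_all add: mat2_simps)

section \<open>Transport along a linear isomorphism\<close>

lemma lattice_span_image: "(*v) M ` lattice_span u v = lattice_span (M *v u) (M *v v)"
proof -
  have "lattice_span a b = range (\<lambda>(m, n). of_int m *\<^sub>R a + of_int n *\<^sub>R b)" for a b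
    by (auto simp: lattice_span_def)
  then show ?thesis
    by (simp add: image_image case_prod_unfold matrix_vector_right_distrib matrix_vector_mult_scaleR)
qed

lemma matrix_inv_left: "invertible (M :: real^2^2) \<Longrightarrow> matrix_inv M ** M = mat 1"
  and matrix_inv_right: "invertible (M :: real^2^2) \<Longrightarrow> M ** matrix_inv M = mat 1"
proof -
  have "M ** matrix_inv M = mat 1 \<and> matrix_inv M ** M = mat 1" if "invertible M"
    using that unfolding invertible_def matrix_inv_def by (rule someI_ex)
  then show "invertible M \<Longrightarrow> matrix_inv M ** M = mat 1" "invertible M \<Longrightarrow> M ** matrix_inv M = mat 1"
    by auto
qed

lemma lattice_basis_image:
  assumes "invertible M" "lattice_basis u v"
  shows "lattice_basis (M *v u) (M *v v)"
  unfolding lattice_basis_def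
proof (intro allI impI)
  fix a b assume "a *\<^sub>R (M *v u) + b *\<^sub>R (M *v v) = 0"
  then have "M *v (a *\<^sub>R u + b *\<^sub>R v) = 0"
    by (simp add: matrix_vector_right_distrib matrix_vector_mult_scaleR)
  then have "matrix_inv M *v (M *v (a *\<^sub>R u + b *\<^sub>R v)) = 0" by simp
  then have "a *\<^sub>R u + b *\<^sub>R v = 0"
    using matrix_inv_left[OF assms(1)] by (simp add: matrix_vector_mul_assoc)
  then show "a = 0 \<and> b = 0" using assms(2) by (simp add: lattice_basis_def)
qed

lemma basis_matrix_conj:
  assumes "invertible M" "basis_matrix u v X Q"
  shows "basis_matrix (M *v u) (M *v v) (M ** X ** matrix_inv M) Q"
proof -
  have "(M ** X ** matrix_inv M) *v (M *v w) = M *v (X *v w)" for w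
  proof -
    have "(M ** X ** matrix_inv M) *v (M *v w) = (M ** X ** (matrix_inv M ** M)) *v w"
      by (simp add: matrix_vector_mul_assoc matrix_mul_assoc)
    then show ?thesis using matrix_inv_left[OF assms(1)] by (simp add: matrix_vector_mul_assoc)
  qed
  then show ?thesis
    using assms(2) by (cases Q) (simp add: basis_matrix_def matrix_vector_right_distrib matrix_vector_mult_scaleR)
qed

lemma det_conj:
  fixes M X :: "real^2^2"
  assumes "invertible M"
  shows "det (M ** X ** matrix_inv M) = det X"
proof -
  have "det M * det (matrix_inv M) = 1"
    using matrix_inv_right[OF assms] by (metis det_I det_mul)
  then show ?thesis by (simp add: det_mul)
qed

text \<open>\<open>M\<close> is only invertible, so this is in general no conjugation inside
  \<open>orthogonal_group\<close>; what the two groups share is matrix multiplication.\<close>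

lemma conj_iso:
  fixes M :: "real^2^2"
  assumes M: "invertible M" and H: "carrier H = (\<lambda>X. M ** X ** matrix_inv M) ` carrier G"
    and mult: "monoid.mult G = (**)" "monoid.mult H = (**)"
  shows "(\<lambda>X. M ** X ** matrix_inv M) \<in> iso G H"
proof -
  let ?c = "\<lambda>X. M ** X ** matrix_inv M"
  have "?c (X ** Y) = ?c X ** ?c Y" for X Y
  proof -
    have "?c X ** ?c Y = M ** X ** (matrix_inv M ** M) ** Y ** matrix_inv M" by (simp add: matrix_mul_assoc)
    then show ?thesis using matrix_inv_left[OF M] by (simp add: matrix_mul_assoc)
  qed
  moreover have "inj ?c"
  proof (rule inj_on_inverseI[where g = "\<lambda>X. matrix_inv M ** X ** M"])
    fix X
    have "matrix_inv M ** (M ** X ** matrix_inv M) ** M = (matrix_inv M ** M) ** X ** (matrix_inv M ** M)"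
      by (simp add: matrix_mul_assoc)
    then show "matrix_inv M ** (M ** X ** matrix_inv M) ** M = X" using matrix_inv_left[OF M] by simp
  qed
  ultimately show ?thesis
    using H mult by (auto simp: iso_def hom_def bij_betw_def intro: inj_on_subset)
qed

lemma lattice_action_space_group:
  assumes S: "space_group S" and E: "universal_space (point_group S) E \<psi>"
    and L: "translation_lattice S = lattice_span u v" and basis: "lattice_basis u v"
  shows "lattice_action (translation_lattice S) (point_group S) E \<psi>"
proof
  show "0 \<in> translation_lattice S" using lattice_spanI[of 0 u 0 v] by (simp add: L)
  fix a assume "a \<in> translation_lattice S"
  then obtain m n where a: "a = of_int m *\<^sub>R u + of_int n *\<^sub>R v" by (auto simp: L lattice_span_def)
  show "- a \<in> translation_lattice S" using lattice_spanI[of "- m" u "- n" v] by (simp add: L a)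
  fix b assume "b \<in> translation_lattice S"
  then obtain i j where b: "b = of_int i *\<^sub>R u + of_int j *\<^sub>R v" by (auto simp: L lattice_span_def)
  show "a + b \<in> translation_lattice S"
    using lattice_spanI[of "m + i" u "n + j" v] by (simp add: L a b algebra_simps)
next
  show "A *v a \<in> translation_lattice S" if "A \<in> carrier (point_group S)" "a \<in> translation_lattice S" for A a
    using point_group_preserves_lattice that S by (auto simp: space_group_def)
  show "\<exists>\<epsilon>>0. \<forall>a\<in>translation_lattice S. a \<noteq> 0 \<longrightarrow> \<epsilon> \<le> norm a"
    unfolding L by (rule lattice_span_discrete[OF basis])
qed (use E in \<open>auto simp: point_group_def orthogonal_group_def\<close>)

section \<open>The rows of the table\<close>

definition table_row ::
  "((real^2) \<times> (real^2^2)) set \<Rightarrow> 'e topology \<Rightarrow> (real^2^2 \<Rightarrow> 'e \<Rightarrow> 'e) \<Rightarrow> plane_type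
    \<Rightarrow> ((real^2^2) monoid \<Rightarrow> bool) \<Rightarrow> bool \<Rightarrow> nat \<Rightarrow> nat \<Rightarrow> nat \<Rightarrow> bool" where
  "table_row S E \<psi> t P_is ori h f q \<longleftrightarrow>
    (let P = point_group S;
         T = torus (translation_lattice S);
         H1 = equivariant_cohomology 1 P E \<psi> T torus_action Z2;
         F1 = equivariant_F1H1 P E \<psi> T torus_action Z2
     in has_plane_type S t \<longrightarrow>
          P_is P \<and> (preserves_orientation P \<longleftrightarrow> ori) \<and>
          H1 \<cong> Z2_sum h \<and> H1\<lparr>carrier := F1\<rparr> \<cong> Z2_sum f \<and> H1 Mod F1 \<cong> Z2_sum q)"

text \<open>\<open>P_is\<close> stays abstract so that cyclic and dihedral rows are treated alike:
  it must survive isomorphism, to pass from the standard group to its conjugate, and determine the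
  number of characters of the point group. The invariant lattice characters contribute the remaining
  exponent \<open>q\<close>.\<close>

lemma table_rowI:
  assumes S: "space_group S" and E: "universal_space (point_group S) E \<psi>"
    and lattice: "standard_lattice t = lattice_span u v" and basis: "lattice_basis u v"
    and gens: "gen_O (standard_generators t) = gen_O (set Xs)"
    and Xs: "set Xs \<subseteq> carrier orthogonal_group"
    and mats: "list_all2 (basis_matrix u v) Xs Qs" and q: "card (invariant_values Qs) = 2 ^ q"
    and P_is: "P_is (orthogonal_group\<lparr>carrier := gen_O (set Xs)\<rparr>)"
    and iso: "\<And>(G :: (real^2^2) monoid) (H :: (real^2^2) monoid) h. \<lbrakk>P_is G; h \<in> iso G H; group H\<rbrakk> \<Longrightarrow> P_is H"
    and f: "\<And>G :: (real^2^2) monoid. P_is G \<Longrightarrow> card (carrier (hom_group G Z2)) = 2 ^ f"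
    and ori: "(\<forall>X\<in>gen_O (set Xs). det X > 0) \<longleftrightarrow> ori"
  shows "table_row S E \<psi> t P_is ori (f + q) f q"
  unfolding table_row_def Let_def
proof (intro impI)
  let ?G = "orthogonal_group\<lparr>carrier := gen_O (set Xs)\<rparr>" and ?P = "point_group S"
  let ?H = "equivariant_cohomology 1 ?P E \<psi> (torus (translation_lattice S)) torus_action Z2"
  let ?F = "equivariant_F1H1 ?P E \<psi> (torus (translation_lattice S)) torus_action Z2"
  assume "has_plane_type S t"
  then obtain M :: "real^2^2" where M: "invertible M"
    and L: "translation_lattice S = lattice_span (M *v u) (M *v v)"
    and P: "carrier ?P = (\<lambda>X. M ** X ** matrix_inv M) ` carrier ?G"
    unfolding has_plane_type_def lattice lattice_span_image gens by auto
  let ?c = "\<lambda>X. M ** X ** matrix_inv M"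
  have basis': "lattice_basis (M *v u) (M *v v)" by (rule lattice_basis_image[OF M basis])
  interpret lattice_action "translation_lattice S" ?P E \<psi>
    by (rule lattice_action_space_group[OF S E L basis'])
  have c: "?c \<in> iso ?G ?P"
    by (rule conj_iso[OF M P]) (simp_all add: point_group_def orthogonal_group_def)
  have sub: "subgroup (gen_O (set Xs)) orthogonal_group"
    by (rule orth.generate_is_subgroup[OF Xs])
  interpret G: group ?G by (rule orth.subgroup_imp_group[OF sub])
  interpret c: group_hom ?G ?P ?c using c by unfold_locales (simp add: iso_def)
  have P_is': "P_is ?P" by (rule iso[OF P_is c P.is_group])
  \<comment> \<open>Conjugates of the standard generators generate the point group, and in the moved
    basis they have the same integer matrices.\<close>
  have "generate ?P (set (map ?c Xs)) = ?c ` generate ?G (set Xs)"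
    using c.generate_img[of "set Xs"] by (auto intro: generate.incl)
  then have gen: "generate ?P (set (map ?c Xs)) = carrier ?P"
    using orth.generate_consistent[OF _ sub, of "set Xs"] P by (auto intro: generate.incl)
  have "list_all2 (basis_matrix (M *v u) (M *v v)) (map ?c Xs) Qs"
    using mats basis_matrix_conj[OF M] by (auto simp: list_all2_conv_all_nth)
  from card_invariant_characters[OF L basis' gen this]
  have "card (carrier (hom_group \<Gamma> Z2)) = 2 ^ (f + q)"
    using card_hom_semidirect[of Z2] f[OF P_is'] q by (simp add: power_add)
  moreover have "preserves_orientation ?P \<longleftrightarrow> ori"
    using ori unfolding preserves_orientation_def P by (simp add: det_conj[OF M])
  ultimately show "P_is ?P \<and> (preserves_orientation ?P \<longleftrightarrow> ori) \<and>
      ?H \<cong> Z2_sum (f + q) \<and> ?H\<lparr>carrier := ?F\<rparr> \<cong> Z2_sum f \<and> ?H Mod ?F \<cong> Z2_sum q"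
    using P_is' equivariant_filtration[of Z2 f q] f[OF P_is'] by (auto simp: Z2_carrier)
qed

lemma det_generate_rotation:
  assumes "X \<in> gen_O {rotation a}"
  shows "det X = 1"
proof -
  have "rotation a \<in> carrier orthogonal_group" by (simp add: orthogonal_group_simps orthogonal_rotation)
  then obtain i :: int where "X = rotation a [^]\<^bsub>orthogonal_group\<^esub> i"
    using assms orth.generate_pow by auto
  then show ?thesis by (simp add: rotation_int_pow det_rotation)
qed

text \<open>The trivial point group is the case \<open>n = 1\<close>, generated by the full turn
  \<open>rot 1\<close>.\<close>

lemma cyclic_row:
  assumes "space_group S" "universal_space (point_group S) E \<psi>"
    and "standard_lattice t = lattice_span u v" "lattice_basis u v" and n: "n > 0"
    and "gen_O (standard_generators t) = gen_O {rot n}"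
    and "basis_matrix u v (rot n) Q" and "card (invariant_values [Q]) = 2 ^ q"
    and "f = (if even n then 1 else 0)" and h: "h = f + q"
  shows "table_row S E \<psi> t (is_cyclic_of_order n) True h f q"
  unfolding h using assms(1-9) is_cyclic_rotations[OF n]
  by (intro table_rowI[where Xs = "[rot n]" and Qs = "[Q]" and u = u and v = v])
    (auto simp: orthogonal_group_simps orthogonal_rotation card_characters_cyclic det_generate_rotation
      intro: is_cyclic_of_order_iso)

text \<open>One reflection in the group already breaks orientation. The groups of orders 2 and 4 are
  included as \<open>n = 1\<close> and \<open>n = 2\<close>.\<close>

lemma dihedral_row:
  assumes "space_group S" "universal_space (point_group S) E \<psi>"
    and "standard_lattice t = lattice_span u v" "lattice_basis u v" and n: "n > 0" and s: "s \<in> {sigma_x, sigma_y}"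
    and "gen_O (standard_generators t) = gen_O {rot n, s}"
    and "basis_matrix u v (rot n) Q" "basis_matrix u v s R"
    and "card (invariant_values [Q, R]) = 2 ^ q"
    and "f = (if even n then 2 else 1)" and h: "h = f + q"
  shows "table_row S E \<psi> t (is_dihedral n) False h f q"
proof -
  have s': "orthogonal_matrix s" "det s = - 1" using s by (auto simp: mat2_simps det_2)
  have "s \<in> gen_O {rot n, s}" by (auto intro: generate.incl)
  then have "\<not> (\<forall>X\<in>gen_O {rot n, s}. det X > 0)"
    using s'(2) by fastforce
  then show ?thesis
    unfolding h using assms(1-11) is_dihedral_reflection[OF n s] s'(1)
    by (intro table_rowI[where Xs = "[rot n, s]" and Qs = "[Q, R]" and u = u and v = v])
      (auto simp: orthogonal_group_simps orthogonal_rotation card_characters_dihedral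
        intro: is_dihedral_iso)
qed

lemma lattice_basis_standard:
  "lattice_basis (vector [1, 0]) (vector [0, 1])"
  "lattice_basis (vector [1, 1]) (vector [-1, 1])"
  "lattice_basis (vector [1, 0]) (vector [1/2, sqrt 3 / 2])"
  by (auto simp: lattice_basis_def vec2_eq_iff)

lemma rotation_values:
  "rot 1 = vector [vector [1, 0], vector [0, 1]]"
  "rot 2 = vector [vector [-1, 0], vector [0, -1]]"
  "rot 3 = vector [vector [-1/2, - (sqrt 3 / 2)], vector [sqrt 3 / 2, -1/2]]"
  "rot 4 = vector [vector [0, -1], vector [1, 0]]"
  "rot 6 = vector [vector [1/2, - (sqrt 3 / 2)], vector [sqrt 3 / 2, 1/2]]"
proof -
  have "2 * pi / real 4 = pi / 2" "2 * pi / real 6 = pi / 3" by simp_all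
  then show "rot 4 = vector [vector [0, -1], vector [1, 0]]"
    "rot 6 = vector [vector [1/2, - (sqrt 3 / 2)], vector [sqrt 3 / 2, 1/2]]"
    by (simp_all only: rotation_def cos_60 sin_60 cos_pi_half sin_pi_half)
qed (simp_all add: rotation_def cos_120 sin_120 cos_120' sin_120')

lemma rotation_1: "rot 1 = \<one>\<^bsub>orthogonal_group\<^esub>"
  by (simp add: rotation_special orthogonal_group_simps)

lemma orthogonal_reflection: "s \<in> {sigma_x, sigma_y} \<Longrightarrow> s \<in> carrier orthogonal_group"
  by (auto simp: orthogonal_group_simps mat2_simps)

text \<open>Adjoining the trivial rotation brings a group generated by one reflection into dihedral
  form with \<open>n = 1\<close>.\<close>

lemma generate_reflection:
  assumes "s \<in> {sigma_x, sigma_y}"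
  shows "gen_O {s} = gen_O {rot 1, s}"
  unfolding rotation_1
  by (rule orth.generate_eqI)
    (use orthogonal_reflection[OF assms] in \<open>auto intro: generate.incl generate.one orth.one_closed\<close>)

text \<open>The product of the two reflections is the half turn, and the half turn exchanges one
  reflection for the other.\<close>

lemma generate_two_reflections:
  "gen_O {sigma_x, sigma_y} = gen_O {rot 2, sigma_x}"
proof (rule orth.generate_eqI)
  have r: "rot 2 = rotation pi" by simp
  show "{sigma_x, sigma_y} \<subseteq> carrier orthogonal_group" "{rot 2, sigma_x} \<subseteq> carrier orthogonal_group"
    by (auto simp: orthogonal_group_simps orthogonal_rotation sigma_x_def sigma_y_def mat2_simps)
  have "sigma_y \<in> gen_O {rotation pi, sigma_x}"
    using generate.eng[of "rotation pi" orthogonal_group "{rotation pi, sigma_x}" sigma_x]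
    by (simp add: generate.incl orthogonal_group_simps flip: rotation_special(3))
  then show "{sigma_x, sigma_y} \<subseteq> gen_O {rot 2, sigma_x}"
    by (auto simp: r intro: generate.incl)
  have "rotation pi \<in> gen_O {sigma_x, sigma_y}"
    using generate.eng[of sigma_x orthogonal_group "{sigma_x, sigma_y}" sigma_y]
    by (simp add: generate.incl orthogonal_group_simps flip: rotation_special(2))
  then show "{rot 2, sigma_x} \<subseteq> gen_O {sigma_x, sigma_y}"
    by (auto simp: r intro: generate.incl)
qed

text \<open>Only the parities of the lattice matrices matter: an invariant character is unconstrained, takes
  equal values on the two basis vectors, or vanishes.\<close>

lemma invariant_values_eq:
  "invariant_values [(1,0,0,1)] = {0,1} \<times> {0,1}"
  "invariant_values [(-1,0,0,-1)] = {0,1} \<times> {0,1}"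
  "invariant_values [(-1,1,-1,0)] = {(0,0)}"
  "invariant_values [(0,1,-1,0)] = {(0,0), (1,1)}"
  "invariant_values [(0,1,-1,1)] = {(0,0)}"
  "invariant_values [(1,0,0,1), (-1,0,0,1)] = {0,1} \<times> {0,1}"
  "invariant_values [(1,0,0,1), (0,1,1,0)] = {(0,0), (1,1)}"
  "invariant_values [(-1,0,0,-1), (-1,0,0,1)] = {0,1} \<times> {0,1}"
  "invariant_values [(-1,0,0,-1), (0,1,1,0)] = {(0,0), (1,1)}"
  "invariant_values [(-1,1,-1,0), (-1,0,-1,1)] = {(0,0)}"
  "invariant_values [(-1,1,-1,0), (1,0,1,-1)] = {(0,0)}"
  "invariant_values [(0,1,-1,0), (-1,0,0,1)] = {(0,0), (1,1)}"
  "invariant_values [(0,1,-1,1), (1,0,1,-1)] = {(0,0)}"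
  by (auto simp: invariant_values_def)

lemma standard_generators_eq:
  "gen_O (standard_generators P1) = gen_O {rot 1}"
  "gen_O (standard_generators P2) = gen_O {rot 2}"
  "gen_O (standard_generators P3) = gen_O {rot 3}"
  "gen_O (standard_generators P4) = gen_O {rot 4}"
  "gen_O (standard_generators P6) = gen_O {rot 6}"
  "gen_O (standard_generators PM) = gen_O {rot 1, sigma_x}"
  "gen_O (standard_generators CM) = gen_O {rot 1, sigma_x}"
  "gen_O (standard_generators PMM) = gen_O {rot 2, sigma_x}"
  "gen_O (standard_generators CMM) = gen_O {rot 2, sigma_x}"
  "gen_O (standard_generators P3M1) = gen_O {rot 3, sigma_x}"
  "gen_O (standard_generators P31M) = gen_O {rot 3, sigma_y}"
  "gen_O (standard_generators P4M) = gen_O {rot 4, sigma_x}"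
  "gen_O (standard_generators P6M) = gen_O {rot 6, sigma_y}"
proof -
  have "gen_O {} = gen_O {rot 1}"
    unfolding rotation_1 by (simp only: orth.generate_empty orth.generate_one)
  then show "gen_O (standard_generators P1) = gen_O {rot 1}" by simp
qed (use generate_reflection[of sigma_x] generate_two_reflections in simp_all)

lemma standard_basis_matrices:
  "basis_matrix (vector [1, 0]) (vector [0, 1]) (rot 1) (1, 0, 0, 1)"
  "basis_matrix (vector [1, 0]) (vector [0, 1]) (rot 2) (-1, 0, 0, -1)"
  "basis_matrix (vector [1, 0]) (vector [0, 1]) (rot 4) (0, 1, -1, 0)"
  "basis_matrix (vector [1, 0]) (vector [0, 1]) sigma_x (-1, 0, 0, 1)"
  "basis_matrix (vector [1, 1]) (vector [-1, 1]) (rot 1) (1, 0, 0, 1)"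
  "basis_matrix (vector [1, 1]) (vector [-1, 1]) (rot 2) (-1, 0, 0, -1)"
  "basis_matrix (vector [1, 1]) (vector [-1, 1]) sigma_x (0, 1, 1, 0)"
  "basis_matrix (vector [1, 0]) (vector [1/2, sqrt 3 / 2]) (rot 3) (-1, 1, -1, 0)"
  "basis_matrix (vector [1, 0]) (vector [1/2, sqrt 3 / 2]) (rot 6) (0, 1, -1, 1)"
  "basis_matrix (vector [1, 0]) (vector [1/2, sqrt 3 / 2]) sigma_x (-1, 0, -1, 1)"
  "basis_matrix (vector [1, 0]) (vector [1/2, sqrt 3 / 2]) sigma_y (1, 0, 1, -1)"
  unfolding rotation_values
  by (simp_all add: basis_matrix_def vec2_eq_iff matrix_vector_mult_def sum_2 sigma_x_def sigma_y_def)

lemmas table_facts = lattice_basis_standard standard_generators_eq standard_basis_matrices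

lemmas table_defs = square_lattice_def rhombic_lattice_def hexagonal_lattice_def invariant_values_eq

text \<open>The last column reflects the action on the lattice modulo 2. On the hexagonal lattice
  the rotation permutes the three nonzero classes cyclically, so nothing invariant is left. The
  quarter turn on the square lattice and the reflection on the rhombic one swap the basis vectors
  and leave one dimension. In the other rows the action is trivial modulo 2.\<close>

lemma table:
  fixes E :: "'e topology"
  assumes "space_group S" "universal_space (point_group S) E \<psi>"
  shows "table_row S E \<psi> P1 (is_cyclic_of_order 1) True 2 0 2"
    and "table_row S E \<psi> P2 (is_cyclic_of_order 2) True 3 1 2"
    and "table_row S E \<psi> P3 (is_cyclic_of_order 3) True 0 0 0"
    and "table_row S E \<psi> P4 (is_cyclic_of_order 4) True 2 1 1"
    and "table_row S E \<psi> P6 (is_cyclic_of_order 6) True 1 1 0"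
    and "table_row S E \<psi> PM (is_dihedral 1) False 3 1 2"
    and "table_row S E \<psi> CM (is_dihedral 1) False 2 1 1"
    and "table_row S E \<psi> PMM (is_dihedral 2) False 4 2 2"
    and "table_row S E \<psi> CMM (is_dihedral 2) False 3 2 1"
    and "table_row S E \<psi> P3M1 (is_dihedral 3) False 1 1 0"
    and "table_row S E \<psi> P31M (is_dihedral 3) False 1 1 0"
    and "table_row S E \<psi> P4M (is_dihedral 4) False 3 2 1"
    and "table_row S E \<psi> P6M (is_dihedral 6) False 2 2 0"
  subgoal by (rule cyclic_row[OF assms, where u = "vector [1, 0]" and v = "vector [0, 1]" and Q = "(1,0,0,1)"]; (rule table_facts | simp add: table_defs))
  subgoal by (rule cyclic_row[OF assms, where u = "vector [1, 0]" and v = "vector [0, 1]" and Q = "(-1,0,0,-1)"]; (rule table_facts | simp add: table_defs))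
  subgoal by (rule cyclic_row[OF assms, where u = "vector [1, 0]" and v = "vector [1/2, sqrt 3 / 2]" and Q = "(-1,1,-1,0)"]; (rule table_facts | simp add: table_defs))
  subgoal by (rule cyclic_row[OF assms, where u = "vector [1, 0]" and v = "vector [0, 1]" and Q = "(0,1,-1,0)"]; (rule table_facts | simp add: table_defs))
  subgoal by (rule cyclic_row[OF assms, where u = "vector [1, 0]" and v = "vector [1/2, sqrt 3 / 2]" and Q = "(0,1,-1,1)"]; (rule table_facts | simp add: table_defs))
  subgoal by (rule dihedral_row[OF assms, where u = "vector [1, 0]" and v = "vector [0, 1]" and Q = "(1,0,0,1)" and R = "(-1,0,0,1)" and s = sigma_x]; (rule table_facts | simp add: table_defs))
  subgoal by (rule dihedral_row[OF assms, where u = "vector [1, 1]" and v = "vector [-1, 1]" and Q = "(1,0,0,1)" and R = "(0,1,1,0)" and s = sigma_x]; (rule table_facts | simp add: table_defs))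
  subgoal by (rule dihedral_row[OF assms, where u = "vector [1, 0]" and v = "vector [0, 1]" and Q = "(-1,0,0,-1)" and R = "(-1,0,0,1)" and s = sigma_x]; (rule table_facts | simp add: table_defs))
  subgoal by (rule dihedral_row[OF assms, where u = "vector [1, 1]" and v = "vector [-1, 1]" and Q = "(-1,0,0,-1)" and R = "(0,1,1,0)" and s = sigma_x]; (rule table_facts | simp add: table_defs))
  subgoal by (rule dihedral_row[OF assms, where u = "vector [1, 0]" and v = "vector [1/2, sqrt 3 / 2]" and Q = "(-1,1,-1,0)" and R = "(-1,0,-1,1)" and s = sigma_x]; (rule table_facts | simp add: table_defs))
  subgoal by (rule dihedral_row[OF assms, where u = "vector [1, 0]" and v = "vector [1/2, sqrt 3 / 2]" and Q = "(-1,1,-1,0)" and R = "(1,0,1,-1)" and s = sigma_y]; (rule table_facts | simp add: table_defs))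
  subgoal by (rule dihedral_row[OF assms, where u = "vector [1, 0]" and v = "vector [0, 1]" and Q = "(0,1,-1,0)" and R = "(-1,0,0,1)" and s = sigma_x]; (rule table_facts | simp add: table_defs))
  subgoal by (rule dihedral_row[OF assms, where u = "vector [1, 0]" and v = "vector [1/2, sqrt 3 / 2]" and Q = "(0,1,-1,1)" and R = "(1,0,1,-1)" and s = sigma_y]; (rule table_facts | simp add: table_defs))
  done

theorem corollary1p4:
  fixes S :: "((real^2) \<times> (real^2^2)) set"
    and E :: "'e topology"
    and \<psi> :: "real^2^2 \<Rightarrow> 'e \<Rightarrow> 'e"
  assumes "space_group S"
    and "universal_space (point_group S) E \<psi>"
  shows "let P = point_group S;
             T = torus (translation_lattice S);
             H1 = equivariant_cohomology 1 P E \<psi> T torus_action Z2;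
             F1 = equivariant_F1H1 P E \<psi> T torus_action Z2;
             row = (\<lambda>t P_is ori h f q.
               has_plane_type S t \<longrightarrow>
                 P_is P \<and> (preserves_orientation P \<longleftrightarrow> ori) \<and>
                 H1 \<cong> Z2_sum h \<and> H1\<lparr>carrier := F1\<rparr> \<cong> Z2_sum f \<and> H1 Mod F1 \<cong> Z2_sum q)
         in row P1   (is_cyclic_of_order 1) True  2 0 2
          \<and> row P2   (is_cyclic_of_order 2) True  3 1 2
          \<and> row P3   (is_cyclic_of_order 3) True  0 0 0
          \<and> row P4   (is_cyclic_of_order 4) True  2 1 1
          \<and> row P6   (is_cyclic_of_order 6) True  1 1 0
          \<and> row PM   (is_dihedral 1)        False 3 1 2
          \<and> row CM   (is_dihedral 1)        False 2 1 1
          \<and> row PMM  (is_dihedral 2)        False 4 2 2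
          \<and> row CMM  (is_dihedral 2)        False 3 2 1
          \<and> row P3M1 (is_dihedral 3)        False 1 1 0
          \<and> row P31M (is_dihedral 3)        False 1 1 0
          \<and> row P4M  (is_dihedral 4)        False 3 2 1
          \<and> row P6M  (is_dihedral 6)        False 2 2 0"
proof -
  note rows = table[OF assms, unfolded table_row_def Let_def]
  show ?thesis unfolding Let_def by (intro conjI rows)
qed

end
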